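(* Let $\mathcal P=(\Delta,\mathcal F)$ be a simple lattice multi-polytope of dimension $n$. Let $v\in N$ be such that $\langle u_i^I,v\rangle$ is a nonzero integer for any $I\in\Sigma^{(n)}$ and $i\in I$. Then $$\sum_{I\in\Sigma^{(n)}}\frac{w(I)\,z^{\langle u_I,v\rangle}}{|N/N_I|}\sum_{g\in N/N_I}\frac{1}{\prod_{i\in I}\bigl(1-\chi_I(u_i^I,g)z^{-\langle u_i^I,v\rangle}\bigr)}=\sum_{u\in N^*}\mathrm{DH}_{\mathcal P_+}(u)z^{\langle u,v\rangle}$$ as (rational) functions of $z\in\mathbb C$.
   Context: **Multi-fans.** Let $N$ be a lattice of rank $n$ and $N_{\mathbb R}=N\otimes\mathbb R$. A cone in $N$ is a strongly convex rational polyhedral cone in $N_{\mathbb R}$ (the set of nonnegative real combinations of finitely many vectors of $N$, containing no line). $\mathrm{Cone}(N)$ is the set of all cones, partially ordered by $\tau\prec\sigma$ iff $\tau$ is a proper face of $\sigma$. A multi-fan of dimension $n$ in $N$ is a triple $\Delta=(\Sigma,C,w^{\pm})$ where $\Sigma$ is a finite partially ordered set with a unique minimum element $*$; $C:\Sigma\to\mathrm{Cone}(N)$ is a map with (1) $C( * )=\{0\}$, (2) $I<J$ implies $C(I)\prec C(J)$, (3) for each $J\in\Sigma$, $C$ restricts to an isomorphism of ordered sets from $\{I\in\Sigma: I\le J\}$ onto $\{\kappa\in\mathrm{Cone}(N):\kappa\preceq C(J)\}$; and, with $\Sigma^{(m)}=\{I\in\Sigma:\dim C(I)=m\}$ (write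 $|I|=m$ for $I\in\Sigma^{(m)}$), $w^+,w^-:\Sigma^{(n)}\to\mathbb Z_{\ge0}$ are functions such that $w^+(I)>0$ or $w^-(I)>0$ for each $I$. Put $w=w^+-w^-$. A vector $v\in N_{\mathbb R}$ is generic if it lies on no linear subspace spanned by a cone $C(I)$ of dimension $<n$. $\Delta$ is pre-complete if $\Sigma^{(n)}\ne\emptyset$ and $d_v=\sum_{v\in C(I),\,I\in\Sigma^{(n)}}w(I)$ is independent of the generic vector $v$. For $K\in\Sigma$ the projected multi-fan $\Delta_K=(\Sigma_K,C_K,w_K^\pm)$ has $\Sigma_K=\{J\in\Sigma:K\le J\}$, $C_K(J)$ = the image of $C(J)$ in the quotient of $N_{\mathbb R}$ by the span of $C(K)$ (with lattice the quotient of $N$ by the subgroup generated by $C(K)\cap N$), and $w_K^\pm$ the restrictions of $w^\pm$. $\Delta$ is complete if $\Delta$ and all $\Delta_K$, $K\in\Sigma$, are pre-complete. $\Delta$ is simplicial if every $C(I)$ is generated by linearly independent vectors; then $\Sigma$ is identified with an augmented simplicial set (abstract simplicial complex including the empty set as minimum) of subsets of $\{1,\dots,d\}$ with $\Sigma^{(1)}=\{\{1\},\dots,\{d\}\}$, and $|I|$ is the cardinality of $I$. **Multi-polytopes.** Put $V=N_{\mathbb R}$, $V^*=\mathrm{Hom}(V,\mathbb R)$, $N^*=\mathrm{Hom}(N,\mathbb Z)\subset V^*$. A multi-polytope is a pair $\mathcal P=(\Delta,\mathcal F)$ where $\Delta$ is a complete multi-fan and $\mathcal F$ assigns to each $I\in\Sigma^{(1)}$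 an affine hyperplane $\mathcal F(I)\subset V^*$ on which the elements of $C(I)$ are constant. It is simple if $\Delta$ is simplicial. For simple $\mathcal P$ let $v_i$ be the primitive vector of $N$ in $C(\{i\})$ and write $F_i=\mathcal F(\{i\})=\{u\in V^*:\langle u,v_i\rangle=c_i\}$. For $I\in\Sigma^{(n)}$, $\bigcap_{i\in I}F_i$ is a point $u_I$ (a vertex); $\{u_i^I\}_{i\in I}\subset V^*$ is the basis dual to $\{v_i\}_{i\in I}$. $\mathcal P$ is a lattice multi-polytope if every vertex $u_I$ lies in $N^*$. **Duistermaat-Heckman function.** Fix a generic $v'\in V$. For $I\in\Sigma^{(n)}$ put $(-1)^I=(-1)^{\sharp\{i\in I:\langle u_i^I,v'\rangle>0\}}$, $(u_i^I)^+=u_i^I$ if $\langle u_i^I,v'\rangle>0$ and $-u_i^I$ if $\langle u_i^I,v'\rangle<0$; let $\phi_I$ be the characteristic function of the cone with apex $u_I$ spanned by the $(u_i^I)^+$, $i\in I$. Then $\mathrm{DH}_{\mathcal P}=\sum_{I\in\Sigma^{(n)}}(-1)^Iw(I)\phi_I$ on $V^*\setminus\bigcup_iF_i$ (it is independent of $v'$ and has bounded support). $\mathcal P_+$ is the multi-polytope on $\Delta$ obtained by moving each $F_i$ slightly in the direction of $v_i$, i.e. replacing $c_i$ by $c_i+\varepsilon$ for sufficiently small $\varepsilon>0$; the moved hyperplanes miss $N^*$. **The groups $N/N_I$.** For $I\in\Sigma^{(n)}$, $N_I$ is the sublattice of $N$ generated by the $v_i$ ($i\in I$), so $N/N_I$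 is finite. For $u\in N_I^*=\mathrm{Hom}(N_I,\mathbb Z)\supset N^*$ and $g\in N/N_I$, $\chi_I(u,g)=\exp(2\pi\sqrt{-1}\langle u,v_g\rangle)$, where $v_g\in N$ represents $g$. *)

theory Defs
  imports
    "HOL-Analysis.Analysis"
    "HOL-Computational_Algebra.Group_Closure"
    "HOL-Library.Set_Algebras"
begin

text \<open>
  The real vector space \<open>N \<otimes> \<real>\<close> is the whole type \<open>'a\<close>, and \<open>N\<close> is the subgroup generated by
  some basis of it.
\<close>

definition lattice_of_rank :: "nat \<Rightarrow> 'a::real_vector set \<Rightarrow> bool" where
  "lattice_of_rank n N \<longleftrightarrow>
     (\<exists>B. finite B \<and> card B = n \<and> independent B \<and> span B = UNIV \<and> N = group_closure B)"

definition nonneg_hull :: "'a::real_vector set \<Rightarrow> 'a set" where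
  "nonneg_hull A = {(\<Sum>a\<in>A. t a *\<^sub>R a) | t. \<forall>a\<in>A. 0 \<le> t a}"

definition Cone :: "'a::real_vector set \<Rightarrow> 'a set set" where
  "Cone N = {\<sigma>. (\<exists>A. finite A \<and> A \<subseteq> N \<and> \<sigma> = nonneg_hull A) \<and>
                \<not> (\<exists>p d. d \<noteq> 0 \<and> (\<forall>t. p + t *\<^sub>R d \<in> \<sigma>))}"


subsection \<open>Multi-fans\<close>

text \<open>
  \<open>leq\<close> is the order of the index poset, as a set of pairs. The cones are subsets of an arbitrary
  type because those of a projected multi-fan are sets of cosets.
\<close>

record ('s, 'v) multi_fan =
  idx :: "'s set"
  leq :: "'s rel"
  cone_of :: "'s \<Rightarrow> 'v set"
  wplus :: "'s \<Rightarrow> nat"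
  wminus :: "'s \<Rightarrow> nat"

definition weight :: "('s, 'v) multi_fan \<Rightarrow> 's \<Rightarrow> int" where
  "weight \<Delta> I = int (wplus \<Delta> I) - int (wminus \<Delta> I)"

definition of_dim :: "('s, 'a::real_vector) multi_fan \<Rightarrow> nat \<Rightarrow> 's set" where
  "of_dim \<Delta> m = {I \<in> idx \<Delta>. dim (cone_of \<Delta> I) = m}"

text \<open>
  Members of \<^term>\<open>Cone N\<close> are nonempty, so the library's empty face plays no role here.
\<close>

definition is_multi_fan ::
    "nat \<Rightarrow> 'a::real_vector set \<Rightarrow> ('s, 'a) multi_fan \<Rightarrow> bool" where
  "is_multi_fan n N \<Delta> \<longleftrightarrow>
     finite (idx \<Delta>) \<and> partial_order_on (idx \<Delta>) (leq \<Delta>) \<and>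
     (\<forall>I\<in>idx \<Delta>. cone_of \<Delta> I \<in> Cone N) \<and>
     (\<exists>b\<in>idx \<Delta>. (\<forall>I\<in>idx \<Delta>. (b, I) \<in> leq \<Delta>) \<and> cone_of \<Delta> b = {0}) \<and>
     (\<forall>I J. (I, J) \<in> leq \<Delta> \<and> I \<noteq> J \<longrightarrow>
        cone_of \<Delta> I face_of cone_of \<Delta> J \<and> cone_of \<Delta> I \<noteq> cone_of \<Delta> J) \<and>
     (\<forall>J\<in>idx \<Delta>.
        bij_betw (cone_of \<Delta>) {I. (I, J) \<in> leq \<Delta>} {\<kappa> \<in> Cone N. \<kappa> face_of cone_of \<Delta> J} \<and>
        (\<forall>I I'. (I, J) \<in> leq \<Delta> \<and> (I', J) \<in> leq \<Delta> \<longrightarrow>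
           ((I, I') \<in> leq \<Delta> \<longleftrightarrow> cone_of \<Delta> I face_of cone_of \<Delta> I'))) \<and>
     (\<forall>I\<in>of_dim \<Delta> n. wplus \<Delta> I > 0 \<or> wminus \<Delta> I > 0)"

text \<open>
  Genericity and pre-completeness involve only the linear structure of the ambient space. They are
  stated for a space with carrier \<open>V\<close>, linear hull operator \<open>sp\<close>, dimension function \<open>dm\<close> and
  dimension \<open>n\<close>, so as to apply both to \<open>'a\<close> and to its quotients.
\<close>

definition generic_in ::
    "('v set \<Rightarrow> 'v set) \<Rightarrow> ('v set \<Rightarrow> nat) \<Rightarrow> nat \<Rightarrow> ('s, 'v) multi_fan \<Rightarrow> 'v \<Rightarrow> bool" where
  "generic_in sp dm n \<Delta> v \<longleftrightarrow>
     (\<forall>I\<in>idx \<Delta>. dm (cone_of \<Delta> I) < n \<longrightarrow> v \<notin> sp (cone_of \<Delta> I))"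

definition pre_complete_in ::
    "'v set \<Rightarrow> ('v set \<Rightarrow> 'v set) \<Rightarrow> ('v set \<Rightarrow> nat) \<Rightarrow> nat \<Rightarrow> ('s, 'v) multi_fan \<Rightarrow> bool" where
  "pre_complete_in V sp dm n \<Delta> \<longleftrightarrow>
     {I \<in> idx \<Delta>. dm (cone_of \<Delta> I) = n} \<noteq> {} \<and>
     (\<exists>d. \<forall>v\<in>V. generic_in sp dm n \<Delta> v \<longrightarrow>
        (\<Sum>I | I \<in> idx \<Delta> \<and> dm (cone_of \<Delta> I) = n \<and> v \<in> cone_of \<Delta> I. weight \<Delta> I) = d)"

text \<open>
  The quotient of \<open>'a\<close> by a subspace \<open>W\<close> has the cosets \<open>x +o W\<close> as its elements. The linear hull
  of a set \<open>X\<close> of cosets is the image of the linear hull of its preimage \<open>\<Union>X\<close>; the latter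
  contains \<open>W\<close> unless \<open>X\<close> is empty.
\<close>

definition quot :: "'a::real_vector set \<Rightarrow> 'a set set" where
  "quot W = range (\<lambda>x. x +o W)"

definition quot_span :: "'a::real_vector set \<Rightarrow> 'a set set \<Rightarrow> 'a set set" where
  "quot_span W X = (\<lambda>x. x +o W) ` span (\<Union>X)"

definition quot_dim :: "'a::real_vector set \<Rightarrow> 'a set set \<Rightarrow> nat" where
  "quot_dim W X = dim (\<Union>X) - dim W"

definition projected ::
    "('s, 'a::real_vector) multi_fan \<Rightarrow> 's \<Rightarrow> ('s, 'a set) multi_fan" where
  "projected \<Delta> K =
     \<lparr>idx = {J. (K, J) \<in> leq \<Delta>},
      leq = leq \<Delta> \<inter> {J. (K, J) \<in> leq \<Delta>} \<times> {J. (K, J) \<in> leq \<Delta>},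
      cone_of = (\<lambda>J. (\<lambda>x. x +o span (cone_of \<Delta> K)) ` cone_of \<Delta> J),
      wplus = wplus \<Delta>,
      wminus = wminus \<Delta>\<rparr>"

abbreviation generic :: "nat \<Rightarrow> ('s, 'a::real_vector) multi_fan \<Rightarrow> 'a \<Rightarrow> bool" where
  "generic n \<Delta> v \<equiv> generic_in span dim n \<Delta> v"

definition complete_multi_fan ::
    "nat \<Rightarrow> 'a::real_vector set \<Rightarrow> ('s, 'a) multi_fan \<Rightarrow> bool" where
  "complete_multi_fan n N \<Delta> \<longleftrightarrow>
     is_multi_fan n N \<Delta> \<and>
     pre_complete_in UNIV span dim n \<Delta> \<and>
     (\<forall>K\<in>idx \<Delta>.
        let W = span (cone_of \<Delta> K) in
          pre_complete_in (quot W) (quot_span W) (quot_dim W)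
            (n - dim (cone_of \<Delta> K)) (projected \<Delta> K))"

definition simplicial_fan :: "('s, 'a::real_vector) multi_fan \<Rightarrow> bool" where
  "simplicial_fan \<Delta> \<longleftrightarrow>
     (\<forall>I\<in>idx \<Delta>. \<exists>A. finite A \<and> independent A \<and> cone_of \<Delta> I = nonneg_hull A)"

text \<open>
  For a simplicial multi-fan an index \<open>I\<close> is regarded as the set of the one-dimensional indices
  below it; "\<open>i \<in> I\<close>" is rendered as \<open>i \<in> verts \<Delta> I\<close>.
\<close>

definition verts :: "('s, 'a::real_vector) multi_fan \<Rightarrow> 's \<Rightarrow> 's set" where
  "verts \<Delta> I = {i \<in> of_dim \<Delta> 1. (i, I) \<in> leq \<Delta>}"

definition primitive_vector :: "'a::real_vector set \<Rightarrow> 'a \<Rightarrow> bool" where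
  "primitive_vector N x \<longleftrightarrow>
     x \<in> N \<and> x \<noteq> 0 \<and> (\<forall>y\<in>N. \<forall>k::int. x = of_int k *\<^sub>R y \<longrightarrow> \<bar>k\<bar> = 1)"

definition prim :: "'a::real_vector set \<Rightarrow> ('s, 'a) multi_fan \<Rightarrow> 's \<Rightarrow> 'a" where
  "prim N \<Delta> i = (THE x. x \<in> cone_of \<Delta> i \<and> primitive_vector N x)"


subsection \<open>Multi-polytopes\<close>

text \<open>Elements of the dual space are functions; they are added and scaled pointwise.\<close>

definition dual_space :: "('a::real_vector \<Rightarrow> real) set" where
  "dual_space = {u. linear u}"

definition dual_lattice :: "'a::real_vector set \<Rightarrow> ('a \<Rightarrow> real) set" where
  "dual_lattice N = {u \<in> dual_space. \<forall>x\<in>N. u x \<in> \<int>}"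

text \<open>Linear forms on the dual space are evaluations at vectors, the dimension being finite.\<close>

definition affine_hyperplane :: "('a::real_vector \<Rightarrow> real) set \<Rightarrow> bool" where
  "affine_hyperplane H \<longleftrightarrow> (\<exists>x c. x \<noteq> 0 \<and> H = {u \<in> dual_space. u x = c})"

definition multi_polytope ::
    "nat \<Rightarrow> 'a::real_vector set \<Rightarrow> ('s, 'a) multi_fan \<Rightarrow> ('s \<Rightarrow> ('a \<Rightarrow> real) set) \<Rightarrow> bool" where
  "multi_polytope n N \<Delta> F \<longleftrightarrow>
     complete_multi_fan n N \<Delta> \<and>
     (\<forall>I\<in>of_dim \<Delta> 1. affine_hyperplane (F I) \<and>
        (\<forall>x\<in>cone_of \<Delta> I. (\<lambda>u. u x) constant_on F I))"

definition simple_multi_polytope ::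
    "nat \<Rightarrow> 'a::real_vector set \<Rightarrow> ('s, 'a) multi_fan \<Rightarrow> ('s \<Rightarrow> ('a \<Rightarrow> real) set) \<Rightarrow> bool" where
  "simple_multi_polytope n N \<Delta> F \<longleftrightarrow> multi_polytope n N \<Delta> F \<and> simplicial_fan \<Delta>"

definition level ::
    "'a::real_vector set \<Rightarrow> ('s, 'a) multi_fan \<Rightarrow> ('s \<Rightarrow> ('a \<Rightarrow> real) set) \<Rightarrow> 's \<Rightarrow> real" where
  "level N \<Delta> F i = (THE c. F i = {u \<in> dual_space. u (prim N \<Delta> i) = c})"

definition moved ::
    "'a::real_vector set \<Rightarrow> ('s, 'a) multi_fan \<Rightarrow> real \<Rightarrow>
     ('s \<Rightarrow> ('a \<Rightarrow> real) set) \<Rightarrow> 's \<Rightarrow> ('a \<Rightarrow> real) set" where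
  "moved N \<Delta> \<epsilon> F = (\<lambda>i. {u \<in> dual_space. u (prim N \<Delta> i) = level N \<Delta> F i + \<epsilon>})"

definition vertex ::
    "('s, 'a::real_vector) multi_fan \<Rightarrow> ('s \<Rightarrow> ('a \<Rightarrow> real) set) \<Rightarrow> 's \<Rightarrow> 'a \<Rightarrow> real" where
  "vertex \<Delta> F I = (THE u. u \<in> dual_space \<and> u \<in> (\<Inter>i\<in>verts \<Delta> I. F i))"

definition dual_vec ::
    "'a::real_vector set \<Rightarrow> ('s, 'a) multi_fan \<Rightarrow> 's \<Rightarrow> 's \<Rightarrow> 'a \<Rightarrow> real" where
  "dual_vec N \<Delta> I i =
     (THE u. u \<in> dual_space \<and> (\<forall>j\<in>verts \<Delta> I. u (prim N \<Delta> j) = (if j = i then 1 else 0)))"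

definition lattice_multi_polytope ::
    "nat \<Rightarrow> 'a::real_vector set \<Rightarrow> ('s, 'a) multi_fan \<Rightarrow> ('s \<Rightarrow> ('a \<Rightarrow> real) set) \<Rightarrow> bool" where
  "lattice_multi_polytope n N \<Delta> F \<longleftrightarrow> (\<forall>I\<in>of_dim \<Delta> n. vertex \<Delta> F I \<in> dual_lattice N)"


subsection \<open>The Duistermaat-Heckman function\<close>

definition pos_vec ::
    "'a::real_vector set \<Rightarrow> ('s, 'a) multi_fan \<Rightarrow> 'a \<Rightarrow> 's \<Rightarrow> 's \<Rightarrow> 'a \<Rightarrow> real" where
  "pos_vec N \<Delta> v' I i =
     (if dual_vec N \<Delta> I i v' > 0 then dual_vec N \<Delta> I i else (\<lambda>x. - dual_vec N \<Delta> I i x))"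

definition vertex_cone ::
    "'a::real_vector set \<Rightarrow> ('s, 'a) multi_fan \<Rightarrow> ('s \<Rightarrow> ('a \<Rightarrow> real) set) \<Rightarrow> 'a \<Rightarrow> 's \<Rightarrow>
     ('a \<Rightarrow> real) set" where
  "vertex_cone N \<Delta> F v' I =
     {\<lambda>x. vertex \<Delta> F I x + (\<Sum>i\<in>verts \<Delta> I. t i * pos_vec N \<Delta> v' I i x) | t.
        \<forall>i\<in>verts \<Delta> I. 0 \<le> t i}"

text \<open>
  As a function, \<open>DH\<close> is only meaningful off the hyperplanes \<open>F i\<close>; on them the sum may depend on
  the auxiliary vector \<open>v'\<close>.
\<close>

definition DH ::
    "nat \<Rightarrow> 'a::real_vector set \<Rightarrow> ('s, 'a) multi_fan \<Rightarrow> ('s \<Rightarrow> ('a \<Rightarrow> real) set) \<Rightarrow> 'a \<Rightarrow>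
     ('a \<Rightarrow> real) \<Rightarrow> int" where
  "DH n N \<Delta> F v' u =
     (\<Sum>I\<in>of_dim \<Delta> n. (- 1) ^ card {i \<in> verts \<Delta> I. dual_vec N \<Delta> I i v' > 0} *
        weight \<Delta> I * indicator (vertex_cone N \<Delta> F v' I) u)"


subsection \<open>The finite groups and their characters\<close>

definition sublat :: "'a::real_vector set \<Rightarrow> ('s, 'a) multi_fan \<Rightarrow> 's \<Rightarrow> 'a set" where
  "sublat N \<Delta> I = group_closure (prim N \<Delta> ` verts \<Delta> I)"

definition quot_group :: "'a::real_vector set \<Rightarrow> ('s, 'a) multi_fan \<Rightarrow> 's \<Rightarrow> 'a set set" where
  "quot_group N \<Delta> I = (\<lambda>x. x +o sublat N \<Delta> I) ` N"

text \<open>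
  The value does not depend on the representative of the coset \<open>g\<close> when \<open>u\<close> is integral on
  \<^term>\<open>sublat N \<Delta> I\<close>.
\<close>

definition chi :: "('a::real_vector \<Rightarrow> real) \<Rightarrow> 'a set \<Rightarrow> complex" where
  "chi u g = exp (2 * of_real pi * \<i> * of_real (u (SOME x. x \<in> g)))"

text \<open>
  The exponents used below are pairings whose values are integers, although of type \<^typ>\<open>real\<close>.
\<close>

definition zpow :: "complex \<Rightarrow> real \<Rightarrow> complex" where
  "zpow z r = z powi \<lfloor>r\<rfloor>"

end

theory Submission
  imports Defs "HOL-Complex_Analysis.Complex_Analysis"
begin

text \<open>
  Expand every factor on the left as a geometric series in the region \<open>0 < \<bar>z\<bar> < 1\<close>. Averaging over
  \<open>N / N\<^sub>I\<close> removes the exponents outside \<open>N\<^sup>*\<close>, and what remains is the generating function of the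
  lattice points of the cone with apex \<open>u\<^sub>I\<close>, whose facets are open or closed exactly as for the moved
  hyperplanes. The left hand side is therefore the generating function of \<open>DH\<close> computed with the
  auxiliary vector \<open>v\<close>.

  Up to sign, \<open>DH\<close> at \<open>u\<close> is the number \<open>d\<^sub>v\<close> of a multi-fan in which the generator of each ray is
  multiplied by the sign of its pairing with \<open>u\<close> minus \<open>c\<^sub>i + \<epsilon>\<close>. Such a sum is independent of the
  auxiliary vector, because the weights balance along each facet by pre-completeness of the
  projected multi-fans. Varying the auxiliary vector also bounds the support of \<open>DH\<close>, so the identity
  is one between rational functions, and it extends from the punctured disc by analytic continuation.
\<close>

text \<open>The collection with reflected rays is not known to come from a complete multi-fan, so
  constancy of its \<open>d_v\<close> cannot be quoted from the hypotheses. What survives reflection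
  is the condition in codimension one: negating \<open>e i\<close> negates \<open>U J i\<close>, and
  if the weights are multiplied by the product of all signs, each facet sum is merely multiplied by
  the signs of the vertices of that facet and stays 0. Constancy is therefore rederived from the
  facet sums alone, by moving along a line that never crosses two facet hyperplanes of one cone at
  the same moment.

  Independence of the auxiliary vector is used in two ways. The expansion yields DH for the given
  \<open>v\<close>, while the claim concerns an arbitrary generic vector. And each single vertex
  cone is unbounded: only the comparison of different auxiliary vectors shows that the support is
  bounded, since \<open>u\<close> must lie in some vertex cone for \<open>y\<close> and in another
  one for \<open>- y\<close>, which confines \<open>u y\<close> between values of vertices at
  \<open>y\<close>.

  Since the vertices are lattice points, "sufficiently small" can be made explicit: every \<epsilon>
  with 0 < \<epsilon> < 1 will do.\<close>

section \<open>Balanced collections of simplicial cones\<close>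

text \<open>
  The numbers \<open>a i / p i\<close> are the times at which the line \<open>a - t p\<close> crosses the coordinate hyperplanes.
\<close>

lemma orthant_crossings_between:
  fixes a p :: "'i \<Rightarrow> real"
  assumes "finite I"
    and "\<And>i. i \<in> I \<Longrightarrow> p i \<noteq> 0"
    and "\<And>i j. i \<in> I \<Longrightarrow> j \<in> I \<Longrightarrow> i \<noteq> j \<Longrightarrow> a i / p i \<noteq> a j / p j"
    and "s \<le> t"
    and "\<And>i. i \<in> I \<Longrightarrow> a i / p i \<noteq> s \<and> a i / p i \<noteq> t"
  shows "of_bool (\<forall>i\<in>I. s * p i < a i) - of_bool (\<forall>i\<in>I. t * p i < a i) =
    (\<Sum>i\<in>I. sgn (p i) * of_bool (s < a i / p i \<and> a i / p i < t \<and>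
       (\<forall>j\<in>I - {i}. a i / p i * p j < a j)))"
  using assms
proof (induction I arbitrary: s t rule: finite_induct)
  case empty
  then show ?case by simp
next
  case (insert k I)
  define r where "r = (\<lambda>i. a i / p i)"
  define g where "g = (\<lambda>x. \<forall>i\<in>I. x * p i < a i)"
  define c where "c = (\<lambda>i x y. sgn (p i) * of_bool (x < r i \<and> r i < y \<and> (\<forall>j\<in>I - {i}. r i * p j < a j)))"
  have pk: "p k \<noteq> 0" using insert.prems by auto
  have rne: "r i \<noteq> r k" if "i \<in> I" for i using insert.prems(2)[of i k] insert.hyps that by (auto simp: r_def)
  have rst: "r k \<noteq> s" "r k \<noteq> t" using insert.prems(4)[of k] by (auto simp: r_def)
  have IH: "of_bool (g x) - of_bool (g y) = (\<Sum>i\<in>I. c i x y)"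
    if "x \<le> y" "\<And>i. i \<in> I \<Longrightarrow> r i \<noteq> x \<and> r i \<noteq> y" for x y
    using insert.IH[of x y] insert.prems that unfolding g_def c_def r_def by auto
  have h: "x * p k < a k \<longleftrightarrow> (if p k > 0 then x < r k else r k < x)" for x
    using pk by (auto simp: r_def field_simps)
  have diff: "insert k I - {i} = insert k (I - {i})" if "i \<in> I" for i
    using that insert.hyps by auto
  have Ik: "insert k I - {k} = I" using insert.hyps by auto
  have RHS: "(\<Sum>i\<in>insert k I. sgn (p i) * of_bool (s < r i \<and> r i < t \<and>
       (\<forall>j\<in>insert k I - {i}. r i * p j < a j)))
     = sgn (p k) * of_bool (s < r k \<and> r k < t \<and> g (r k)) +
       (\<Sum>i\<in>I. if r i * p k < a k then c i s t else 0)"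
    by (subst sum.insert[OF insert.hyps], rule arg_cong2[where f = "(+)"])
      (auto simp: Ik diff g_def c_def intro!: sum.cong)
  have LHS: "(of_bool (\<forall>i\<in>insert k I. s * p i < a i) - of_bool (\<forall>i\<in>insert k I. t * p i < a i) :: real)
    = of_bool (s * p k < a k \<and> g s) - of_bool (t * p k < a k \<and> g t)"
    by (auto simp: g_def)
  have rs: "r i \<noteq> s \<and> r i \<noteq> t" if "i \<in> I" for i using insert.prems(4) that by (auto simp: r_def)
  have "of_bool (s * p k < a k \<and> g s) - of_bool (t * p k < a k \<and> g t) =
     sgn (p k) * of_bool (s < r k \<and> r k < t \<and> g (r k)) +
       (\<Sum>i\<in>I. if r i * p k < a k then c i s t else 0)"
  \<comment> \<open>If the crossing time of the new coordinate \<open>k\<close> lies outside the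
    interval, the sign of \<open>a k - x * p k\<close> is constant on it. Otherwise that inequality
    holds on exactly one side of \<open>r k\<close>; the induction hypothesis is applied to this
    subinterval, and its end \<open>r k\<close> supplies the crossing term of \<open>k\<close>.
    Hence the induction keeps \<open>s\<close> and \<open>t\<close> arbitrary.\<close>
  proof (cases "s < r k \<and> r k < t")
    case False
    then have out: "r k < s \<or> t < r k" using rst by auto
    have same: "c i s t = 0 \<or> (r i * p k < a k \<longleftrightarrow> s * p k < a k)" for i
      using out by (auto simp: c_def h)
    have "(t * p k < a k) = (s * p k < a k)" using out insert.prems(3) by (auto simp: h)
    moreover have "(\<Sum>i\<in>I. if r i * p k < a k then c i s t else 0) =
        (\<Sum>i\<in>I. if s * p k < a k then c i s t else 0)"
      by (rule sum.cong) (use same in auto)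
    ultimately show ?thesis
      using False IH[of s t] rs insert.prems(3) by (cases "s * p k < a k") auto
  next
    case True
    show ?thesis
    proof (cases "p k > 0")
      case pos: True
      have "(\<Sum>i\<in>I. if r i * p k < a k then c i s t else 0) = (\<Sum>i\<in>I. c i s (r k))"
        by (rule sum.cong) (use True pos in \<open>auto simp: h c_def\<close>)
      then show ?thesis using True pos IH[of s "r k"] rs rne by (auto simp: h)
    next
      case neg: False
      have "(\<Sum>i\<in>I. if r i * p k < a k then c i s t else 0) = (\<Sum>i\<in>I. c i (r k) t)"
        by (rule sum.cong) (use True neg in \<open>auto simp: h c_def\<close>)
      then show ?thesis using True neg pk IH[of "r k" t] rs rne by (auto simp: h)
    qed
  qed
  then show ?case using RHS LHS unfolding r_def by simp
qed

text \<open>The end time is moved beyond all crossings, where each coordinate of a - t p has the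
  sign of - p.\<close>

lemma orthant_crossings:
  fixes a p :: "'i \<Rightarrow> real"
  assumes "finite I"
    and "\<And>i. i \<in> I \<Longrightarrow> p i \<noteq> 0"
    and "\<And>i. i \<in> I \<Longrightarrow> a i \<noteq> 0"
    and "\<And>i j. i \<in> I \<Longrightarrow> j \<in> I \<Longrightarrow> i \<noteq> j \<Longrightarrow> a i / p i \<noteq> a j / p j"
  shows "of_bool (\<forall>i\<in>I. 0 < a i) = of_bool (\<forall>i\<in>I. p i < 0) +
    (\<Sum>i\<in>I. sgn (p i) * of_bool (0 < a i / p i \<and> (\<forall>j\<in>I - {i}. a i / p i * p j < a j)))"
proof -
  define t where "t = 1 + (\<Sum>i\<in>I. \<bar>a i / p i\<bar>)"
  have t: "a i / p i < t" if "i \<in> I" for i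
  proof -
    have "\<bar>a i / p i\<bar> \<le> (\<Sum>i\<in>I. \<bar>a i / p i\<bar>)"
      by (rule member_le_sum) (use assms(1) that in auto)
    then show ?thesis unfolding t_def by linarith
  qed
  have t0: "0 \<le> t" unfolding t_def by (simp add: sum_nonneg)
  have "t * p i < a i \<longleftrightarrow> p i < 0" if "i \<in> I" for i
  proof (cases "p i < 0")
    case True
    then show ?thesis using t[OF that] by (simp add: divide_less_eq)
  next
    case False
    then have "p i > 0" using assms(2)[OF that] by simp
    then show ?thesis using t[OF that] by (simp add: divide_less_eq)
  qed
  then have "(\<forall>i\<in>I. t * p i < a i) \<longleftrightarrow> (\<forall>i\<in>I. p i < 0)" by blast
  moreover have "of_bool (\<forall>i\<in>I. 0 * p i < a i) - of_bool (\<forall>i\<in>I. t * p i < a i) =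
    (\<Sum>i\<in>I. sgn (p i) * of_bool (0 < a i / p i \<and> a i / p i < t \<and>
       (\<forall>j\<in>I - {i}. a i / p i * p j < a j)))"
    by (rule orthant_crossings_between[OF assms(1,2,4) t0])
      (use assms(2,3) t in \<open>auto simp: order.strict_iff_order\<close>)
  moreover have "\<dots> = (\<Sum>i\<in>I. sgn (p i) * of_bool (0 < a i / p i \<and>
       (\<forall>j\<in>I - {i}. a i / p i * p j < a j)))"
    by (rule sum.cong) (use t in auto)
  ultimately show ?thesis by simp
qed

text \<open>Finitely many proper hyperplanes do not cover a real vector space. If the new form
  \<open>f\<close> vanishes at the vector \<open>p\<close> found so far and \<open>f q\<close> is
  nonzero, then \<open>f\<close> is a nonzero constant on the line t p + q, and each old form
  vanishes there for only one t.\<close>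

lemma exists_vector_off_kernels:
  fixes \<Phi> :: "('a::real_vector \<Rightarrow> real) set"
  assumes "finite \<Phi>" "\<And>f. f \<in> \<Phi> \<Longrightarrow> linear f" "\<And>f. f \<in> \<Phi> \<Longrightarrow> \<exists>x. f x \<noteq> 0"
  obtains p where "\<And>f. f \<in> \<Phi> \<Longrightarrow> f p \<noteq> 0"
proof -
  have "\<exists>p. \<forall>f\<in>\<Phi>. f p \<noteq> 0" using assms
  proof (induction rule: finite_induct)
    case (insert f \<Phi>)
    then obtain p q where p: "\<forall>g\<in>\<Phi>. g p \<noteq> 0" and q: "f q \<noteq> 0" by (metis insertCI)
    have "finite ((\<lambda>g. - g q / g p) ` \<Phi> \<union> {- f p / f q} \<union> {0})" using insert.hyps by simp
    then obtain t where t: "t \<notin> (\<lambda>g. - g q / g p) ` \<Phi> \<union> {- f p / f q} \<union> {0 :: real}"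
      using ex_new_if_finite[OF infinite_UNIV_char_0] by (metis (no_types, lifting))
    define x where "x = (if f p \<noteq> 0 then p else t *\<^sub>R p + q)"
    have "g x \<noteq> 0" if "g \<in> insert f \<Phi>" for g
    proof (cases "f p = 0")
      case True
      have "linear g" using insert.prems that by auto
      then have gx: "g x = t * g p + g q" using True by (simp add: x_def linear_add linear_scale)
      show ?thesis
      proof (cases "g = f")
        case False
        then have "g p \<noteq> 0" "t \<noteq> - g q / g p" using that p t by auto
        then show ?thesis unfolding gx by (auto simp: field_simps)
      qed (use gx True q in auto)
    qed (use that p in \<open>auto simp: x_def\<close>)
    then show ?case by blast
  qed auto
  then obtain p where "\<forall>f\<in>\<Phi>. f p \<noteq> 0" by blast
  then show ?thesis by (intro that[of p]) auto
qed

text \<open>\<open>facet J i\<close> is an index rather than the vertex set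
  \<open>V J - {i}\<close>: two indices of a multi-fan can have the same vertices, and the weights
  balance around each index separately. In \<open>balance\<close> the sign of \<open>U J i p\<close>
  tells whether \<open>p\<close> lies on the same side of the facet as the cone of
  \<open>J\<close>.\<close>

locale balanced_cones =
  fixes D :: "'s set" and V :: "'s \<Rightarrow> 'i set" and e :: "'i \<Rightarrow> 'a::real_vector"
    and U :: "'s \<Rightarrow> 'i \<Rightarrow> 'a \<Rightarrow> real" and w :: "'s \<Rightarrow> int" and facet :: "'s \<Rightarrow> 'i \<Rightarrow> 's"
  assumes finite_D: "finite D"
    and finite_V: "J \<in> D \<Longrightarrow> finite (V J)"
    and linear_U: "J \<in> D \<Longrightarrow> i \<in> V J \<Longrightarrow> linear (U J i)"
    and U_e: "J \<in> D \<Longrightarrow> i \<in> V J \<Longrightarrow> j \<in> V J \<Longrightarrow> U J i (e j) = (if j = i then 1 else 0)"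
    and U_expand: "J \<in> D \<Longrightarrow> (\<Sum>i\<in>V J. U J i x *\<^sub>R e i) = x"
    and V_facet: "J \<in> D \<Longrightarrow> i \<in> V J \<Longrightarrow> V (facet J i) = V J - {i}"
    and balance: "(\<And>J i. J \<in> D \<Longrightarrow> i \<in> V J \<Longrightarrow> U J i p \<noteq> 0) \<Longrightarrow>
      (\<Sum>(J, i) | (J, i) \<in> Sigma D V \<and> facet J i = K. of_int (w J) * sgn (U J i p)) = 0"
begin

text \<open>Only the hyperplanes spanned by facets of maximal cones are avoided. The vector
  \<open>v\<close> of the theorem has this property by hypothesis, and generic vectors have it by
  \<open>generic_regular\<close>.\<close>

definition regular :: "'a \<Rightarrow> bool" where
  "regular p \<longleftrightarrow> (\<forall>J\<in>D. \<forall>i\<in>V J. U J i p \<noteq> 0)"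

text \<open>This is \<open>d_x\<close> for the collection in which \<open>e i\<close> is reflected
  wherever \<open>s i\<close> is negative. The product of signs in the weight plays the part of an
  orientation: with it the reflected collection is balanced again.\<close>

definition flip_sum :: "('i \<Rightarrow> real) \<Rightarrow> 'a \<Rightarrow> real" where
  "flip_sum s x = (\<Sum>J\<in>D. of_int (w J) * (\<Prod>i\<in>V J. sgn (s i)) * of_bool (\<forall>i\<in>V J. 0 < s i * U J i x))"

lemma U_facet_span:
  assumes "J \<in> D" "i \<in> V J" "x \<in> span (e ` (V J - {i}))"
  shows "U J i x = 0"
proof -
  have "U J i y = 0" if "y \<in> e ` (V J - {i})" for y
    using that U_e assms(1,2) by (auto split: if_splits)
  then show ?thesis
    using linear_eq_0_on_span[OF linear_U[OF assms(1,2)] _ assms(3)] by blast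
qed

lemma U_nonzero: "J \<in> D \<Longrightarrow> i \<in> V J \<Longrightarrow> U J i (e i) \<noteq> 0"
  using U_e by simp

text \<open>On the span of the common vertices both functionals are the coordinate belonging to
  \<open>e j\<close>.\<close>

lemma U_facet_eq:
  assumes J: "J \<in> D" "i \<in> V J" "J' \<in> D" "i' \<in> V J'" and K: "V J - {i} = V J' - {i'}"
    and x: "x \<in> span (e ` (V J - {i}))" and j: "j \<in> V J - {i}"
  shows "U J j x = U J' j x"
proof -
  have "linear (\<lambda>x. U J j x - U J' j x)"
    using J j K linear_U by (intro linear_compose_sub) auto
  moreover have "U J j y - U J' j y = 0" if "y \<in> e ` (V J - {i})" for y
  proof -
    obtain k where k: "k \<in> V J - {i}" "y = e k" using \<open>y \<in> e ` (V J - {i})\<close> by blast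
    then have "k \<in> V J'" "j \<in> V J'" using K j by auto
    then show ?thesis using k U_e[of J j k] U_e[of J' j k] J j by auto
  qed
  ultimately have "U J j x - U J' j x = 0"
    using linear_eq_0_on_span[OF _ _ x, of "\<lambda>x. U J j x - U J' j x"] by blast
  then show ?thesis by simp
qed

text \<open>General position: a line from \<open>y\<close> in direction \<open>p\<close> meets the
  facet hyperplanes of one cone at distinct times. For a pair \<open>i\<close>, \<open>j\<close>
  this is the nonvanishing at \<open>p\<close> of a linear form whose value at \<open>e j\<close> is
  \<open>U J i y\<close>, so the form is not zero. A whole set \<open>Y\<close> is treated at once
  so that two starting points can share one \<open>p\<close>.\<close>

lemma regular_off_ratios:
  assumes "finite Y" "\<And>y. y \<in> Y \<Longrightarrow> regular y"
  obtains p where "regular p"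
    "\<And>y J i j. y \<in> Y \<Longrightarrow> J \<in> D \<Longrightarrow> i \<in> V J \<Longrightarrow> j \<in> V J \<Longrightarrow> i \<noteq> j \<Longrightarrow>
      U J i y / U J i p \<noteq> U J j y / U J j p"
proof -
  define \<Phi>1 where "\<Phi>1 = (\<Union>J\<in>D. \<Union>i\<in>V J. {U J i})"
  define \<Phi>2 where "\<Phi>2 = (\<lambda>y. \<Union>J\<in>D. \<Union>i\<in>V J. \<Union>j\<in>V J - {i}. {\<lambda>p. U J i y * U J j p - U J j y * U J i p})"
  define \<Phi> where "\<Phi> = \<Phi>1 \<union> (\<Union>y\<in>Y. \<Phi>2 y)"
  have "finite \<Phi>" unfolding \<Phi>_def \<Phi>1_def \<Phi>2_def using finite_D finite_V assms(1) by auto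
  moreover have "linear f" if "f \<in> \<Phi>" for f
    using that linear_U unfolding \<Phi>_def \<Phi>1_def \<Phi>2_def
    by (auto intro!: linear_compose_sub linear_compose_scale_right[where 'b = real, simplified])
  moreover have "\<exists>p. f p \<noteq> 0" if "f \<in> \<Phi>" for f
    using that unfolding \<Phi>_def
  proof
    assume "f \<in> \<Phi>1"
    then show ?thesis unfolding \<Phi>1_def using U_nonzero by blast
  next
    assume "f \<in> (\<Union>y\<in>Y. \<Phi>2 y)"
    then obtain y J i j where *: "y \<in> Y" "J \<in> D" "i \<in> V J" "j \<in> V J - {i}"
      "f = (\<lambda>p. U J i y * U J j p - U J j y * U J i p)"
      unfolding \<Phi>2_def by blast
    then have "f (e j) = U J i y" using U_e[of J j j] U_e[of J i j] by auto
    then have "f (e j) \<noteq> 0" using * assms(2)[of y] unfolding regular_def by auto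
    then show ?thesis by blast
  qed
  ultimately obtain p where p: "\<And>f. f \<in> \<Phi> \<Longrightarrow> f p \<noteq> 0" using exists_vector_off_kernels by blast
  have reg: "regular p" using p unfolding \<Phi>_def \<Phi>1_def regular_def by blast
  moreover have "U J i y / U J i p \<noteq> U J j y / U J j p"
    if "y \<in> Y" "J \<in> D" "i \<in> V J" "j \<in> V J" "i \<noteq> j" for y J i j
  proof -
    have "(\<lambda>p. U J i y * U J j p - U J j y * U J i p) \<in> \<Phi>2 y"
      unfolding \<Phi>2_def using that by blast
    then have "(\<lambda>p. U J i y * U J j p - U J j y * U J i p) \<in> \<Phi>"
      unfolding \<Phi>_def using that by blast
    from p[OF this] have "U J i y * U J j p \<noteq> U J j y * U J i p" by simp
    then show ?thesis using reg that unfolding regular_def by (simp add: frac_eq_eq)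
  qed
  ultimately show ?thesis by (rule that)
qed

text \<open>
  Along the ray from \<open>x\<close> in direction \<open>- p\<close> the sum changes only where a facet is crossed, and there
  the contributions of the cones containing the facet cancel by the balancing condition.
\<close>

lemma flip_sum_uminus:
  assumes s: "\<And>i. s i \<noteq> 0" and x: "regular x" and p: "regular p"
    and ratios: "\<And>J i j. J \<in> D \<Longrightarrow> i \<in> V J \<Longrightarrow> j \<in> V J \<Longrightarrow> i \<noteq> j \<Longrightarrow>
      U J i x / U J i p \<noteq> U J j x / U J j p"
  shows "flip_sum s x = flip_sum s (- p)"
proof -
  \<comment> \<open>\<open>r J i\<close> is the time at which x - t p meets the hyperplane
    \<open>U J i = 0\<close>, and \<open>y J i\<close> is the crossing point.\<close>
  define r where "r = (\<lambda>J i. U J i x / U J i p)"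
  define y where "y = (\<lambda>J i. x - r J i *\<^sub>R p)"
  define S where "S = (\<lambda>J. \<Prod>i\<in>V J. sgn (s i))"
  \<comment> \<open>What a crossing contributes apart from \<open>w J\<close> and
    \<open>sgn (U J i p)\<close>. It turns out to depend on the index \<open>facet J i\<close>
    alone, which is \<open>c_eq\<close>, so it can be taken out of a facet sum.\<close>
  define c where "c = (\<lambda>J i. S (facet J i) *
    of_bool (0 < r J i \<and> (\<forall>j\<in>V J - {i}. 0 < s j * U J j (y J i))))"
  have Uy: "U J j (y J i) = U J j x - r J i * U J j p" if "J \<in> D" "j \<in> V J" for J i j
    using linear_U[OF that] by (simp add: y_def linear_diff linear_scale)
  have y_span: "y J i \<in> span (e ` (V J - {i}))" if "J \<in> D" "i \<in> V J" for J i
  proof -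
    have "U J i (y J i) = 0" using that p Uy[of J i i] by (simp add: regular_def r_def)
    then have "y J i = (\<Sum>j\<in>V J - {i}. U J j (y J i) *\<^sub>R e j)"
      using U_expand[of J "y J i"] sum.remove[of "V J" i "\<lambda>j. U J j (y J i) *\<^sub>R e j"] that finite_V by auto
    also have "\<dots> \<in> span (e ` (V J - {i}))"
      by (intro span_sum span_scale span_base) auto
    finally show ?thesis .
  qed
  have c_eq: "c J i = c J' i'" if J: "J \<in> D" "i \<in> V J" "J' \<in> D" "i' \<in> V J'" and K: "facet J i = facet J' i'" for J i J' i'
  proof -
    have VK: "V J - {i} = V J' - {i'}" using V_facet[of J i] V_facet[of J' i'] J K by simp
    have sp: "y J i \<in> span (e ` (V J - {i}))" "y J' i' \<in> span (e ` (V J - {i}))"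
      using y_span[of J i] y_span[of J' i'] J VK by auto
    \<comment> \<open>The crossing point computed in \<open>J'\<close> lies in the span of the
      common facet, so it is a zero of \<open>U J i\<close> as well; this forces the two crossing
      times to agree.\<close>
    have "U J i (y J' i') = 0" using U_facet_span sp(2) J by blast
    then have "U J i x = r J' i' * U J i p"
      using linear_U[of J i] J by (simp add: y_def linear_diff linear_scale)
    then have r: "r J i = r J' i'" using p J by (simp add: r_def regular_def)
    then have yy: "y J i = y J' i'" by (simp add: y_def)
    have "U J j (y J i) = U J' j (y J' i')" if "j \<in> V J - {i}" for j
      using U_facet_eq[OF J VK sp(1) that] yy by simp
    then show ?thesis unfolding c_def using r K VK by auto
  qed
  have cross: "S J * of_bool (\<forall>i\<in>V J. 0 < s i * U J i x) = S J * of_bool (\<forall>i\<in>V J. 0 < s i * U J i (- p)) +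
      (\<Sum>i\<in>V J. sgn (U J i p) * c J i)" if J: "J \<in> D" for J
  proof -
    have rr: "s i * U J i x / (s i * U J i p) = r J i" for i using s by (simp add: r_def)
    have "of_bool (\<forall>i\<in>V J. 0 < s i * U J i x) = (of_bool (\<forall>i\<in>V J. s i * U J i p < 0) :: real) +
      (\<Sum>i\<in>V J. sgn (s i * U J i p) * of_bool (0 < s i * U J i x / (s i * U J i p) \<and>
        (\<forall>j\<in>V J - {i}. s i * U J i x / (s i * U J i p) * (s j * U J j p) < s j * U J j x)))"
      by (rule orthant_crossings[OF finite_V[OF J]])
        (use s x p J ratios in \<open>auto simp: regular_def\<close>)
    then have "S J * of_bool (\<forall>i\<in>V J. 0 < s i * U J i x) = S J * of_bool (\<forall>i\<in>V J. s i * U J i p < 0) +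
      (\<Sum>i\<in>V J. S J * (sgn (s i * U J i p) * of_bool (0 < r J i \<and>
        (\<forall>j\<in>V J - {i}. r J i * (s j * U J j p) < s j * U J j x))))"
      unfolding rr by (simp only: distrib_left sum_distrib_left)
    also have "(\<Sum>i\<in>V J. S J * (sgn (s i * U J i p) * of_bool (0 < r J i \<and>
        (\<forall>j\<in>V J - {i}. r J i * (s j * U J j p) < s j * U J j x)))) = (\<Sum>i\<in>V J. sgn (U J i p) * c J i)"
    proof (rule sum.cong)
      fix i assume i: "i \<in> V J"
      \<comment> \<open>\<open>sgn (s i)\<close> occurs twice, in the weight and in the crossing
        sign of the reflected cone, and cancels. This is the point where reflection is seen to
        respect the balance.\<close>
      have "S J = sgn (s i) * S (facet J i)"
        unfolding S_def V_facet[OF J i] using finite_V[OF J] i by (simp add: prod.remove)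
      moreover have "sgn (s i) * sgn (s i) = 1" using s[of i] by (simp add: sgn_if)
      ultimately have "S J * sgn (s i * U J i p) = sgn (U J i p) * S (facet J i)"
        by (simp add: sgn_mult)
      moreover have "(r J i * (s j * U J j p) < s j * U J j x) \<longleftrightarrow> 0 < s j * U J j (y J i)" if "j \<in> V J - {i}" for j
        using Uy[of J j i] J that by (auto simp: right_diff_distrib mult.left_commute)
      ultimately show "S J * (sgn (s i * U J i p) * of_bool (0 < r J i \<and>
        (\<forall>j\<in>V J - {i}. r J i * (s j * U J j p) < s j * U J j x))) = sgn (U J i p) * c J i"
        unfolding c_def by (simp add: mult.assoc[symmetric])
    qed simp
    also have "(\<forall>i\<in>V J. s i * U J i p < 0) \<longleftrightarrow> (\<forall>i\<in>V J. 0 < s i * U J i (- p))"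
      using linear_U[OF J] by (simp add: linear_neg)
    finally show ?thesis .
  qed
  define P where "P = Sigma D V"
  have finP: "finite P" unfolding P_def using finite_D finite_V by auto
  define tm where "tm = (\<lambda>(J, i). of_int (w J) * sgn (U J i p) * c J i)"
  have "flip_sum s x = (\<Sum>J\<in>D. of_int (w J) * (S J * of_bool (\<forall>i\<in>V J. 0 < s i * U J i x)))"
    by (simp add: flip_sum_def S_def mult.assoc)
  also have "\<dots> = flip_sum s (- p) + (\<Sum>J\<in>D. \<Sum>i\<in>V J. tm (J, i))"
  proof -
    have "flip_sum s (- p) = (\<Sum>J\<in>D. of_int (w J) * (S J * of_bool (\<forall>i\<in>V J. 0 < s i * U J i (- p))))"
      by (simp add: flip_sum_def S_def mult.assoc)
    then show ?thesis
      by (simp add: cross mult.assoc distrib_left sum.distrib sum_distrib_left tm_def)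
  qed
  also have "(\<Sum>J\<in>D. \<Sum>i\<in>V J. tm (J, i)) = sum tm P"
    unfolding P_def using finite_D finite_V by (subst sum.Sigma) auto
  also have "sum tm P = (\<Sum>K\<in>(\<lambda>(J, i). facet J i) ` P. \<Sum>q | q \<in> P \<and> (\<lambda>(J, i). facet J i) q = K. tm q)"
    by (rule sum.image_gen[OF finP])
  also have "\<dots> = 0"
  proof (rule sum.neutral, rule ballI)
    fix K assume "K \<in> (\<lambda>(J, i). facet J i) ` P"
    then obtain J0 i0 where J0: "(J0, i0) \<in> P" "facet J0 i0 = K" by auto
    have "(\<Sum>q | q \<in> P \<and> (\<lambda>(J, i). facet J i) q = K. tm q) =
      (\<Sum>(J, i) | (J, i) \<in> P \<and> facet J i = K. of_int (w J) * sgn (U J i p) * c J0 i0)"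
    proof (rule sum.cong)
      fix q assume q: "q \<in> {(J, i). (J, i) \<in> P \<and> facet J i = K}"
      obtain J i where "q = (J, i)" by (cases q)
      with q show "tm q = (case q of (J, i) \<Rightarrow> of_int (w J) * sgn (U J i p) * c J0 i0)"
        using c_eq[of J i J0 i0] J0 by (auto simp: tm_def P_def)
    qed auto
    also have "\<dots> = (\<Sum>(J, i) | (J, i) \<in> P \<and> facet J i = K. of_int (w J) * sgn (U J i p)) * c J0 i0"
      unfolding sum_distrib_right by (rule sum.cong) auto
    also have "\<dots> = 0" using balance[of p K] p unfolding regular_def P_def by simp
    finally show "(\<Sum>q | q \<in> P \<and> (\<lambda>(J, i). facet J i) q = K. tm q) = 0" .
  qed
  finally show ?thesis by simp
qed

lemma flip_sum_cong:
  assumes "\<And>J i. J \<in> D \<Longrightarrow> i \<in> V J \<Longrightarrow> s i = s' i"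
  shows "flip_sum s x = flip_sum s' x"
  unfolding flip_sum_def using assms by (intro sum.cong refl) (simp cong: prod.cong ball_cong)

text \<open>Both sums equal the sum at \<open>- p\<close>, for one direction \<open>p\<close> in
  general position to both vectors.\<close>

lemma flip_sum_independent:
  assumes s: "\<And>J i. J \<in> D \<Longrightarrow> i \<in> V J \<Longrightarrow> s i \<noteq> 0" and x: "regular x" "regular x'"
  shows "flip_sum s x = flip_sum s x'"
proof -
  \<comment> \<open>\<open>flip_sum_uminus\<close> asks for nonzero signs at every index. Outside
    the sets \<open>V J\<close> the value has no influence, so 0 is replaced by 1.\<close>
  define s' where "s' = (\<lambda>i. if s i = 0 then 1 else s i)"
  have s': "s' i \<noteq> 0" for i by (simp add: s'_def)
  have cong: "flip_sum s y = flip_sum s' y" for y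
    by (rule flip_sum_cong) (use s in \<open>auto simp: s'_def\<close>)
  obtain p where p: "regular p"
    "\<And>y J i j. y \<in> {x, x'} \<Longrightarrow> J \<in> D \<Longrightarrow> i \<in> V J \<Longrightarrow> j \<in> V J \<Longrightarrow> i \<noteq> j \<Longrightarrow>
      U J i y / U J i p \<noteq> U J j y / U J j p"
    by (rule regular_off_ratios[of "{x, x'}"]) (use x in auto)
  have "flip_sum s' x = flip_sum s' (- p)"
    using p(2) by (intro flip_sum_uminus[OF s' x(1) p(1)]) auto
  moreover have "flip_sum s' x' = flip_sum s' (- p)"
    using p(2) by (intro flip_sum_uminus[OF s' x(2) p(1)]) auto
  ultimately show ?thesis by (simp add: cong)
qed

end

section \<open>Generating function of a vertex cone\<close>

lemma has_sum_prod_PiE: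
  fixes f :: "'a \<Rightarrow> 'b \<Rightarrow> 'c :: {banach, real_normed_field}"
  assumes A: "finite A"
    and abs: "\<And>x. x \<in> A \<Longrightarrow> (\<lambda>b. norm (f x b)) summable_on B x"
    and s: "\<And>x. x \<in> A \<Longrightarrow> (f x has_sum s x) (B x)"
  shows "((\<lambda>g. \<Prod>x\<in>A. f x (g x)) has_sum (\<Prod>x\<in>A. s x)) (PiE A B)"
proof -
  have "(\<lambda>g. norm (\<Prod>x\<in>A. f x (g x))) summable_on PiE A B"
  \<comment> \<open>\<open>infsum\<close> takes the default value 0 on families that are not
    summable, so a nonzero product of sums of norms certifies summability of the product family. If
    one of these sums is 0, all terms of that factor vanish and the product family is 0.\<close>
  proof (cases "\<exists>x\<in>A. infsum (\<lambda>b. norm (f x b)) (B x) = 0")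
    case True
    then obtain x where x: "x \<in> A" "infsum (\<lambda>b. norm (f x b)) (B x) = 0" by blast
    then have "((\<lambda>b. norm (f x b)) has_sum 0) (B x)"
      using abs[OF x(1)] has_sum_infsum by force
    then have "norm (f x b) = 0" if "b \<in> B x" for b
      using nonneg_has_sum_le_0D[of "\<lambda>b. norm (f x b)" "B x" 0 b] that by simp
    then have "(\<Prod>x\<in>A. f x (g x)) = 0" if "g \<in> PiE A B" for g
      using that x(1) A by (auto intro!: prod_zero)
    then show ?thesis by (intro summable_on_0) simp
  next
    case False
    have "infsum (\<lambda>g. \<Prod>x\<in>A. norm (f x (g x))) (PiE A B) = (\<Prod>x\<in>A. infsum (\<lambda>b. norm (f x b)) (B x))"
      by (rule infsum_prod_PiE_abs[OF A]) (use abs in simp)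
    also have "\<dots> \<noteq> 0" using False A by auto
    finally have "(\<lambda>g. \<Prod>x\<in>A. norm (f x (g x))) summable_on PiE A B"
      using infsum_not_exists by blast
    then show ?thesis by (simp add: prod_norm)
  qed
  then have "(\<lambda>g. \<Prod>x\<in>A. f x (g x)) summable_on PiE A B"
    by (rule abs_summable_summable)
  moreover have "infsum (\<lambda>g. \<Prod>x\<in>A. f x (g x)) (PiE A B) = (\<Prod>x\<in>A. s x)"
    using infsum_prod_PiE_abs[OF A abs, of "\<lambda>x. x"] infsumI[OF s] by simp
  ultimately show ?thesis using has_sum_infsum by force
qed

lemma has_sum_finite_sum:
  fixes f :: "'i \<Rightarrow> 'a \<Rightarrow> 'b :: {topological_comm_monoid_add}"
  assumes "finite I" "\<And>i. i \<in> I \<Longrightarrow> (f i has_sum s i) A"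
  shows "((\<lambda>x. \<Sum>i\<in>I. f i x) has_sum (\<Sum>i\<in>I. s i)) A"
  using assms by induction (auto intro: has_sum_add simp: has_sum_0)

lemma has_sum_powi_nonneg:
  fixes y :: "'a :: {real_normed_field, banach}"
  assumes "norm y < 1"
  shows "((\<lambda>k. y powi k) has_sum 1 / (1 - y)) {0..}"
proof -
  have "((\<lambda>n. y ^ n) has_sum 1 / (1 - y)) UNIV"
    using assms by (intro norm_summable_imp_has_sum geometric_sums) (auto simp: norm_power)
  also have "?this \<longleftrightarrow> ?thesis"
    by (intro has_sum_reindex_bij_witness[of _ nat int]) (auto simp: power_int_def)
  finally show ?thesis .
qed

text \<open>The expansion at infinity: 1 / (1 - y) is rewritten in terms of
  \<open>inverse y\<close>, which leaves the exponents from - 1 downwards.\<close>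

lemma has_sum_powi_neg:
  fixes y :: "'a :: {real_normed_field, banach}"
  assumes "norm y > 1"
  shows "((\<lambda>k. y powi k) has_sum - 1 / (1 - y)) {..-1}"
proof -
  have "y \<noteq> 0" "y \<noteq> 1" using assms by auto
  have "((\<lambda>n. inverse y ^ n) has_sum inverse y / (1 - inverse y)) {1..}"
    using assms by (intro has_sum_geometric_from_1) (simp add: norm_inverse inverse_less_1_iff)
  also have "inverse y / (1 - inverse y) = - 1 / (1 - y)"
    using \<open>y \<noteq> 0\<close> \<open>y \<noteq> 1\<close> by (simp add: divide_simps)
  also have "((\<lambda>n. inverse y ^ n) has_sum - 1 / (1 - y)) {1..} \<longleftrightarrow> ?thesis"
    by (intro has_sum_reindex_bij_witness[of _ "\<lambda>k. nat (- k)" "\<lambda>n. - int n"])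
      (auto simp: power_int_def nat_le_iff le_nat_iff)
  finally show ?thesis .
qed

section \<open>Cosets of a sublattice and averages of characters\<close>

lemma coset_closure_eq_iff:
  "x +o group_closure S = y +o group_closure S \<longleftrightarrow> x - y \<in> group_closure S"
proof
  assume "x +o group_closure S = y +o group_closure S"
  moreover have "x \<in> x +o group_closure S"
    using zero_in_group_closure[of S] by (force simp: elt_set_plus_def)
  ultimately show "x - y \<in> group_closure S" by (auto simp: elt_set_plus_def)
next
  assume *: "x - y \<in> group_closure S"
  have "\<exists>b\<in>group_closure S. x + a = y + b" if "a \<in> group_closure S" for a
    using group_closure_add[OF * that] by (intro bexI[of _ "x - y + a"]) (auto simp: algebra_simps)
  moreover have "\<exists>b\<in>group_closure S. y + a = x + b" if "a \<in> group_closure S" for a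
    using group_closure.diff[OF that *] by (intro bexI[of _ "a - (x - y)"]) (auto simp: algebra_simps)
  ultimately show "x +o group_closure S = y +o group_closure S"
    unfolding elt_set_plus_def by blast
qed

lemma Ints_group_closure:
  assumes "linear f" "\<And>x. x \<in> S \<Longrightarrow> f x \<in> \<int>" "x \<in> group_closure S"
  shows "f x \<in> (\<int> :: real set)"
  using assms(3)
proof induction
  case (diff s t)
  then show ?case using assms(1) by (simp add: linear_diff)
qed (use assms in \<open>auto simp: linear_0\<close>)

lemma exp_2pi_Ints:
  assumes "r - s \<in> (\<int> :: real set)"
  shows "exp (2 * of_real pi * \<i> * of_real r) = exp (2 * of_real pi * \<i> * of_real s)"
proof -
  obtain k where "r - s = of_int k" using assms by (auto elim: Ints_cases)
  then have r: "r = s + of_int k" by simp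
  have "exp (2 * of_real pi * \<i> * of_real r) =
      exp (2 * of_real pi * \<i> * of_real s) * exp ((2 * of_int k * of_real pi) * \<i>)"
    unfolding r exp_add[symmetric] by (simp add: distrib_left mult_ac)
  also have "exp ((2 * of_int k * of_real pi) * \<i>) = 1"
    using exp_integer_2pi[of "of_int k"] by simp
  finally show ?thesis by simp
qed

text \<open>\<open>chi\<close> evaluates at a representative picked by \<open>SOME\<close>. The
  values of \<open>f\<close> on one coset differ by integers, so every representative gives the same
  exponential.\<close>

lemma chi_coset:
  assumes "linear f" "\<And>y. y \<in> S \<Longrightarrow> f y \<in> \<int>"
  shows "chi f (x +o group_closure S) = exp (2 * of_real pi * \<i> * of_real (f x))"
proof -
  have "x \<in> x +o group_closure S"
    using zero_in_group_closure[of S] by (force simp: elt_set_plus_def)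
  then have "(SOME y. y \<in> x +o group_closure S) \<in> x +o group_closure S" by (rule someI)
  then obtain a where a: "a \<in> group_closure S" "(SOME y. y \<in> x +o group_closure S) = x + a"
    by (auto simp: elt_set_plus_def)
  then have "f (x + a) - f x \<in> \<int>"
    using Ints_group_closure[OF assms] assms(1) by (simp add: linear_add)
  then show ?thesis unfolding chi_def a(2) by (rule exp_2pi_Ints)
qed

text \<open>Translation by \<open>y \<in> N\<close> multiplies the sum by the value of the character at \<open>y\<close>.\<close>

lemma sum_chi:
  assumes f: "linear f" and S: "\<And>y. y \<in> S \<Longrightarrow> f y \<in> \<int>"
    and N: "\<And>x y. x \<in> N \<Longrightarrow> y \<in> N \<Longrightarrow> x + y \<in> N" "\<And>x. x \<in> N \<Longrightarrow> - x \<in> N"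
    and G: "G = (\<lambda>x. x +o group_closure S) ` N"
  shows "(\<Sum>g\<in>G. chi f g) = (if \<forall>x\<in>N. f x \<in> \<int> then of_nat (card G) else 0)"
proof (cases "\<forall>x\<in>N. f x \<in> \<int>")
  case True
  have "chi f g = 1" if "g \<in> G" for g
  proof -
    obtain x where x: "x \<in> N" "g = x +o group_closure S" using \<open>g \<in> G\<close> unfolding G by blast
    then have "exp (2 * of_real pi * \<i> * of_real (f x)) = exp (2 * of_real pi * \<i> * of_real (0::real))"
      using True by (intro exp_2pi_Ints) auto
    then show ?thesis using chi_coset[OF f S] x by simp
  qed
  then show ?thesis using True by simp
next
  case False
  then obtain y where y: "y \<in> N" "f y \<notin> \<int>" by blast
  define \<zeta> where "\<zeta> = exp (2 * of_real pi * \<i> * of_real (f y) :: complex)"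
  have "\<zeta> \<noteq> 1"
  proof
    assume "\<zeta> = 1"
    then obtain k :: int where "2 * pi * f y = of_int (2 * k) * pi"
      unfolding \<zeta>_def exp_eq_1 by auto
    then have "f y = of_int k" by simp
    then show False using y by simp
  qed
  have shift: "x +o (a +o group_closure S) = (x + a) +o group_closure S" for x a
    by (rule set_plus_rearrange2)
  have tr: "a +o g \<in> G" if "a \<in> N" "g \<in> G" for a g
    using that N(1) unfolding G by (auto simp: shift)
  have "bij_betw (\<lambda>g. y +o g) G G"
  proof (rule bij_betwI[where g = "\<lambda>g. (- y) +o g"])
    show "(\<lambda>g. y +o g) \<in> G \<rightarrow> G" "(\<lambda>g. (- y) +o g) \<in> G \<rightarrow> G"
      using y tr N(2)[OF y(1)] by auto
  qed (auto simp: set_plus_rearrange2)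
  then have "(\<Sum>g\<in>G. chi f g) = (\<Sum>g\<in>G. chi f (y +o g))"
    by (rule sum.reindex_bij_betw[symmetric])
  also have "\<dots> = (\<Sum>g\<in>G. \<zeta> * chi f g)"
  proof (rule sum.cong)
    fix g assume "g \<in> G"
    then obtain x where x: "x \<in> N" "g = x +o group_closure S" unfolding G by blast
    show "chi f (y +o g) = \<zeta> * chi f g"
      using f unfolding x(2) shift by (simp add: chi_coset[OF f S] \<zeta>_def linear_add distrib_left exp_add)
  qed simp
  also have "\<dots> = \<zeta> * (\<Sum>g\<in>G. chi f g)" by (simp add: sum_distrib_left)
  finally show ?thesis using \<open>\<zeta> \<noteq> 1\<close> False by auto
qed

text \<open>A monomial in the factors is collected into the character of one functional with
  coordinates \<open>k\<close>, the form in which \<open>sum_chi\<close> computes its average. The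
  representative chosen in \<open>chi\<close> depends on \<open>g\<close> only, so it is common to
  all factors.\<close>

lemma prod_powi_chi:
  assumes I: "finite I" and U: "\<And>i. i \<in> I \<Longrightarrow> linear (U i)" and z: "z \<noteq> 0"
  shows "(\<Prod>i\<in>I. (chi (U i) g * z powi (- m i)) powi k i) =
    z powi (- (\<Sum>i\<in>I. k i * m i)) * chi (\<lambda>x. \<Sum>i\<in>I. of_int (k i) * U i x) g"
proof -
  define x where "x = (SOME x. x \<in> g)"
  have "(chi (U i) g * z powi (- m i)) powi k i =
    z powi (- (k i * m i)) * exp (2 * of_real pi * \<i> * of_real (of_int (k i) * U i x))" for i
    unfolding chi_def x_def[symmetric]
    by (simp add: power_int_mult_distrib exp_power_int mult_ac flip: power_int_mult)
  then have "(\<Prod>i\<in>I. (chi (U i) g * z powi (- m i)) powi k i) = (\<Prod>i\<in>I. z powi (- (k i * m i))) *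
     (\<Prod>i\<in>I. exp (2 * of_real pi * \<i> * of_real (of_int (k i) * U i x)))"
    by (simp add: prod.distrib)
  also have "(\<Prod>i\<in>I. z powi (- (k i * m i))) = z powi (- (\<Sum>i\<in>I. k i * m i))"
    using I z by induction (auto simp flip: power_int_add)
  also have "(\<Prod>i\<in>I. exp (2 * of_real pi * \<i> * of_real (of_int (k i) * U i x))) =
     chi (\<lambda>x. \<Sum>i\<in>I. of_int (k i) * U i x) g"
    unfolding chi_def x_def[symmetric] by (simp add: exp_sum[OF I, symmetric] sum_distrib_left)
  finally show ?thesis .
qed

lemma linear_combination: "(\<And>i. i \<in> I \<Longrightarrow> linear (U i)) \<Longrightarrow> linear (\<lambda>x. \<Sum>i\<in>I. c i * (U i x :: real))"
  by (intro linear_compose_sum ballI linear_compose_scale_right[where 'b = real, simplified]) auto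

text \<open>
  Each factor is expanded as a geometric series in \<open>z\<close>, and averaging over \<open>N / N\<^sub>I\<close> retains only the
  exponents coming from \<open>N\<^sup>*\<close>. The shift by \<open>\<epsilon>\<close> reflects that \<open>- 1 / (1 - y)\<close> expands into
  \<open>y powi k\<close> with \<open>k \<le> - 1\<close>, while \<open>1 / (1 - y)\<close> also contains the term for \<open>k = 0\<close>.
\<close>

lemma vertex_generating_function:
  fixes z :: complex
  assumes I: "finite I" and U: "\<And>i. i \<in> I \<Longrightarrow> linear (U i)"
    and dual: "\<And>i j. i \<in> I \<Longrightarrow> j \<in> I \<Longrightarrow> U i (e j) = (if j = i then 1 else 0)"
    and expand: "\<And>x. (\<Sum>i\<in>I. U i x *\<^sub>R e i) = x"
    and N: "N = group_closure B" and e: "e ` I \<subseteq> N"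
    and G: "G = (\<lambda>x. x +o group_closure (e ` I)) ` N" "finite G"
    and apex: "apex \<in> dual_lattice N" and v: "v \<in> N"
    and m: "\<And>i. i \<in> I \<Longrightarrow> U i v = of_int (m i)" "\<And>i. i \<in> I \<Longrightarrow> m i \<noteq> 0"
    and z: "z \<noteq> 0" "norm z < 1" and \<epsilon>: "0 < \<epsilon>" "\<epsilon> < 1"
  shows "((\<lambda>u. (- 1) ^ card {i \<in> I. U i v > 0} * of_bool (\<forall>i\<in>I. 0 < (u (e i) - apex (e i) - \<epsilon>) * U i v) *
      zpow z (u v)) has_sum
    zpow z (apex v) / of_nat (card G) * (\<Sum>g\<in>G. 1 / (\<Prod>i\<in>I. 1 - chi (U i) g * zpow z (- U i v))))
    (dual_lattice N)"
proof -
  define y where "y = (\<lambda>g i. chi (U i) g * z powi (- m i))"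
  \<comment> \<open>Characters have absolute value 1, so \<open>y g i\<close> has norm
    \<open>norm z powi (- m i)\<close>, which is below 1 exactly if \<open>m i < 0\<close>. Then the
    series at 0 applies, with sign 1; otherwise the series at infinity applies, with sign - 1. The
    signs are recorded in \<sigma>.\<close>
  define K where "K = (\<lambda>i. if m i < 0 then {0..} else {..- 1 :: int})"
  define \<sigma> where "\<sigma> = (\<lambda>i. if m i < 0 then 1 else - 1 :: complex)"
  define f where "f = (\<lambda>(k :: 'a \<Rightarrow> int) x. \<Sum>i\<in>I. of_int (k i) * U i x)"
  define s where "s = ((- 1) ^ card {i \<in> I. U i v > 0} :: complex)"
  have "0 \<in> N" unfolding N by (rule zero_in_group_closure)
  then have cG: "card G \<noteq> 0" using G by auto
  have lin_f: "linear (f k)" for k unfolding f_def using U by (rule linear_combination)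
  have lin_apex: "linear apex" using apex by (simp add: dual_lattice_def dual_space_def)
  have f_e: "f k (e i) = of_int (k i)" if "i \<in> I" for k i
    unfolding f_def using that I by (simp add: dual if_distrib[of "\<lambda>x. _ * x"] cong: if_cong)
  have N_add: "a + b \<in> N" if "a \<in> N" "b \<in> N" for a b
    using that unfolding N by (rule group_closure_add)
  have N_neg: "- a \<in> N" if "a \<in> N" for a
    using that unfolding N by simp
  have series: "((\<lambda>k. y g i powi k) has_sum \<sigma> i / (1 - y g i)) (K i)
      \<and> (\<lambda>k. norm (y g i powi k)) summable_on K i" if "i \<in> I" for g i
  proof -
    have ny: "norm (y g i) = norm z powi (- m i)"
      by (simp add: y_def norm_mult norm_power_int chi_def)
    show ?thesis
    proof (cases "m i < 0")
      case True
      then have "norm (y g i) < 1"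
        unfolding ny using z by (simp add: power_int_def power_less_one_iff)
      moreover from this have "norm (norm (y g i)) < 1" by simp
      ultimately show ?thesis
        using has_sum_powi_nonneg[of "y g i"] has_sum_powi_nonneg[of "norm (y g i)"] True
        unfolding K_def \<sigma>_def by (auto simp: norm_power_int summable_on_def)
    next
      case False
      then have "m i > 0" using m(2)[OF that] by simp
      then have "norm (y g i) > 1"
        unfolding ny using z by (simp add: power_int_def one_less_inverse_iff power_less_one_iff flip: power_inverse)
      moreover from this have "norm (norm (y g i)) > 1" by simp
      ultimately show ?thesis
        using has_sum_powi_neg[of "y g i"] has_sum_powi_neg[of "norm (y g i)"] False
        unfolding K_def \<sigma>_def by (auto simp: norm_power_int summable_on_def)
    qed
  qed
  have \<sigma>: "(\<Prod>i\<in>I. \<sigma> i) = s"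
  proof -
    have "(\<Prod>i\<in>I. \<sigma> i) = (\<Prod>i\<in>I. if U i v > 0 then - 1 else 1)"
    proof (rule prod.cong)
      fix i assume "i \<in> I"
      then show "\<sigma> i = (if U i v > 0 then - 1 else 1)" using m[of i] by (auto simp: \<sigma>_def)
    qed simp
    also have "\<dots> = s"
      using I by (simp add: prod.If_cases s_def Collect_conj_eq)
    finally show ?thesis .
  qed
  \<comment> \<open>The signs of the chosen expansions multiply to \<open>s\<close>. Multiplying by
    \<open>s\<close> once more removes the sign from the value of the sum and leaves on its terms
    the sign that the cone carries in DH.\<close>
  have ss: "s * s = 1" unfolding s_def by (simp flip: power_add mult_2)
  have "((\<lambda>k. \<Prod>i\<in>I. y g i powi k i) has_sum (\<Prod>i\<in>I. \<sigma> i / (1 - y g i))) (PiE I K)" for g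
    by (rule has_sum_prod_PiE[OF I]) (use series in auto)
  then have "((\<lambda>k. \<Sum>g\<in>G. \<Prod>i\<in>I. y g i powi k i) has_sum (\<Sum>g\<in>G. \<Prod>i\<in>I. \<sigma> i / (1 - y g i))) (PiE I K)"
    using G(2) by (intro has_sum_finite_sum)
  then have "((\<lambda>k. s * zpow z (apex v) / of_nat (card G) * (\<Sum>g\<in>G. \<Prod>i\<in>I. y g i powi k i)) has_sum
     s * zpow z (apex v) / of_nat (card G) * (\<Sum>g\<in>G. \<Prod>i\<in>I. \<sigma> i / (1 - y g i))) (PiE I K)"
    by (rule has_sum_cmult_right)
  also have "(\<Sum>g\<in>G. \<Prod>i\<in>I. \<sigma> i / (1 - y g i)) = s * (\<Sum>g\<in>G. 1 / (\<Prod>i\<in>I. 1 - y g i))"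
    by (simp add: prod_dividef \<sigma> sum_distrib_left)
  also have "s * zpow z (apex v) / of_nat (card G) * (s * (\<Sum>g\<in>G. 1 / (\<Prod>i\<in>I. 1 - y g i))) =
     zpow z (apex v) / of_nat (card G) * (\<Sum>g\<in>G. 1 / (\<Prod>i\<in>I. 1 - y g i))"
  proof -
    have "s * a / c * (s * b) = (s * s) * (a / c * b)" for a b c
      by (simp only: times_divide_eq_left times_divide_eq_right mult.assoc mult.left_commute[of a])
    then show ?thesis by (simp only: ss mult_1_left)
  qed
  also have "(\<Sum>g\<in>G. 1 / (\<Prod>i\<in>I. 1 - y g i)) =
     (\<Sum>g\<in>G. 1 / (\<Prod>i\<in>I. 1 - chi (U i) g * zpow z (- U i v)))"
  proof -
    have "zpow z (- U i v) = z powi (- m i)" if "i \<in> I" for i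
      unfolding zpow_def m(1)[OF that] by (simp only: of_int_minus[symmetric] floor_of_int)
    then show ?thesis unfolding y_def by (simp cong: prod.cong)
  qed
  finally have sum1: "((\<lambda>k. s * zpow z (apex v) / of_nat (card G) * (\<Sum>g\<in>G. \<Prod>i\<in>I. y g i powi k i)) has_sum
     zpow z (apex v) / of_nat (card G) * (\<Sum>g\<in>G. 1 / (\<Prod>i\<in>I. 1 - chi (U i) g * zpow z (- U i v))))
     (PiE I K)" .
  \<comment> \<open>The multi-index \<open>k\<close> belongs to the point with coordinates
    \<open>- k i\<close> relative to the apex; its monomial is then z to the power
    \<open>h k v\<close>. The point lies in the dual lattice exactly if the average of the character
    of \<open>f k\<close> is not 0.\<close>
  define h where "h = (\<lambda>k x. apex x - f k x)"
  have h_lin: "linear (h k)" for k unfolding h_def using lin_apex lin_f by (intro linear_compose_sub)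
  have hN: "h k \<in> dual_lattice N \<longleftrightarrow> (\<forall>x\<in>N. f k x \<in> \<int>)" for k
  proof -
    have "h k x \<in> \<int> \<longleftrightarrow> f k x \<in> \<int>" if "x \<in> N" for x
    proof -
      have "apex x \<in> \<int>" using apex that by (simp add: dual_lattice_def)
      then show ?thesis unfolding h_def using Ints_diff[of "apex x" "f k x"] Ints_diff[of "apex x" "apex x - f k x"] by auto
    qed
    then show ?thesis using h_lin by (simp add: dual_lattice_def dual_space_def)
  qed
  define T where "T = (\<lambda>u :: _ \<Rightarrow> real. if u \<in> dual_lattice N then s * zpow z (u v) else 0)"
  have tm: "s * zpow z (apex v) / of_nat (card G) * (\<Sum>g\<in>G. \<Prod>i\<in>I. y g i powi k i) = T (h k)" for k
  proof -
    have "(\<Sum>g\<in>G. \<Prod>i\<in>I. y g i powi k i) = z powi (- (\<Sum>i\<in>I. k i * m i)) * (\<Sum>g\<in>G. chi (f k) g)"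
      unfolding y_def f_def by (simp add: prod_powi_chi[OF I U z(1)] sum_distrib_left)
    also have "(\<Sum>g\<in>G. chi (f k) g) = (if \<forall>x\<in>N. f k x \<in> \<int> then of_nat (card G) else 0)"
      by (rule sum_chi[OF lin_f _ N_add N_neg G(1)]) (auto simp: f_e)
    finally have sumk: "(\<Sum>g\<in>G. \<Prod>i\<in>I. y g i powi k i) =
      z powi (- (\<Sum>i\<in>I. k i * m i)) * (if h k \<in> dual_lattice N then of_nat (card G) else 0)"
      by (simp add: hN)
    have fv: "f k v = of_int (\<Sum>i\<in>I. k i * m i)" unfolding f_def using m(1) by simp
    obtain a where a: "apex v = of_int a" using apex v unfolding dual_lattice_def by (auto elim: Ints_cases)
    have "zpow z (h k v) = z powi (a - (\<Sum>i\<in>I. k i * m i))"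
      unfolding h_def zpow_def fv a by (simp only: of_int_diff[symmetric] floor_of_int)
    then have "zpow z (h k v) = zpow z (apex v) * z powi (- (\<Sum>i\<in>I. k i * m i))"
      using z by (simp add: zpow_def a flip: power_int_add)
    then show ?thesis using cG by (simp add: sumk T_def)
  qed
  have inj: "inj_on h (PiE I K)"
  proof (rule inj_onI)
    fix k k' assume *: "k \<in> PiE I K" "k' \<in> PiE I K" "h k = h k'"
    have "k i = k' i" if "i \<in> I" for i
      using fun_cong[OF *(3), of "e i"] that by (simp add: h_def f_e)
    then show "k = k'" using * by (intro PiE_ext) auto
  qed
  have sum2: "(T has_sum
     zpow z (apex v) / of_nat (card G) * (\<Sum>g\<in>G. 1 / (\<Prod>i\<in>I. 1 - chi (U i) g * zpow z (- U i v))))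
     (h ` PiE I K)"
    using sum1 unfolding has_sum_reindex[OF inj] o_def tm .
  \<comment> \<open>The two index sets differ: points of the image of \<open>h\<close> outside the
    dual lattice have \<open>T\<close> equal to 0, and points of the dual lattice outside that image
    fail the sign conditions.\<close>
  show ?thesis
  proof (rule has_sum_cong_neutral[THEN iffD1, OF _ _ _ sum2])
    fix u assume u: "u \<in> dual_lattice N - h ` PiE I K"
    have lin_u: "linear u" using u by (simp add: dual_lattice_def dual_space_def)
    have "\<not> (\<forall>i\<in>I. 0 < (u (e i) - apex (e i) - \<epsilon>) * U i v)"
    proof
      assume pos: "\<forall>i\<in>I. 0 < (u (e i) - apex (e i) - \<epsilon>) * U i v"
      define k where "k = restrict (\<lambda>i. \<lfloor>apex (e i) - u (e i)\<rfloor>) I"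
      have k: "of_int (k i) = apex (e i) - u (e i)" if "i \<in> I" for i
      proof -
        have "apex (e i) - u (e i) \<in> \<int>"
          using u apex e that by (auto simp: dual_lattice_def)
        then show ?thesis using that by (auto simp: k_def elim: Ints_cases)
      qed
      have "k i \<in> K i" if "i \<in> I" for i
      proof -
        have *: "0 < (- of_int (k i) - \<epsilon>) * real_of_int (m i)" using pos k m(1) that by auto
        \<comment> \<open>As \<open>k i\<close> is an integer and 0 < \<epsilon> < 1,
          \<open>k i > - \<epsilon>\<close> amounts to \<open>k i \<ge> 0\<close> and
          \<open>k i < - \<epsilon>\<close> to \<open>k i \<le> - 1\<close>, which are the exponent
          ranges of the two expansions.\<close>
        show ?thesis
        proof (cases "m i < 0")
          case True
          then have "- of_int (k i) - \<epsilon> < 0" using * by (simp add: zero_less_mult_iff)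
          then have "real_of_int (k i) > - 1" using \<epsilon> by linarith
          then show ?thesis using True by (simp add: K_def)
        next
          case False
          then have "- of_int (k i) - \<epsilon> > 0" using * by (simp add: zero_less_mult_iff)
          then have "real_of_int (k i) < 0" using \<epsilon> by linarith
          then show ?thesis using False by (simp add: K_def)
        qed
      qed
      then have kP: "k \<in> PiE I K" by (auto simp: k_def)
      have "h k x = u x" for x
      proof -
        have "h k x = (\<Sum>i\<in>I. U i x * h k (e i))"
          using arg_cong[OF expand[of x], of "h k"] h_lin by (simp add: linear_sum linear_scale)
        also have "\<dots> = (\<Sum>i\<in>I. U i x * u (e i))"
          by (rule sum.cong) (auto simp: h_def f_e k)
        also have "\<dots> = u x"
          using arg_cong[OF expand[of x], of u] lin_u by (simp add: linear_sum linear_scale)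
        finally show ?thesis .
      qed
      then have "h k = u" by (rule ext)
      then show False using u kP by blast
    qed
    then show "(- 1) ^ card {i \<in> I. U i v > 0} * of_bool (\<forall>i\<in>I. 0 < (u (e i) - apex (e i) - \<epsilon>) * U i v) *
      zpow z (u v) = 0" by simp
  next
    fix u assume "u \<in> h ` PiE I K - dual_lattice N"
    then show "T u = 0" by (simp add: T_def)
  next
    fix u assume u: "u \<in> h ` PiE I K \<inter> dual_lattice N"
    then obtain k where k: "k \<in> PiE I K" "u = h k" by blast
    have pos: "0 < (u (e i) - apex (e i) - \<epsilon>) * U i v" if "i \<in> I" for i
    proof -
      have ki: "k i \<in> K i" using k that by auto
      have "u (e i) - apex (e i) - \<epsilon> = - of_int (k i) - \<epsilon>" using that by (simp add: k h_def f_e)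
      moreover have "0 < (- of_int (k i) - \<epsilon>) * real_of_int (m i)"
      proof (cases "m i < 0")
        case True
        then have "- of_int (k i) - \<epsilon> < 0" using ki \<epsilon> by (simp add: K_def)
        then show ?thesis using True by (simp add: zero_less_mult_iff)
      next
        case False
        then have "m i > 0" "real_of_int (k i) \<le> - 1" using ki m(2)[OF that] by (auto simp: K_def)
        then show ?thesis using \<epsilon> by (simp add: zero_less_mult_iff)
      qed
      ultimately show ?thesis using m(1) that by simp
    qed
    then have "(\<forall>i\<in>I. 0 < (u (e i) - apex (e i) - \<epsilon>) * U i v) \<longleftrightarrow> True" by blast
    then show "T u = (- 1) ^ card {i \<in> I. U i v > 0} * of_bool (\<forall>i\<in>I. 0 < (u (e i) - apex (e i) - \<epsilon>) * U i v) *
      zpow z (u v)"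
      using u by (simp only: T_def s_def) simp
  qed
qed

section \<open>Lattice points weighted by a balanced collection of cones\<close>

lemma finite_powi_eq:
  assumes "m \<noteq> 0" "c \<noteq> 0"
  shows "finite {z :: complex. c * z powi m = 1}"
proof (cases "m > 0")
  case True
  have "{z. c * z powi m = 1} \<subseteq> {z. z ^ nat m = inverse c}"
    using True assms by (auto simp: power_int_def field_simps)
  moreover have "finite {z :: complex. z ^ nat m = inverse c}" using True by (intro finite_nth_roots) auto
  ultimately show ?thesis by (rule finite_subset)
next
  case False
  have "z ^ nat (- m) = c" if "c * z powi m = 1" for z
  proof -
    have "z powi m = inverse (z ^ nat (- m))" using False by (simp add: power_int_def power_inverse)
    then have "c * inverse (z ^ nat (- m)) = 1" using that by simp
    then show ?thesis using assms by (metis inverse_unique inverse_inverse_eq mult.commute)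
  qed
  then have "{z. c * z powi m = 1} \<subseteq> {z. z ^ nat (- m) = c}" by blast
  moreover have "finite {z :: complex. z ^ nat (- m) = c}" using False assms by (intro finite_nth_roots) auto
  ultimately show ?thesis by (rule finite_subset)
qed

text \<open>Since \<open>norm c = 1\<close> and \<open>m\<close> is nonzero, all zeros of the
  denominators lie on the unit circle. So the punctured disc lies in \<open>S\<close>, and
  \<open>S\<close> is connected because its complement is finite.\<close>

lemma laurent_continuation:
  fixes f g :: "complex \<Rightarrow> complex"
  assumes T: "finite T" "\<And>c m. (c, m) \<in> T \<Longrightarrow> norm c = 1 \<and> m \<noteq> 0"
    and S: "S = {z. z \<noteq> 0 \<and> (\<forall>(c, m)\<in>T. 1 - c * z powi m \<noteq> 0)}"
    and f: "f holomorphic_on S" and g: "g holomorphic_on S"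
    and eq: "\<And>z. z \<noteq> 0 \<Longrightarrow> norm z < 1 \<Longrightarrow> f z = g z" and z: "z \<in> S"
  shows "f z = g z"
proof -
  define E where "E = insert 0 (\<Union>(c, m)\<in>T. {z. c * z powi m = 1})"
  have SE: "S = - E" unfolding S E_def by auto
  have "finite {z. c * z powi m = 1}" if "(c, m) \<in> T" for c m
    using T(2)[OF that] by (intro finite_powi_eq) auto
  then have "finite E" unfolding E_def using T(1) by auto
  then have "open S" "connected S"
    unfolding SE using path_connected_complement_countable[of E]
    by (auto simp: finite_imp_closed countable_finite path_connected_imp_connected)
  moreover have "open (ball 0 1 - {0 :: complex})" by (intro open_delete open_ball)
  moreover have "ball 0 1 - {0} \<subseteq> S"
  proof
    fix z :: complex assume z: "z \<in> ball 0 1 - {0}"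
    have "1 - c * z powi m \<noteq> 0" if "(c, m) \<in> T" for c m
    proof
      assume "1 - c * z powi m = 0"
      then have "norm (c * z powi m) = 1" by (metis eq_iff_diff_eq_0 norm_one)
      then have "norm z powi m = 1" using T(2)[OF that] by (simp add: norm_mult norm_power_int)
      moreover have "norm z powi m \<noteq> 1"
      proof (cases "m > 0")
        case True
        then have "norm z ^ nat m < 1" using z by (auto simp: power_less_one_iff)
        then show ?thesis using True by (simp add: power_int_def)
      next
        case False
        then have "norm z ^ nat (- m) < 1" using z T(2)[OF that] by (auto simp: power_less_one_iff)
        then show ?thesis using False by (auto simp: power_int_def power_inverse)
      qed
      ultimately show False by simp
    qed
    then show "z \<in> S" unfolding S using z by auto
  qed
  moreover have "ball 0 1 - {0 :: complex} \<noteq> {}"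
  proof -
    have "(1 / 2 :: complex) \<in> ball 0 1 - {0}" by simp
    then show ?thesis by blast
  qed
  ultimately show ?thesis
    using analytic_continuation_open[of "ball 0 1 - {0}" S f g z] f g z eq by auto
qed

text \<open>A linear form is determined by its values on \<open>B\<close>, and these are integers in
  a bounded range.\<close>

lemma finite_bounded_dual_lattice:
  fixes B :: "'a::real_vector set" and M :: "'a \<Rightarrow> real"
  assumes "finite B" "span B = UNIV" "B \<subseteq> N"
  shows "finite {u \<in> dual_lattice N. \<forall>b\<in>B. \<bar>u b\<bar> \<le> M b}"
proof -
  let ?A = "{u \<in> dual_lattice N. \<forall>b\<in>B. \<bar>u b\<bar> \<le> M b}"
  have "(\<lambda>u. restrict u B) ` ?A \<subseteq> PiE B (\<lambda>b. real_of_int ` {\<lfloor>- M b\<rfloor>..\<lceil>M b\<rceil>})"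
  proof (clarify, intro restrict_PiE_iff[THEN iffD2] ballI)
    fix u b assume u: "u \<in> dual_lattice N" "\<forall>b\<in>B. \<bar>u b\<bar> \<le> M b" and b: "b \<in> B"
    then have "u b \<in> \<int>" using assms(3) by (auto simp: dual_lattice_def)
    then obtain k where k: "u b = of_int k" by (auto elim: Ints_cases)
    have "\<bar>real_of_int k\<bar> \<le> M b" using u b k by auto
    then have "k \<in> {\<lfloor>- M b\<rfloor>..\<lceil>M b\<rceil>}" by (auto simp: floor_le_iff le_ceiling_iff)
    then show "u b \<in> real_of_int ` {\<lfloor>- M b\<rfloor>..\<lceil>M b\<rceil>}" using k by blast
  qed
  moreover have "finite (PiE B (\<lambda>b. real_of_int ` {\<lfloor>- M b\<rfloor>..\<lceil>M b\<rceil>}))"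
    using assms(1) by (intro finite_PiE) auto
  ultimately have "finite ((\<lambda>u. restrict u B) ` ?A)" by (rule finite_subset)
  moreover have "inj_on (\<lambda>u. restrict u B) ?A"
  proof (rule inj_onI)
    fix u u' assume *: "u \<in> ?A" "u' \<in> ?A" "restrict u B = restrict u' B"
    have "u b = u' b" if "b \<in> B" for b using fun_cong[OF *(3), of b] that by simp
    moreover have "linear u" "linear u'" using *(1,2) by (auto simp: dual_lattice_def dual_space_def)
    ultimately have "u x = u' x" for x
      using linear_eq_on_span[of u u' B x] assms(2) by auto
    then show "u = u'" by (rule ext)
  qed
  ultimately show ?thesis by (rule finite_imageD)
qed

section \<open>Support and generating function of the signed cone sum\<close>

context balanced_cones
begin

text \<open>This is DH for the levels \<open>c\<close> and the auxiliary vector \<open>x\<close>,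
  with each vertex cone described by inequalities instead of apex and generators. Off the
  hyperplanes the two descriptions agree (\<open>DH_eq_cone_sum\<close>).\<close>

definition cone_sum :: "('i \<Rightarrow> real) \<Rightarrow> 'a \<Rightarrow> ('a \<Rightarrow> real) \<Rightarrow> int" where
  "cone_sum c x u = (\<Sum>J\<in>D. (- 1) ^ card {i \<in> V J. U J i x > 0} * w J *
    of_bool (\<forall>i\<in>V J. 0 < (u (e i) - c i) * U J i x))"

text \<open>
  On the support of the summand of \<open>J\<close> the sign of \<open>U J i x\<close> is that of \<open>u (e i) - c i\<close>, so it does
  not involve \<open>J\<close> any more.
\<close>

lemma cone_sum_eq_flip_sum:
  assumes x: "regular x" and c: "\<And>J i. J \<in> D \<Longrightarrow> i \<in> V J \<Longrightarrow> u (e i) \<noteq> c i"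
    and n: "\<And>J. J \<in> D \<Longrightarrow> card (V J) = n"
  shows "of_int (cone_sum c x u) = (- 1) ^ n * flip_sum (\<lambda>i. u (e i) - c i) x"
proof -
  have t: "of_int ((- 1) ^ card {i \<in> V J. U J i x > 0} * w J * of_bool (\<forall>i\<in>V J. 0 < (u (e i) - c i) * U J i x)) =
    (- 1) ^ n * (real_of_int (w J) * (\<Prod>i\<in>V J. sgn (u (e i) - c i)) * of_bool (\<forall>i\<in>V J. 0 < (u (e i) - c i) * U J i x))"
    if J: "J \<in> D" for J
  proof (cases "\<forall>i\<in>V J. 0 < (u (e i) - c i) * U J i x")
    case True
    have "(- 1) ^ n * (\<Prod>i\<in>V J. sgn (u (e i) - c i)) = (\<Prod>i\<in>V J. - sgn (u (e i) - c i))"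
      using n[OF J] by (simp add: prod_uminus)
    also have "\<dots> = (\<Prod>i\<in>V J. if U J i x > 0 then - 1 else 1)"
      by (rule prod.cong) (use True in \<open>auto simp: zero_less_mult_iff\<close>)
    also have "\<dots> = (- 1) ^ card {i \<in> V J. U J i x > 0}"
      using finite_V[OF J] by (simp add: prod.If_cases Collect_conj_eq)
    finally show ?thesis using True by simp
  qed auto
  show ?thesis unfolding cone_sum_def flip_sum_def of_int_sum sum_distrib_left by (rule sum.cong[OF refl t])
qed

lemma cone_sum_independent:
  assumes "regular x" "regular x'" and c: "\<And>J i. J \<in> D \<Longrightarrow> i \<in> V J \<Longrightarrow> u (e i) \<noteq> c i"
    and n: "\<And>J. J \<in> D \<Longrightarrow> card (V J) = n"
  shows "cone_sum c x u = cone_sum c x' u"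
proof -
  have "flip_sum (\<lambda>i. u (e i) - c i) x = flip_sum (\<lambda>i. u (e i) - c i) x'"
    by (rule flip_sum_independent) (use assms in auto)
  then have "real_of_int (cone_sum c x u) = of_int (cone_sum c x' u)"
    using cone_sum_eq_flip_sum[of x u c n] cone_sum_eq_flip_sum[of x' u c n] assms by simp
  then show ?thesis by simp
qed

text \<open>By independence the sum is also nonzero for \<open>y\<close>, so \<open>u\<close>
  satisfies the inequalities of some \<open>J\<close>. Weighted with the coordinates of
  \<open>y\<close> they add up to \<open>u y\<close> being at least the value at \<open>y\<close> of
  the vertex of \<open>J\<close> for the levels \<open>c\<close>. The same argument for
  \<open>- y\<close> gives the upper bound.\<close>

lemma cone_sum_bound:
  assumes u: "linear u" and x: "regular x" and y: "regular y" and nz: "cone_sum c x u \<noteq> 0"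
    and c: "\<And>J i. J \<in> D \<Longrightarrow> i \<in> V J \<Longrightarrow> u (e i) \<noteq> c i"
    and n: "\<And>J. J \<in> D \<Longrightarrow> card (V J) = n"
  shows "\<bar>u y\<bar> \<le> (\<Sum>J\<in>D. \<bar>\<Sum>i\<in>V J. U J i y * c i\<bar>)"
proof -
  have lower: "- (\<Sum>J\<in>D. \<bar>\<Sum>i\<in>V J. U J i y * c i\<bar>) \<le> u y" if y: "regular y" for y
  proof -
    have "cone_sum c y u \<noteq> 0"
      using nz cone_sum_independent[where u = u and c = c and n = n, OF x y c n] by simp
    then obtain J where J: "J \<in> D" "\<forall>i\<in>V J. 0 < (u (e i) - c i) * U J i y"
      unfolding cone_sum_def by (auto elim!: sum.not_neutral_contains_not_neutral split: if_splits)
    have "(\<Sum>i\<in>V J. U J i y * c i) \<le> (\<Sum>i\<in>V J. U J i y * u (e i))"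
      by (rule sum_mono) (use J(2) in \<open>auto simp: algebra_simps dest!: bspec\<close>)
    also have "\<dots> = u y"
      using arg_cong[OF U_expand[OF J(1), of y], of u] u by (simp add: linear_sum linear_scale)
    finally have "- \<bar>\<Sum>i\<in>V J. U J i y * c i\<bar> \<le> u y" by linarith
    moreover have "\<bar>\<Sum>i\<in>V J. U J i y * c i\<bar> \<le> (\<Sum>J\<in>D. \<bar>\<Sum>i\<in>V J. U J i y * c i\<bar>)"
      by (rule member_le_sum[OF J(1)]) (use finite_D in auto)
    ultimately show ?thesis by linarith
  qed
  have Uneg: "U J i (- y) = - U J i y" if "J \<in> D" "i \<in> V J" for J i
    using linear_U[OF that] by (rule linear_neg)
  have "regular (- y)" using y Uneg by (simp add: regular_def)
  from lower[OF this] have "- (\<Sum>J\<in>D. \<bar>\<Sum>i\<in>V J. U J i y * c i\<bar>) \<le> - u y"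
    using u Uneg by (simp add: linear_neg sum_negf)
  then show ?thesis using lower[OF y] by linarith
qed

text \<open>Every vector is a difference of two regular ones, so bounds at regular vectors yield
  bounds at the elements of a basis.\<close>

lemma regular_shift:
  assumes "regular x"
  obtains t where "t \<noteq> 0" "regular (t *\<^sub>R x)" "regular (b + t *\<^sub>R x)"
proof -
  have "finite (insert 0 (\<Union>J\<in>D. (\<lambda>i. - U J i b / U J i x) ` V J))" using finite_D finite_V by auto
  from ex_new_if_finite[OF infinite_UNIV_char_0 this]
  obtain t where t: "t \<notin> insert 0 (\<Union>J\<in>D. (\<lambda>i. - U J i b / U J i x) ` V J)" by (rule exE)
  have "regular (t *\<^sub>R x)"
    unfolding regular_def using t assms linear_U by (auto simp: regular_def linear_scale)
  moreover have "regular (b + t *\<^sub>R x)"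
    unfolding regular_def
  proof (intro ballI notI)
    fix J i assume J: "J \<in> D" "i \<in> V J" and "U J i (b + t *\<^sub>R x) = 0"
    then have "U J i b + t * U J i x = 0" using linear_U[OF J] by (simp add: linear_add linear_scale)
    moreover have "U J i x \<noteq> 0" using assms J by (simp add: regular_def)
    ultimately have "t = - U J i b / U J i x" by (simp add: field_simps)
    then show False using t J by blast
  qed
  ultimately show ?thesis using t by (intro that) auto
qed

lemma finite_cone_sum_support:
  assumes B: "finite B" "span B = UNIV" "B \<subseteq> N" and x: "regular x"
    and c: "\<And>u J i. u \<in> dual_lattice N \<Longrightarrow> J \<in> D \<Longrightarrow> i \<in> V J \<Longrightarrow> u (e i) \<noteq> c i"
    and n: "\<And>J. J \<in> D \<Longrightarrow> card (V J) = n"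
  shows "finite {u \<in> dual_lattice N. cone_sum c x u \<noteq> 0}"
proof -
  have "\<exists>M. \<forall>u\<in>{u \<in> dual_lattice N. cone_sum c x u \<noteq> 0}. \<bar>u b\<bar> \<le> M" for b
  proof -
    obtain t where t: "regular (t *\<^sub>R x)" "regular (b + t *\<^sub>R x)" by (rule regular_shift[OF x])
    show ?thesis
    proof (intro exI ballI)
      fix u assume "u \<in> {u \<in> dual_lattice N. cone_sum c x u \<noteq> 0}"
      then have u: "u \<in> dual_lattice N" "linear u" "cone_sum c x u \<noteq> 0"
        by (auto simp: dual_lattice_def dual_space_def)
      have "\<bar>u y\<bar> \<le> (\<Sum>J\<in>D. \<bar>\<Sum>i\<in>V J. U J i y * c i\<bar>)" if "regular y" for y
        by (rule cone_sum_bound[where c = c and n = n, OF u(2) x that u(3) c[OF u(1)] n])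
      from this[OF t(1)] this[OF t(2)]
      show "\<bar>u b\<bar> \<le> (\<Sum>J\<in>D. \<bar>\<Sum>i\<in>V J. U J i (t *\<^sub>R x) * c i\<bar>) + (\<Sum>J\<in>D. \<bar>\<Sum>i\<in>V J. U J i (b + t *\<^sub>R x) * c i\<bar>)"
        using u(2) by (simp add: linear_add)
    qed
  qed
  then obtain M where "\<And>b u. u \<in> dual_lattice N \<Longrightarrow> cone_sum c x u \<noteq> 0 \<Longrightarrow> \<bar>u b\<bar> \<le> M b"
    by (metis (mono_tags, lifting) mem_Collect_eq)
  then have "{u \<in> dual_lattice N. cone_sum c x u \<noteq> 0} \<subseteq> {u \<in> dual_lattice N. \<forall>b\<in>B. \<bar>u b\<bar> \<le> M b}" by blast
  then show ?thesis using finite_bounded_dual_lattice[OF B] finite_subset by blast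
qed

text \<open>Two vectors occur: \<open>v\<close> supplies the exponents and determines how the
  factors are expanded, while \<open>x\<close> is the auxiliary vector of the cone sum in the
  result.\<close>

lemma lattice_point_identity:
  fixes z :: complex
  assumes B: "finite B" "span B = UNIV" and N: "N = group_closure B"
    and n: "\<And>J. J \<in> D \<Longrightarrow> card (V J) = n"
    and e: "\<And>J. J \<in> D \<Longrightarrow> e ` V J \<subseteq> N"
    and G: "\<And>J. J \<in> D \<Longrightarrow> G J = (\<lambda>x. x +o group_closure (e ` V J)) ` N" "\<And>J. J \<in> D \<Longrightarrow> finite (G J)"
    and apex: "\<And>J. J \<in> D \<Longrightarrow> apex J \<in> dual_lattice N"
    and \<epsilon>: "0 < \<epsilon>" "\<epsilon> < 1" and c: "\<And>J i. J \<in> D \<Longrightarrow> i \<in> V J \<Longrightarrow> c i = apex J (e i) + \<epsilon>"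
    and v: "v \<in> N" "\<And>J i. J \<in> D \<Longrightarrow> i \<in> V J \<Longrightarrow> U J i v \<in> \<int> \<and> U J i v \<noteq> 0"
    and x: "regular x"
  shows "finite {u \<in> dual_lattice N. cone_sum c x u \<noteq> 0}"
    and "z \<noteq> 0 \<Longrightarrow> (\<And>J g i. J \<in> D \<Longrightarrow> g \<in> G J \<Longrightarrow> i \<in> V J \<Longrightarrow> 1 - chi (U J i) g * zpow z (- U J i v) \<noteq> 0) \<Longrightarrow>
      (\<Sum>J\<in>D. of_int (w J) * zpow z (apex J v) / of_nat (card (G J)) *
        (\<Sum>g\<in>G J. 1 / (\<Prod>i\<in>V J. 1 - chi (U J i) g * zpow z (- U J i v)))) =
      (\<Sum>u | u \<in> dual_lattice N \<and> cone_sum c x u \<noteq> 0. of_int (cone_sum c x u) * zpow z (u v))"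
proof -
  have BN: "B \<subseteq> N" unfolding N by (auto intro: group_closure.base)
  \<comment> \<open>\<open>apex J (e i)\<close> is an integer, so the shifted level
    \<open>c i\<close> is not, and no lattice point lies on a moved hyperplane. Independence of the
    auxiliary vector requires this.\<close>
  have off: "u (e i) \<noteq> c i" if "u \<in> dual_lattice N" "J \<in> D" "i \<in> V J" for u J i
  proof
    assume "u (e i) = c i"
    then have "\<epsilon> = u (e i) - apex J (e i)" using c that by simp
    also have "\<dots> \<in> \<int>" using that apex[of J] e[of J] by (auto simp: dual_lattice_def)
    finally obtain k where "\<epsilon> = of_int k" by (auto elim: Ints_cases)
    then show False using \<epsilon> by simp
  qed
  have v_reg: "regular v" using v(2) by (auto simp: regular_def)
  show fin: "finite {u \<in> dual_lattice N. cone_sum c x u \<noteq> 0}"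
    by (rule finite_cone_sum_support[where c = c and n = n, OF B BN x]) (use off n in auto)
  define lhs where "lhs = (\<lambda>z. \<Sum>J\<in>D. of_int (w J) * zpow z (apex J v) / of_nat (card (G J)) *
        (\<Sum>g\<in>G J. 1 / (\<Prod>i\<in>V J. 1 - chi (U J i) g * zpow z (- U J i v))))"
  define rhs where "rhs = (\<lambda>z. \<Sum>u | u \<in> dual_lattice N \<and> cone_sum c x u \<noteq> 0. of_int (cone_sum c x u) * zpow z (u v))"
  have disc: "lhs z = rhs z" if z: "z \<noteq> 0" "norm z < 1" for z
  proof -
    define A where "A = (\<lambda>J. zpow z (apex J v) / of_nat (card (G J)) *
        (\<Sum>g\<in>G J. 1 / (\<Prod>i\<in>V J. 1 - chi (U J i) g * zpow z (- U J i v))))"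
    define t where "t = (\<lambda>J u. (- 1) ^ card {i \<in> V J. U J i v > 0} *
       of_bool (\<forall>i\<in>V J. 0 < (u (e i) - c i) * U J i v) * zpow z (u v))"
    have "(t J has_sum A J) (dual_lattice N)" if J: "J \<in> D" for J
    proof -
      have eqc: "u (e i) - apex J (e i) - \<epsilon> = u (e i) - c i" if "i \<in> V J" for u :: "'a \<Rightarrow> real" and i
        using c[OF J that] by simp
      have "((\<lambda>u. (- 1) ^ card {i \<in> V J. U J i v > 0} * of_bool (\<forall>i\<in>V J. 0 < (u (e i) - apex J (e i) - \<epsilon>) * U J i v) *
        zpow z (u v)) has_sum A J) (dual_lattice N)"
        unfolding A_def
      proof (rule vertex_generating_function[where m = "\<lambda>i. \<lfloor>U J i v\<rfloor>",
            OF finite_V[OF J] _ _ _ N e[OF J] G(1)[OF J] G(2)[OF J] apex[OF J] v(1) _ _ z \<epsilon>])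
        fix i assume i: "i \<in> V J"
        show "linear (U J i)" using linear_U J i .
        obtain k where "U J i v = of_int k" using v(2)[OF J i] by (auto elim: Ints_cases)
        then show "U J i v = of_int \<lfloor>U J i v\<rfloor>" "\<lfloor>U J i v\<rfloor> \<noteq> 0" using v(2)[OF J i] by auto
      qed (use U_e U_expand J in auto)
      then show ?thesis unfolding t_def using eqc by (simp cong: ball_cong)
    qed
    then have "((\<lambda>u. \<Sum>J\<in>D. of_int (w J) * t J u) has_sum (\<Sum>J\<in>D. of_int (w J) * A J)) (dual_lattice N)"
      using finite_D by (intro has_sum_finite_sum has_sum_cmult_right)
    also have "(\<lambda>u. \<Sum>J\<in>D. of_int (w J) * t J u) = (\<lambda>u. of_int (cone_sum c v u) * zpow z (u v))"
      unfolding t_def cone_sum_def of_int_sum sum_distrib_right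
      by (intro ext sum.cong refl) (simp add: mult_ac)
    also have "(\<Sum>J\<in>D. of_int (w J) * A J) = lhs z" unfolding lhs_def A_def by (simp add: mult_ac)
    finally have "((\<lambda>u. of_int (cone_sum c v u) * zpow z (u v)) has_sum lhs z) (dual_lattice N)" .
    \<comment> \<open>Passage, term by term, from the vector \<open>v\<close> dictated by the
      expansion to the prescribed \<open>x\<close>.\<close>
    also have "?this \<longleftrightarrow> ((\<lambda>u. of_int (cone_sum c x u) * zpow z (u v)) has_sum lhs z) (dual_lattice N)"
      by (intro has_sum_cong) (use cone_sum_independent[where n = n, OF v_reg x _ n] off in auto)
    finally have "((\<lambda>u. of_int (cone_sum c x u) * zpow z (u v)) has_sum lhs z) (dual_lattice N)" .
    moreover have "((\<lambda>u. of_int (cone_sum c x u) * zpow z (u v)) has_sum rhs z) (dual_lattice N)"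
      by (rule has_sum_finite_neutralI[OF fin]) (auto simp: rhs_def)
    ultimately show ?thesis by (rule has_sum_unique)
  qed
  \<comment> \<open>The coefficients and exponents of all denominators; \<open>S\<close> is the
    region where none of them vanishes.\<close>
  define T where "T = (\<Union>J\<in>D. \<Union>g\<in>G J. \<Union>i\<in>V J. {(chi (U J i) g, \<lfloor>- U J i v\<rfloor>)})"
  define S where "S = {z :: complex. z \<noteq> 0 \<and> (\<forall>(c, m)\<in>T. 1 - c * z powi m \<noteq> 0)}"
  have finT: "finite T" unfolding T_def using finite_D finite_V G(2) by auto
  have T: "norm c = 1 \<and> m \<noteq> 0" if "(c, m) \<in> T" for c m
  proof -
    obtain J g i where *: "J \<in> D" "i \<in> V J" "c = chi (U J i) g" "m = \<lfloor>- U J i v\<rfloor>"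
      using \<open>(c, m) \<in> T\<close> unfolding T_def by blast
    obtain k where "U J i v = of_int k" using v(2)[OF *(1,2)] by (auto elim: Ints_cases)
    then show ?thesis using * v(2)[OF *(1,2)] by (auto simp: chi_def simp flip: of_int_minus)
  qed
  have nzS: "1 - chi (U J i) g * z powi \<lfloor>- U J i v\<rfloor> \<noteq> 0" if "z \<in> S" "J \<in> D" "g \<in> G J" "i \<in> V J" for z J g i
  proof -
    have "(chi (U J i) g, \<lfloor>- U J i v\<rfloor>) \<in> T" unfolding T_def using that by blast
    then show ?thesis using that(1) unfolding S_def by blast
  qed
  have S0: "z \<noteq> 0" if "z \<in> S" for z using that by (simp add: S_def)
  have "lhs holomorphic_on S"
    unfolding lhs_def zpow_def using nzS S0 finite_V
    by (intro holomorphic_intros) (auto simp: G(2))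
  moreover have "rhs holomorphic_on S"
    unfolding rhs_def zpow_def using S0 by (intro holomorphic_intros) auto
  ultimately have S: "lhs z = rhs z" if "z \<in> S" for z
    using laurent_continuation[OF finT T S_def] disc that by blast
  assume "z \<noteq> 0" and "\<And>J g i. J \<in> D \<Longrightarrow> g \<in> G J \<Longrightarrow> i \<in> V J \<Longrightarrow> 1 - chi (U J i) g * zpow z (- U J i v) \<noteq> 0"
  then have "z \<in> S" unfolding S_def T_def zpow_def by auto
  from S[OF this] show "(\<Sum>J\<in>D. of_int (w J) * zpow z (apex J v) / of_nat (card (G J)) *
        (\<Sum>g\<in>G J. 1 / (\<Prod>i\<in>V J. 1 - chi (U J i) g * zpow z (- U J i v)))) =
      (\<Sum>u | u \<in> dual_lattice N \<and> cone_sum c x u \<noteq> 0. of_int (cone_sum c x u) * zpow z (u v))"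
    unfolding lhs_def rhs_def .
qed

end

section \<open>Simplicial cones and primitive vectors\<close>

lemma dual_family:
  fixes A :: "'a::real_vector set"
  assumes "independent A"
  obtains f :: "'a \<Rightarrow> 'a \<Rightarrow> real" where "\<And>a. linear (f a)"
    "\<And>a b. a \<in> A \<Longrightarrow> b \<in> A \<Longrightarrow> f a b = (if b = a then 1 else 0)"
proof -
  have "\<exists>g :: 'a \<Rightarrow> real. linear g \<and> (\<forall>b\<in>A. g b = (if b = a then 1 else 0))" for a
    using linear_independent_extend[OF assms, of "\<lambda>b. if b = a then 1 else (0::real)"] by blast
  then obtain f :: "'a \<Rightarrow> 'a \<Rightarrow> real" where "\<forall>a. linear (f a) \<and> (\<forall>b\<in>A. f a b = (if b = a then 1 else 0))"
    by metis
  then show ?thesis by (intro that[of f]) auto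
qed

lemma nonneg_hullI: "(\<And>a. a \<in> A \<Longrightarrow> 0 \<le> t a) \<Longrightarrow> (\<Sum>a\<in>A. t a *\<^sub>R a) \<in> nonneg_hull A"
  unfolding nonneg_hull_def by blast

lemma nonneg_hull_subset_span: "nonneg_hull A \<subseteq> span A"
  unfolding nonneg_hull_def by (auto intro: span_sum span_scale span_base)

lemma subset_nonneg_hull: "finite A \<Longrightarrow> A \<subseteq> nonneg_hull A"
proof
  fix a assume "finite A" "a \<in> A"
  then have "(\<Sum>b\<in>A. (if b = a then 1 else 0) *\<^sub>R b) = a"
    by (simp add: if_distrib[of "\<lambda>c. c *\<^sub>R _"] cong: if_cong)
  then show "a \<in> nonneg_hull A"
    using nonneg_hullI[of A "\<lambda>b. if b = a then 1 else 0"] by simp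
qed

lemma span_nonneg_hull: "finite A \<Longrightarrow> span (nonneg_hull A) = span A"
  using span_mono[OF subset_nonneg_hull[of A]] span_mono[OF nonneg_hull_subset_span[of A]]
  by (simp add: span_span)

lemma dim_nonneg_hull: "finite A \<Longrightarrow> independent A \<Longrightarrow> dim (nonneg_hull A) = card A"
  by (metis dim_span dim_span_eq_card_independent span_nonneg_hull)

lemma nonneg_hull_singleton: "nonneg_hull {a} = {t *\<^sub>R a | t. 0 \<le> t}"
  unfolding nonneg_hull_def by auto

lemma nonneg_hull_scale_singleton:
  assumes "0 < t"
  shows "nonneg_hull {t *\<^sub>R a} = nonneg_hull {a}"
proof -
  have "\<exists>r\<ge>0. s *\<^sub>R t *\<^sub>R a = r *\<^sub>R a" if "0 \<le> s" for s
    using assms that by (intro exI[of _ "s * t"]) auto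
  moreover have "\<exists>r\<ge>0. s *\<^sub>R a = r *\<^sub>R t *\<^sub>R a" if "0 \<le> s" for s
    using assms that by (intro exI[of _ "s / t"]) auto
  ultimately show ?thesis unfolding nonneg_hull_singleton by blast
qed

context
  fixes A :: "'a::real_vector set" and f :: "'a \<Rightarrow> 'a \<Rightarrow> real"
  assumes A: "finite A" and lin: "\<And>a. linear (f a)"
    and dual: "\<And>a b. a \<in> A \<Longrightarrow> b \<in> A \<Longrightarrow> f a b = (if b = a then 1 else 0)"
begin

lemma dual_family_sum: "a \<in> A \<Longrightarrow> f a (\<Sum>b\<in>A. t b *\<^sub>R b) = t a"
  using A by (simp add: linear_sum[OF lin] linear_scale[OF lin] dual if_distrib[of "\<lambda>c. _ * c"] cong: if_cong)

lemma nonneg_hull_coord: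
  assumes "x \<in> nonneg_hull A"
  shows "a \<in> A \<Longrightarrow> 0 \<le> f a x" "(\<Sum>a\<in>A. f a x *\<^sub>R a) = x"
proof -
  obtain t where t: "\<And>a. a \<in> A \<Longrightarrow> 0 \<le> t a" "x = (\<Sum>a\<in>A. t a *\<^sub>R a)"
    using assms unfolding nonneg_hull_def by blast
  have *: "f a x = t a" if "a \<in> A" for a using t(2) dual_family_sum that by simp
  then show "a \<in> A \<Longrightarrow> 0 \<le> f a x" using t by simp
  show "(\<Sum>a\<in>A. f a x *\<^sub>R a) = x" using * t(2) by simp
qed

lemma nonneg_hull_subset_iff:
  assumes "A0 \<subseteq> A"
  shows "x \<in> nonneg_hull A0 \<longleftrightarrow> x \<in> nonneg_hull A \<and> (\<forall>a\<in>A - A0. f a x = 0)"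
proof
  assume "x \<in> nonneg_hull A0"
  then obtain t where t: "\<And>a. a \<in> A0 \<Longrightarrow> 0 \<le> t a" "x = (\<Sum>a\<in>A0. t a *\<^sub>R a)"
    unfolding nonneg_hull_def by blast
  define s where "s = (\<lambda>a. if a \<in> A0 then t a else 0)"
  have "x = (\<Sum>a\<in>A. s a *\<^sub>R a)"
    unfolding t(2) s_def using assms A by (intro sum.mono_neutral_cong_left) auto
  then show "x \<in> nonneg_hull A \<and> (\<forall>a\<in>A - A0. f a x = 0)"
    using nonneg_hullI[of A s] dual_family_sum[of _ s] t(1) by (auto simp: s_def)
next
  assume x: "x \<in> nonneg_hull A \<and> (\<forall>a\<in>A - A0. f a x = 0)"
  then have "x = (\<Sum>a\<in>A. f a x *\<^sub>R a)" using nonneg_hull_coord(2) by simp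
  also have "\<dots> = (\<Sum>a\<in>A0. f a x *\<^sub>R a)"
    using assms A x by (intro sum.mono_neutral_right) auto
  finally have "x = (\<Sum>a\<in>A0. f a x *\<^sub>R a)" .
  moreover have "(\<Sum>a\<in>A0. f a x *\<^sub>R a) \<in> nonneg_hull A0"
    by (rule nonneg_hullI) (use x nonneg_hull_coord(1) assms in blast)
  ultimately show "x \<in> nonneg_hull A0" by simp
qed

text \<open>The coordinates outside \<open>A0\<close> are nonnegative at both ends of a segment in
  the cone; if they vanish at an inner point, they vanish at both ends.\<close>

lemma nonneg_hull_face:
  assumes "A0 \<subseteq> A"
  shows "nonneg_hull A0 face_of nonneg_hull A"
  unfolding face_of_def
proof (intro conjI ballI impI)
  show "nonneg_hull A0 \<subseteq> nonneg_hull A" using nonneg_hull_subset_iff[OF assms] by blast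
  show "convex (nonneg_hull A0)"
    unfolding convex_def
  proof (intro ballI allI impI)
    fix x y and u v :: real assume xy: "x \<in> nonneg_hull A0" "y \<in> nonneg_hull A0" and uv: "0 \<le> u" "0 \<le> v" "u + v = 1"
    obtain s where s: "\<And>a. a \<in> A0 \<Longrightarrow> 0 \<le> s a" "x = (\<Sum>a\<in>A0. s a *\<^sub>R a)"
      using xy(1) unfolding nonneg_hull_def by blast
    obtain t where t: "\<And>a. a \<in> A0 \<Longrightarrow> 0 \<le> t a" "y = (\<Sum>a\<in>A0. t a *\<^sub>R a)"
      using xy(2) unfolding nonneg_hull_def by blast
    have "u *\<^sub>R x + v *\<^sub>R y = (\<Sum>a\<in>A0. (u * s a + v * t a) *\<^sub>R a)"
      unfolding s(2) t(2) by (simp add: scaleR_sum_right scaleR_add_left sum.distrib)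
    also have "\<dots> \<in> nonneg_hull A0" by (rule nonneg_hullI) (use s(1) t(1) uv in auto)
    finally show "u *\<^sub>R x + v *\<^sub>R y \<in> nonneg_hull A0" .
  qed
  fix x y z assume x: "x \<in> nonneg_hull A" and y: "y \<in> nonneg_hull A" and z: "z \<in> nonneg_hull A0" "z \<in> open_segment x y"
  obtain u where u: "0 < u" "u < 1" "z = (1 - u) *\<^sub>R x + u *\<^sub>R y" using z(2) by (auto simp: in_segment)
  have "f a x = 0 \<and> f a y = 0" if a: "a \<in> A - A0" for a
  proof -
    have "f a z = (1 - u) * f a x + u * f a y"
      unfolding u(3) by (simp add: linear_add[OF lin] linear_scale[OF lin])
    moreover have "f a z = 0" using z(1) a nonneg_hull_subset_iff[OF assms] by blast
    moreover have "0 \<le> f a x" "0 \<le> f a y" using nonneg_hull_coord(1) x y a by auto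
    ultimately have "(1 - u) * f a x = 0 \<and> u * f a y = 0"
      using u by (intro add_nonneg_eq_0_iff[THEN iffD1]) auto
    then show ?thesis using u by auto
  qed
  then show "x \<in> nonneg_hull A0" "y \<in> nonneg_hull A0"
    using x y nonneg_hull_subset_iff[OF assms] by blast+
qed

lemma nonneg_hull_ray_face:
  assumes b: "b \<noteq> 0" and face: "nonneg_hull {b} face_of nonneg_hull A"
  shows "\<exists>a\<in>A. nonneg_hull {b} = nonneg_hull {a}"
proof -
  have bA: "b \<in> nonneg_hull A" using face subset_nonneg_hull[of "{b}"] unfolding face_of_def by blast
  note coord = nonneg_hull_coord[OF bA]
  obtain a where a: "a \<in> A" "f a b \<noteq> 0"
    using coord(2) b by (metis (no_types, lifting) scaleR_zero_left sum.neutral)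
  have fab: "f a b > 0" using coord(1)[OF a(1)] a(2) by simp
  \<comment> \<open>\<open>b\<close> is the midpoint of \<open>x\<close> and \<open>y\<close>, where
    \<open>x\<close> doubles the \<open>a\<close>-component of \<open>b\<close> and \<open>y\<close>
    doubles all the others. Both points are in the cone, so the face property puts \<open>x\<close>
    on the ray of \<open>b\<close>.\<close>
  define x where "x = (2 * f a b) *\<^sub>R a"
  define y where "y = 2 *\<^sub>R b - x"
  have x: "x \<in> nonneg_hull A"
  proof -
    have "x = (\<Sum>c\<in>A. (if c = a then 2 * f a b else 0) *\<^sub>R c)"
      using A a by (simp add: x_def if_distrib[of "\<lambda>c. c *\<^sub>R _"] cong: if_cong)
    then show ?thesis using nonneg_hullI[of A "\<lambda>c. if c = a then 2 * f a b else 0"] fab by simp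
  qed
  have y: "y \<in> nonneg_hull A"
  proof -
    have "y = (\<Sum>c\<in>A. (if c = a then 0 else 2 * f c b) *\<^sub>R c)"
    proof -
      have "2 *\<^sub>R b = (\<Sum>c\<in>A. (2 * f c b) *\<^sub>R c)"
        using coord(2) by (metis (no_types, lifting) scaleR_scaleR scaleR_sum_right sum.cong)
      also have "\<dots> = x + (\<Sum>c\<in>A - {a}. (2 * f c b) *\<^sub>R c)" using A a by (simp add: sum.remove x_def)
      also have "(\<Sum>c\<in>A - {a}. (2 * f c b) *\<^sub>R c) = (\<Sum>c\<in>A. (if c = a then 0 else 2 * f c b) *\<^sub>R c)"
        using A by (intro sum.mono_neutral_cong_left) auto
      finally show ?thesis by (simp add: y_def)
    qed
    then show ?thesis using nonneg_hullI[of A "\<lambda>c. if c = a then 0 else 2 * f c b"] coord(1) by simp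
  qed
  have "x \<in> nonneg_hull {b}"
  proof (cases "x = y")
    case True
    then have "2 *\<^sub>R x = 2 *\<^sub>R b" by (simp add: y_def scaleR_2 eq_diff_eq)
    then have "x = b" by simp
    then show ?thesis using subset_nonneg_hull[of "{b}"] by simp
  next
    case False
    have "b \<in> open_segment x y"
      unfolding in_segment using False by (intro conjI exI[of _ "1 / 2"]) (auto simp: y_def scaleR_diff_right)
    then show ?thesis using face x y subset_nonneg_hull[of "{b}"] unfolding face_of_def by blast
  qed
  then obtain t where t: "x = t *\<^sub>R b" "0 \<le> t" by (auto simp: nonneg_hull_singleton)
  have "f a x = 2 * f a b" unfolding x_def using a(1) by (simp add: linear_scale[OF lin] dual)
  then have "t * f a b = 2 * f a b" unfolding t(1) by (simp add: linear_scale[OF lin])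
  then have "t = 2" using fab by simp
  then have "2 *\<^sub>R b = 2 *\<^sub>R f a b *\<^sub>R a" using t x_def by simp
  then have "b = f a b *\<^sub>R a" by (simp only: scaleR_cancel_left) simp
  then show ?thesis using nonneg_hull_scale_singleton[OF fab, of a] a(1) by metis
qed

text \<open>An extreme ray occurs in every generating set: when \<open>a\<close> is written as a
  nonnegative combination of \<open>A'\<close>, the coordinates other than \<open>a\<close> cancel
  without negative terms, so they vanish in each summand that occurs.\<close>

lemma nonneg_hull_ray_generator:
  assumes A': "finite A'" and eq: "nonneg_hull A = nonneg_hull A'" and a: "a \<in> A"
  shows "\<exists>x\<in>A'. \<exists>t>0. x = t *\<^sub>R a"
proof -
  have A'A: "x \<in> nonneg_hull A" if "x \<in> A'" for x using subset_nonneg_hull[OF A'] eq that by blast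
  have "a \<in> nonneg_hull A'" using subset_nonneg_hull[OF A] eq a by blast
  then obtain s where s: "\<And>x. x \<in> A' \<Longrightarrow> 0 \<le> s x" "a = (\<Sum>x\<in>A'. s x *\<^sub>R x)"
    unfolding nonneg_hull_def by blast
  have fs: "f c a = (\<Sum>x\<in>A'. s x * f c x)" for c
    using arg_cong[OF s(2), of "f c"] by (simp add: linear_sum[OF lin] linear_scale[OF lin])
  have "f a a = 1" using dual a by simp
  then have "(\<Sum>x\<in>A'. s x * f a x) \<noteq> 0" using fs[of a] by simp
  then obtain x where x: "x \<in> A'" "s x * f a x \<noteq> 0" by (rule sum.not_neutral_contains_not_neutral)
  have "f c x = 0" if c: "c \<in> A" "c \<noteq> a" for c
  proof -
    have "(\<Sum>x\<in>A'. s x * f c x) = 0" using fs[of c] dual a c by simp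
    moreover have "0 \<le> s x * f c x" if "x \<in> A'" for x
      using s(1)[OF that] nonneg_hull_coord(1)[OF A'A[OF that] c(1)] by simp
    ultimately have "s x * f c x = 0" using A' x(1) by (simp add: sum_nonneg_eq_0_iff)
    then show ?thesis using x(2) by auto
  qed
  then have "(\<Sum>c\<in>A. f c x *\<^sub>R c) = (\<Sum>c\<in>A. if c = a then f a x *\<^sub>R a else 0)"
    by (intro sum.cong) auto
  then have "x = f a x *\<^sub>R a" using nonneg_hull_coord(2)[OF A'A[OF x(1)]] A a by simp
  moreover have "f a x > 0" using nonneg_hull_coord(1)[OF A'A[OF x(1)] a] x(2) by (simp add: order_less_le)
  ultimately show ?thesis using x(1) by blast
qed

lemma nonneg_hull_no_line:
  assumes "\<And>t. p + t *\<^sub>R d \<in> nonneg_hull A"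
  shows "d = 0"
proof -
  have "f a d = 0" if a: "a \<in> A" for a
  proof (rule ccontr)
    assume nz: "f a d \<noteq> 0"
    have "0 \<le> f a (p + (- (f a p + 1) / f a d) *\<^sub>R d)" using nonneg_hull_coord(1)[OF assms a] .
    also have "\<dots> = - 1" using nz by (simp add: linear_add[OF lin] linear_scale[OF lin])
    finally show False by simp
  qed
  moreover have "p + 1 *\<^sub>R d \<in> nonneg_hull A" "p + 0 *\<^sub>R d \<in> nonneg_hull A" using assms by blast+
  ultimately have "(\<Sum>a\<in>A. f a p *\<^sub>R a) = p + d" "(\<Sum>a\<in>A. f a p *\<^sub>R a) = p"
    using nonneg_hull_coord(2)[of "p + d"] nonneg_hull_coord(2)[of p] by (auto simp: linear_add[OF lin])
  then show "d = 0" by simp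
qed

end

lemma nonneg_hull_in_Cone:
  assumes "finite A" "independent A" "A \<subseteq> N"
  shows "nonneg_hull A \<in> Cone N"
proof -
  obtain f :: "'a \<Rightarrow> 'a \<Rightarrow> real" where "\<And>a. linear (f a)"
    "\<And>a b. a \<in> A \<Longrightarrow> b \<in> A \<Longrightarrow> f a b = (if b = a then 1 else 0)"
    using dual_family[OF assms(2)] by metis
  then show ?thesis unfolding Cone_def using nonneg_hull_no_line[OF assms(1)] assms by blast
qed

lemma independent_scaled:
  fixes A :: "'a::real_vector set"
  assumes A: "finite A" "independent A" and s: "\<And>a. a \<in> A \<Longrightarrow> 0 < s a"
  shows "independent ((\<lambda>a. s a *\<^sub>R a) ` A)" "nonneg_hull ((\<lambda>a. s a *\<^sub>R a) ` A) = nonneg_hull A"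
    "inj_on (\<lambda>a. s a *\<^sub>R a) A"
proof -
  let ?h = "\<lambda>a. s a *\<^sub>R a"
  obtain f :: "'a \<Rightarrow> 'a \<Rightarrow> real" where lin: "\<And>a. linear (f a)"
    and dual: "\<And>a b. a \<in> A \<Longrightarrow> b \<in> A \<Longrightarrow> f a b = (if b = a then 1 else 0)"
    using dual_family[OF A(2)] by metis
  show inj: "inj_on ?h A"
  proof (rule inj_onI, rule ccontr)
    fix a b assume ab: "a \<in> A" "b \<in> A" "?h a = ?h b" "a \<noteq> b"
    have "f a (?h a) = s a" "f a (?h b) = 0" using ab(1,2,4) by (auto simp: linear_scale[OF lin] dual)
    then show False using ab(3) s[OF ab(1)] by simp
  qed
  show "independent (?h ` A)"
  proof
    assume "dependent (?h ` A)"
    then obtain u where u: "\<exists>v\<in>?h ` A. u v \<noteq> 0" "(\<Sum>v\<in>?h ` A. u v *\<^sub>R v) = 0"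
      using dependent_finite[of "?h ` A"] A(1) by auto
    have "(\<Sum>a\<in>A. (u (?h a) * s a) *\<^sub>R a) = 0" using u(2) by (simp add: sum.reindex[OF inj])
    then have "u (?h a) * s a = 0" if "a \<in> A" for a
      using dual_family_sum[OF A(1) lin dual that, of "\<lambda>a. u (?h a) * s a"] by (simp add: linear_0[OF lin])
    then have "u (?h a) = 0" if "a \<in> A" for a using s[OF that] that by fastforce
    then show False using u(1) by auto
  qed
  show "nonneg_hull (?h ` A) = nonneg_hull A"
  proof
    show "nonneg_hull (?h ` A) \<subseteq> nonneg_hull A"
    proof
      fix x assume "x \<in> nonneg_hull (?h ` A)"
      then obtain t where t: "\<And>a. a \<in> A \<Longrightarrow> 0 \<le> t (?h a)" "x = (\<Sum>a\<in>A. t (?h a) *\<^sub>R ?h a)"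
        unfolding nonneg_hull_def by (auto simp: sum.reindex[OF inj])
      have "x = (\<Sum>a\<in>A. (t (?h a) * s a) *\<^sub>R a)" unfolding t(2) by simp
      also have "\<dots> \<in> nonneg_hull A" by (rule nonneg_hullI) (use t(1) s in \<open>simp add: less_imp_le\<close>)
      finally show "x \<in> nonneg_hull A" .
    qed
    show "nonneg_hull A \<subseteq> nonneg_hull (?h ` A)"
    proof
      fix x assume "x \<in> nonneg_hull A"
      then obtain t where t: "\<And>a. a \<in> A \<Longrightarrow> 0 \<le> t a" "x = (\<Sum>a\<in>A. t a *\<^sub>R a)"
        unfolding nonneg_hull_def by auto
      define r where "r = (\<lambda>v. t (the_inv_into A ?h v) / s (the_inv_into A ?h v))"
      have r: "r (?h a) = t a / s a" if "a \<in> A" for a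
        using the_inv_into_f_f[OF inj that] by (simp add: r_def)
      have "x = (\<Sum>a\<in>A. r (?h a) *\<^sub>R ?h a)"
        unfolding t(2) using r s by (intro sum.cong) (auto simp: order_less_imp_not_eq2)
      also have "\<dots> = (\<Sum>v\<in>?h ` A. r v *\<^sub>R v)" by (simp add: sum.reindex[OF inj])
      also have "\<dots> \<in> nonneg_hull (?h ` A)" by (rule nonneg_hullI) (use r t(1) s in \<open>auto simp: less_imp_le\<close>)
      finally show "x \<in> nonneg_hull (?h ` A)" .
    qed
  qed
qed

text \<open>Kept apart from the multi-fan so that it also applies to the sublattice generated by the
  primitive vectors of a maximal cone.\<close>

locale lattice_basis =
  fixes B :: "'a::real_vector set" and N :: "'a set"
  assumes finite_B: "finite B" and indep_B: "independent B" and span_B: "span B = UNIV"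
    and N_def: "N = group_closure B"
begin

lemma lin_coord: "linear (\<lambda>x. representation B x b)"
  by (rule linearI) (simp_all add: representation_add representation_scale indep_B span_B)

lemma coord_expand: "(\<Sum>b\<in>B. representation B x b *\<^sub>R b) = x"
  using sum_representation_eq[OF indep_B _ finite_B order_refl] span_B by simp

lemma coord_Ints: "x \<in> N \<Longrightarrow> representation B x b \<in> \<int>"
  unfolding N_def by (rule Ints_group_closure[OF lin_coord]) (auto simp: representation_basis[OF indep_B])

lemma N_add: "x \<in> N \<Longrightarrow> y \<in> N \<Longrightarrow> x + y \<in> N" and N_diff: "x \<in> N \<Longrightarrow> y \<in> N \<Longrightarrow> x - y \<in> N"
  and N_zero: "0 \<in> N"
  unfolding N_def by (auto intro: group_closure_add group_closure.diff zero_in_group_closure)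

lemma N_of_int_scale: "x \<in> N \<Longrightarrow> of_int k *\<^sub>R x \<in> N"
proof (induction k rule: int_induct[where k = 0])
  case (step1 i)
  then show ?case using N_add by (simp add: scaleR_add_left)
next
  case (step2 i)
  then show ?case using N_diff by (simp add: scaleR_diff_left)
qed (simp add: N_zero)

lemma N_sum: "(\<And>i. i \<in> I \<Longrightarrow> g i \<in> N) \<Longrightarrow> (\<Sum>i\<in>I. g i) \<in> N"
  by (induction I rule: infinite_finite_induct) (auto intro: N_add N_zero)

lemma finite_N_bounded: "finite {x \<in> N. \<forall>b\<in>B. \<bar>representation B x b\<bar> \<le> M b}"
proof -
  let ?P = "PiE B (\<lambda>b. real_of_int ` {\<lfloor>- M b\<rfloor>..\<lceil>M b\<rceil>})"
  have "{x \<in> N. \<forall>b\<in>B. \<bar>representation B x b\<bar> \<le> M b} \<subseteq> (\<lambda>k. \<Sum>b\<in>B. k b *\<^sub>R b) ` ?P"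
  proof clarify
    fix x assume x: "x \<in> N" "\<forall>b\<in>B. \<bar>representation B x b\<bar> \<le> M b"
    have "representation B x b \<in> real_of_int ` {\<lfloor>- M b\<rfloor>..\<lceil>M b\<rceil>}" if "b \<in> B" for b
    proof -
      obtain k where k: "representation B x b = of_int k" using coord_Ints[OF x(1)] by (auto elim: Ints_cases)
      have "\<bar>real_of_int k\<bar> \<le> M b" using x(2) k that by auto
      then have "k \<in> {\<lfloor>- M b\<rfloor>..\<lceil>M b\<rceil>}" by (auto simp: floor_le_iff le_ceiling_iff)
      then show ?thesis using k by blast
    qed
    then have "restrict (representation B x) B \<in> ?P" by auto
    moreover have "x = (\<Sum>b\<in>B. restrict (representation B x) B b *\<^sub>R b)"
      using coord_expand[of x] by simp
    ultimately show "x \<in> (\<lambda>k. \<Sum>b\<in>B. k b *\<^sub>R b) ` ?P" by blast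
  qed
  moreover have "finite ?P" using finite_B by (intro finite_PiE) auto
  ultimately show ?thesis by (meson finite_surj)
qed

text \<open>A lattice vector of least height on the ray generates all lattice vectors of the ray.\<close>

lemma ray_generator:
  assumes x: "x \<in> N" "x \<noteq> 0"
  obtains p where "p \<in> N" "p \<noteq> 0" "p \<in> nonneg_hull {x}"
    "\<And>q. q \<in> N \<Longrightarrow> q \<in> nonneg_hull {x} \<Longrightarrow> \<exists>k::int. q = of_int k *\<^sub>R p"
proof -
  \<comment> \<open>The height is additive along the ray under nonnegative scaling, positive off 0
    and an integer on \<open>N\<close>; hence a lattice vector of least height exists.\<close>
  define h where "h = (\<lambda>y. \<Sum>b\<in>B. \<bar>representation B y b\<bar>)"
  have h_scale: "h (t *\<^sub>R y) = t * h y" if "0 \<le> t" for t y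
    using that by (simp add: h_def linear_scale[OF lin_coord] abs_mult sum_distrib_left)
  have h_pos: "0 < h y" if "y \<noteq> 0" for y
  proof -
    have "\<exists>b\<in>B. representation B y b \<noteq> 0"
    proof (rule ccontr)
      assume "\<not> ?thesis"
      then have "y = 0" using coord_expand[of y] by (metis (no_types, lifting) scaleR_zero_left sum.neutral)
      then show False using that by simp
    qed
    then obtain b where "b \<in> B" "representation B y b \<noteq> 0" by blast
    then show ?thesis unfolding h_def using finite_B by (intro sum_pos2[of B b]) auto
  qed
  have h_int: "h y = of_int \<lfloor>h y\<rfloor>" if "y \<in> N" for y
  proof -
    have "h y \<in> \<int>" unfolding h_def using coord_Ints[OF that] by (intro Ints_sum) auto
    then show ?thesis by (auto elim: Ints_cases)
  qed
  define R where "R = (\<lambda>y. y \<in> N \<and> y \<noteq> 0 \<and> y \<in> nonneg_hull {x})"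
  have "R x" unfolding R_def using x subset_nonneg_hull[of "{x}"] by simp
  from ex_has_least_nat[of R x "\<lambda>y. nat \<lfloor>h y\<rfloor>", OF this]
  obtain p where p: "R p" and min: "\<forall>y. R y \<longrightarrow> nat \<lfloor>h p\<rfloor> \<le> nat \<lfloor>h y\<rfloor>" by (elim exE conjE)
  have min': "h p \<le> h y" if "R y" for y
  proof -
    have "0 < h y" "0 < h p" using h_pos that p by (auto simp: R_def)
    then have "\<lfloor>h p\<rfloor> \<le> \<lfloor>h y\<rfloor>" using min[rule_format, OF that] by linarith
    then have "real_of_int \<lfloor>h p\<rfloor> \<le> of_int \<lfloor>h y\<rfloor>" by simp
    moreover have "y \<in> N" "p \<in> N" using that p by (auto simp: R_def)
    ultimately show ?thesis using h_int[of p] h_int[of y] by simp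
  qed
  obtain c where c: "p = c *\<^sub>R x" "0 < c"
    using p unfolding R_def nonneg_hull_singleton by (auto simp: order_le_less)
  have "\<exists>k::int. q = of_int k *\<^sub>R p" if q: "q \<in> N" "q \<in> nonneg_hull {x}" for q
  proof -
    obtain d where d: "q = d *\<^sub>R x" using q(2) by (auto simp: nonneg_hull_singleton)
    define r where "r = d / c"
    have qr: "q = r *\<^sub>R p" using c by (simp add: d r_def)
    \<comment> \<open>Division with remainder: the remainder is a lattice vector of the ray of
      smaller height than \<open>p\<close>, so it is 0.\<close>
    define y where "y = q - of_int \<lfloor>r\<rfloor> *\<^sub>R p"
    have y_eq: "y = frac r *\<^sub>R p" unfolding y_def by (simp add: qr frac_def scaleR_diff_left)
    have "y = (frac r * c) *\<^sub>R x" by (simp add: y_eq c)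
    then have "y \<in> nonneg_hull {x}" unfolding nonneg_hull_singleton using c(2) frac_ge_0 by fastforce
    moreover have "y \<in> N" unfolding y_def using q p by (intro N_diff N_of_int_scale) (auto simp: R_def)
    moreover have "h y < h p"
      unfolding y_eq using h_scale[OF frac_ge_0] h_pos[of p] p frac_lt_1[of r] by (simp add: R_def)
    ultimately have "y = 0" using min'[of y] by (auto simp: R_def)
    then show ?thesis unfolding y_def by auto
  qed
  then show ?thesis using p by (intro that[of p]) (auto simp: R_def)
qed

text \<open>The generator of the lattice vectors of the ray is primitive. Any other primitive vector
  of the ray is an integer multiple of it with factor 1 or - 1, and - 1 leaves the ray.\<close>

lemma ex1_primitive:
  assumes x: "x \<in> N" "x \<noteq> 0"
  shows "\<exists>!p. p \<in> nonneg_hull {x} \<and> primitive_vector N p"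
proof -
  obtain p where p: "p \<in> N" "p \<noteq> 0" "p \<in> nonneg_hull {x}"
    and gen: "\<And>q. q \<in> N \<Longrightarrow> q \<in> nonneg_hull {x} \<Longrightarrow> \<exists>k::int. q = of_int k *\<^sub>R p"
    using ray_generator[OF x] by metis
  obtain c where c: "p = c *\<^sub>R x" "0 < c"
    using p unfolding nonneg_hull_singleton by (auto simp: order_le_less)
  have unit: "\<bar>k\<bar> = 1" if y: "y \<in> N" and pk: "p = of_int k *\<^sub>R y" for y and k :: int
  proof -
    have "k \<noteq> 0" using pk p by auto
    \<comment> \<open>The sign moves \<open>y\<close> onto the ray, where it is an integer multiple
      of \<open>p\<close>; so \<open>\<bar>k\<bar>\<close> divides 1.\<close>
    define y' where "y' = of_int (sgn k) *\<^sub>R y"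
    have kk: "real_of_int k * of_int (sgn k) = of_int \<bar>k\<bar>" by (simp only: abs_sgn of_int_mult)
    have ss: "real_of_int (sgn k) * real_of_int (sgn k) = 1" using \<open>k \<noteq> 0\<close> by (simp add: sgn_if)
    have py': "p = of_int \<bar>k\<bar> *\<^sub>R y'"
      unfolding y'_def pk kk[symmetric] scaleR_scaleR mult.assoc ss by simp
    have "y' = (1 / of_int \<bar>k\<bar>) *\<^sub>R p" unfolding py' using \<open>k \<noteq> 0\<close> by simp
    then have "y' = (c / of_int \<bar>k\<bar>) *\<^sub>R x" by (simp add: c)
    moreover have "0 \<le> c / of_int \<bar>k\<bar>" using c by simp
    ultimately have "y' \<in> nonneg_hull {x}" unfolding nonneg_hull_singleton by blast
    moreover have "y' \<in> N" unfolding y'_def by (rule N_of_int_scale[OF y])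
    ultimately obtain j :: int where "y' = of_int j *\<^sub>R p" using gen by blast
    then have "p = of_int \<bar>k\<bar> *\<^sub>R of_int j *\<^sub>R p" using py' by (simp only:)
    then have "1 *\<^sub>R p = of_int (\<bar>k\<bar> * j) *\<^sub>R p" by (simp only: scaleR_scaleR of_int_mult scaleR_one)
    then have "1 = real_of_int (\<bar>k\<bar> * j)" using p(2) scaleR_cancel_right by blast
    then have "\<bar>k\<bar> * j = 1" by (metis of_int_1 of_int_eq_iff)
    then show ?thesis using zmult_eq_1_iff[of "\<bar>k\<bar>" j] by auto
  qed
  have prim_p: "primitive_vector N p" unfolding primitive_vector_def using p unit by blast
  show ?thesis
  proof (rule ex1I[of _ p])
    show "p \<in> nonneg_hull {x} \<and> primitive_vector N p" using p prim_p by simp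
    fix q assume q: "q \<in> nonneg_hull {x} \<and> primitive_vector N q"
    then obtain k :: int where k: "q = of_int k *\<^sub>R p" using gen unfolding primitive_vector_def by blast
    then have "\<bar>k\<bar> = 1" using q p unfolding primitive_vector_def by blast
    moreover have "k \<noteq> - 1"
    proof
      assume "k = - 1"
      then have "q = (- c) *\<^sub>R x" using k c by simp
      moreover obtain d where "0 \<le> d" "q = d *\<^sub>R x" using q by (auto simp: nonneg_hull_singleton)
      ultimately have "d = - c" using x(2) by (metis scaleR_cancel_right)
      then show False using c \<open>0 \<le> d\<close> by simp
    qed
    ultimately have "k = 1" by linarith
    then show "q = p" using k by simp
  qed
qed

end

section \<open>Complete simplicial multi-fans\<close>

locale complete_simplicial_fan = lattice_basis B N for B :: "'a::real_vector set" and N +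
  fixes n :: nat and \<Delta> :: "('s, 'a) multi_fan"
  assumes card_B: "card B = n" and complete: "complete_multi_fan n N \<Delta>" and simplicial: "simplicial_fan \<Delta>"
begin

abbreviation C :: "'s \<Rightarrow> 'a set" where "C \<equiv> cone_of \<Delta>"
abbreviation D :: "'s set" where "D \<equiv> of_dim \<Delta> n"
abbreviation V :: "'s \<Rightarrow> 's set" where "V \<equiv> verts \<Delta>"
abbreviation e :: "'s \<Rightarrow> 'a" where "e \<equiv> prim N \<Delta>"
abbreviation U :: "'s \<Rightarrow> 's \<Rightarrow> 'a \<Rightarrow> real" where "U \<equiv> dual_vec N \<Delta>"

lemma fan: "is_multi_fan n N \<Delta>"
  using complete by (simp add: complete_multi_fan_def)

lemma finite_idx: "finite (idx \<Delta>)"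
  using fan by (simp add: is_multi_fan_def)

lemma leq_order: "trans (leq \<Delta>)" "leq \<Delta> \<subseteq> idx \<Delta> \<times> idx \<Delta>"
  using fan by (simp_all add: is_multi_fan_def partial_order_on_def preorder_on_def)

lemma leq_idx: "(I, J) \<in> leq \<Delta> \<Longrightarrow> I \<in> idx \<Delta> \<and> J \<in> idx \<Delta>"
  using leq_order(2) by blast

lemma leq_trans: "(I, J) \<in> leq \<Delta> \<Longrightarrow> (J, K) \<in> leq \<Delta> \<Longrightarrow> (I, K) \<in> leq \<Delta>"
  using leq_order(1) by (rule transD)

lemma faces_bij:
  "J \<in> idx \<Delta> \<Longrightarrow> bij_betw C {I. (I, J) \<in> leq \<Delta>} {\<kappa> \<in> Cone N. \<kappa> face_of C J}"
  using fan unfolding is_multi_fan_def by blast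

lemma leq_face: "(I, J) \<in> leq \<Delta> \<Longrightarrow> C I face_of C J"
  using bij_betwE[OF faces_bij] leq_idx by blast

lemma face_leq:
  assumes "J \<in> idx \<Delta>" "\<kappa> \<in> Cone N" "\<kappa> face_of C J"
  shows "\<exists>I. (I, J) \<in> leq \<Delta> \<and> C I = \<kappa>"
proof -
  have "\<kappa> \<in> C ` {I. (I, J) \<in> leq \<Delta>}"
    using bij_betw_imp_surj_on[OF faces_bij[OF assms(1)]] assms by auto
  then show ?thesis by blast
qed

lemma leq_inj: "(I, J) \<in> leq \<Delta> \<Longrightarrow> (I', J) \<in> leq \<Delta> \<Longrightarrow> C I = C I' \<Longrightarrow> I = I'"
  using bij_betw_imp_inj_on[OF faces_bij[of J]] leq_idx by (metis (mono_tags, lifting) inj_onD mem_Collect_eq)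

lemma primitive_ray_unique:
  assumes "primitive_vector N p" "primitive_vector N q" "nonneg_hull {p} = nonneg_hull {q}"
  shows "p = q"
proof -
  have "p \<in> nonneg_hull {p}" "q \<in> nonneg_hull {p}"
    using subset_nonneg_hull[of "{p}"] subset_nonneg_hull[of "{q}"] assms(3) by auto
  moreover have "\<exists>!x. x \<in> nonneg_hull {p} \<and> primitive_vector N x"
    using assms(1) by (intro ex1_primitive) (auto simp: primitive_vector_def)
  ultimately show ?thesis using assms(1,2) by blast
qed

lemma prim_eq:
  assumes "C i = nonneg_hull {p}" "primitive_vector N p"
  shows "e i = p"
proof -
  have "\<exists>!x. x \<in> nonneg_hull {p} \<and> primitive_vector N x"
    using assms(2) by (intro ex1_primitive) (auto simp: primitive_vector_def)
  moreover have "p \<in> nonneg_hull {p}" using subset_nonneg_hull[of "{p}"] by simp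
  ultimately show ?thesis unfolding prim_def assms(1) using assms(2) by (intro the1_equality) auto
qed

text \<open>\<open>simplicial_fan\<close> gives independent generators that need not be lattice
  vectors, \<open>Cone N\<close> gives lattice generators that need not be independent. Comparing
  extreme rays shows that the independent ones lie on lattice rays, so they can be rescaled to
  primitive vectors.\<close>

lemma primitive_generators:
  assumes J: "J \<in> idx \<Delta>"
  obtains A where "finite A" "independent A" "\<And>a. a \<in> A \<Longrightarrow> primitive_vector N a" "C J = nonneg_hull A"
proof -
  obtain A where A: "finite A" "independent A" "C J = nonneg_hull A"
    using simplicial J unfolding simplicial_fan_def by blast
  obtain f :: "'a \<Rightarrow> 'a \<Rightarrow> real" where f: "\<And>a. linear (f a)"
    "\<And>a b. a \<in> A \<Longrightarrow> b \<in> A \<Longrightarrow> f a b = (if b = a then 1 else 0)"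
    using dual_family[OF A(2)] by metis
  have "C J \<in> Cone N" using fan J by (simp add: is_multi_fan_def)
  then have "\<exists>A'. finite A' \<and> A' \<subseteq> N \<and> C J = nonneg_hull A'"
    unfolding Cone_def mem_Collect_eq by (rule conjunct1)
  then obtain A' where A': "finite A'" "A' \<subseteq> N" "nonneg_hull A = nonneg_hull A'"
    unfolding A(3) by (elim exE conjE)
  have "\<exists>s>0. primitive_vector N (s *\<^sub>R a)" if a: "a \<in> A" for a
  proof -
    obtain x t where x: "x \<in> A'" "0 < t" "x = t *\<^sub>R a"
      using nonneg_hull_ray_generator[OF A(1) f A'(1,3) a] by blast
    have "a \<noteq> 0" using a A(2) dependent_zero by blast
    then have "x \<noteq> 0" using x by simp
    then obtain p where p: "p \<in> nonneg_hull {x}" "primitive_vector N p"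
      using ex1_primitive[of x] x A'(2) by blast
    obtain r where r: "0 \<le> r" "p = r *\<^sub>R x" using p(1) by (auto simp: nonneg_hull_singleton)
    moreover have "r \<noteq> 0" using p(2) r by (auto simp: primitive_vector_def)
    ultimately have "p = (r * t) *\<^sub>R a" "0 < r * t" using x by auto
    then show ?thesis using p(2) by blast
  qed
  then obtain s where s: "\<And>a. a \<in> A \<Longrightarrow> 0 < s a" "\<And>a. a \<in> A \<Longrightarrow> primitive_vector N (s a *\<^sub>R a)" by metis
  show ?thesis
    by (rule that[of "(\<lambda>a. s a *\<^sub>R a) ` A"])
      (use independent_scaled[OF A(1,2) s(1)] A s(2) in auto)
qed

lemma ray_prim:
  assumes "i \<in> of_dim \<Delta> 1"
  shows "C i = nonneg_hull {e i}" "primitive_vector N (e i)"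
proof -
  obtain A where A: "finite A" "independent A" "\<And>a. a \<in> A \<Longrightarrow> primitive_vector N a" "C i = nonneg_hull A"
    using primitive_generators[of i] assms by (auto simp: of_dim_def)
  have "card A = 1" using dim_nonneg_hull[OF A(1,2)] A(4) assms by (simp add: of_dim_def)
  then obtain a where "A = {a}" using card_1_singletonE by blast
  then have "C i = nonneg_hull {a}" "primitive_vector N a" using A by auto
  then show "C i = nonneg_hull {e i}" "primitive_vector N (e i)" using prim_eq[of i a] by auto
qed

text \<open>The rays of \<open>C J\<close> found among cones and those found in the index poset are
  matched: each generator spans a face, which has an index below \<open>J\<close>, and each
  one-dimensional index below \<open>J\<close> gives a face, which must be the ray of a
  generator.\<close>

lemma verts_generate:
  assumes J: "J \<in> idx \<Delta>"
  shows "independent (e ` V J)" "inj_on e (V J)" "C J = nonneg_hull (e ` V J)"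
proof -
  obtain A where A: "finite A" "independent A" "\<And>a. a \<in> A \<Longrightarrow> primitive_vector N a" "C J = nonneg_hull A"
    using primitive_generators[OF J] by metis
  obtain f :: "'a \<Rightarrow> 'a \<Rightarrow> real" where f: "\<And>a. linear (f a)"
    "\<And>a b. a \<in> A \<Longrightarrow> b \<in> A \<Longrightarrow> f a b = (if b = a then 1 else 0)"
    using dual_family[OF A(2)] by metis
  have "e ` V J = A"
  proof
    show "e ` V J \<subseteq> A"
    proof
      fix x assume "x \<in> e ` V J"
      then obtain i where i: "i \<in> of_dim \<Delta> 1" "(i, J) \<in> leq \<Delta>" "x = e i" by (auto simp: verts_def)
      note r = ray_prim[OF i(1)]
      have "nonneg_hull {e i} face_of nonneg_hull A" using leq_face[OF i(2)] r A(4) by simp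
      moreover have "e i \<noteq> 0" using r(2) by (simp add: primitive_vector_def)
      ultimately obtain a where a: "a \<in> A" "nonneg_hull {e i} = nonneg_hull {a}"
        using nonneg_hull_ray_face[OF A(1) f] by blast
      then show "x \<in> A" using primitive_ray_unique[OF r(2) A(3)] i(3) by simp
    qed
    show "A \<subseteq> e ` V J"
    proof
      fix a assume a: "a \<in> A"
      have indep: "independent {a}" using A(2) a by (meson dependent_mono empty_subsetI insert_subset)
      have "a \<in> N" using A(3)[OF a] by (simp add: primitive_vector_def)
      then have "nonneg_hull {a} \<in> Cone N" using indep by (intro nonneg_hull_in_Cone) auto
      moreover have "nonneg_hull {a} face_of C J"
        unfolding A(4) by (rule nonneg_hull_face[OF A(1) f]) (use a in auto)
      ultimately obtain i where i: "(i, J) \<in> leq \<Delta>" "C i = nonneg_hull {a}" using face_leq[OF J] by blast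
      have "dim (C i) = 1" using dim_nonneg_hull[of "{a}"] indep i(2) by simp
      then have "i \<in> V J" using i leq_idx by (auto simp: verts_def of_dim_def)
      moreover have "e i = a" using prim_eq[OF i(2) A(3)[OF a]] .
      ultimately show "a \<in> e ` V J" by blast
    qed
  qed
  then show "independent (e ` V J)" "C J = nonneg_hull (e ` V J)" using A by auto
  show "inj_on e (V J)"
  proof (rule inj_onI)
    fix i j assume "i \<in> V J" "j \<in> V J" "e i = e j"
    then show "i = j" using leq_inj[of i J j] ray_prim(1) by (auto simp: verts_def)
  qed
qed

lemma finite_verts: "finite (V J)"
  using finite_idx by (rule rev_finite_subset) (auto simp: verts_def of_dim_def)

lemma prim_in_N: "e ` V J \<subseteq> N"
  using ray_prim(2) by (auto simp: verts_def primitive_vector_def)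

lemma dim_C: "J \<in> idx \<Delta> \<Longrightarrow> dim (C J) = card (V J)"
  using dim_nonneg_hull[of "e ` V J"] verts_generate[of J] finite_verts by (simp add: card_image)

lemma span_C: "J \<in> idx \<Delta> \<Longrightarrow> span (C J) = span (e ` V J)"
  using span_nonneg_hull[of "e ` V J"] verts_generate(3)[of J] finite_verts by simp

lemma verts_mono: "(K, J) \<in> leq \<Delta> \<Longrightarrow> V K \<subseteq> V J"
  by (auto simp: verts_def intro: leq_trans)

lemma independent_hull_inj:
  assumes "independent E" "S \<subseteq> E" "T \<subseteq> E" "finite S" "nonneg_hull S = nonneg_hull T"
  shows "S \<subseteq> T"
proof
  fix x assume x: "x \<in> S"
  then have "x \<in> span T" using subset_nonneg_hull[OF assms(4)] assms(5) nonneg_hull_subset_span by blast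
  show "x \<in> T"
  proof (rule ccontr)
    assume "x \<notin> T"
    then have "T \<subseteq> E - {x}" using assms(3) by blast
    then have "x \<in> span (E - {x})" using \<open>x \<in> span T\<close> span_mono by blast
    then show False using assms(1,2) x unfolding dependent_def by blast
  qed
qed

text \<open>Each subset of the generators of a simplicial cone spans a face, and this face has an
  index. Independence of the generators shows that its vertices are no more than the given
  ones.\<close>

lemma subset_verts_index:
  assumes J: "J \<in> idx \<Delta>" and S: "S \<subseteq> V J"
  shows "\<exists>K. (K, J) \<in> leq \<Delta> \<and> V K = S"
proof -
  note g = verts_generate[OF J]
  have fin: "finite (e ` V J)" using finite_verts by simp
  obtain f :: "'a \<Rightarrow> 'a \<Rightarrow> real" where f: "\<And>a. linear (f a)"
    "\<And>a b. a \<in> e ` V J \<Longrightarrow> b \<in> e ` V J \<Longrightarrow> f a b = (if b = a then 1 else 0)"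
    using dual_family[OF g(1)] by metis
  have S': "e ` S \<subseteq> e ` V J" using S by blast
  have "nonneg_hull (e ` S) \<in> Cone N"
  proof (rule nonneg_hull_in_Cone)
    show "finite (e ` S)" using finite_subset[OF S' fin] .
    show "independent (e ` S)" using independent_mono[OF g(1) S'] .
    show "e ` S \<subseteq> N" using prim_in_N[of J] S' by blast
  qed
  moreover have "nonneg_hull (e ` S) face_of C J"
    unfolding g(3) by (rule nonneg_hull_face[OF fin f S'])
  ultimately obtain K where K: "(K, J) \<in> leq \<Delta>" "C K = nonneg_hull (e ` S)" using face_leq[OF J] by blast
  have VK: "V K \<subseteq> V J" using verts_mono[OF K(1)] .
  have hull: "nonneg_hull (e ` V K) = nonneg_hull (e ` S)"
    using verts_generate(3)[of K] K leq_idx by auto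
  have "e ` V K = e ` S"
    using independent_hull_inj[OF g(1) _ S' _ hull] independent_hull_inj[OF g(1) S' _ _ hull[symmetric]] VK
      finite_verts finite_subset[OF S' fin] by blast
  then have "V K = S" using inj_on_image_eq_iff[OF g(2) VK S] by simp
  then show ?thesis using K by blast
qed

lemma verts_inj:
  assumes "(K, J) \<in> leq \<Delta>" "(K', J) \<in> leq \<Delta>" "V K = V K'"
  shows "K = K'"
proof -
  have "K \<in> idx \<Delta>" "K' \<in> idx \<Delta>" using assms leq_idx by blast+
  then show ?thesis using leq_inj[OF assms(1,2)] verts_generate(3) assms(3) by simp
qed

text \<open>The choice is unambiguous: below a fixed \<open>J\<close> an index is determined by its
  vertices (\<open>verts_inj\<close>).\<close>

definition facet :: "'s \<Rightarrow> 's \<Rightarrow> 's" where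
  "facet J i = (SOME K. (K, J) \<in> leq \<Delta> \<and> V K = V J - {i})"

lemma facet:
  assumes "J \<in> idx \<Delta>"
  shows "(facet J i, J) \<in> leq \<Delta>" "V (facet J i) = V J - {i}"
  using someI_ex[OF subset_verts_index[OF assms, of "V J - {i}"]] unfolding facet_def by auto

section \<open>Dual bases of maximal cones and weights around facets\<close>

lemma D_idx: "J \<in> D \<Longrightarrow> J \<in> idx \<Delta>" by (simp add: of_dim_def)

lemma card_verts: "J \<in> D \<Longrightarrow> card (V J) = n"
  using dim_C[of J] by (simp add: of_dim_def)

text \<open>The ambient type is an arbitrary \<open>real_vector\<close>; the basis \<open>B\<close>
  gives access to dimension arguments for subspaces.\<close>

sublocale fd: finite_dimensional_vector_space scaleR B
  rewrites "module.span scaleR = span" and "module.dependent scaleR = dependent"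
    and "module.subspace scaleR = subspace" and "vector_space.dim scaleR = dim"
  by unfold_locales
    (use finite_B indep_B span_B in \<open>auto simp: algebra_simps dependent_raw_def span_raw_def dim_raw_def subspace_raw_def\<close>)

lemma span_verts:
  assumes "J \<in> D"
  shows "span (e ` V J) = UNIV"
proof -
  note g = verts_generate[OF D_idx[OF assms]]
  have "dim (UNIV :: 'a set) = card B" using dim_eq_card[of B UNIV] indep_B span_B by simp
  also have "\<dots> = card (e ` V J)" using card_B card_verts[OF assms] card_image[OF g(2)] by simp
  finally have "UNIV \<subseteq> span (e ` V J)" using fd.card_ge_dim_independent[of "e ` V J" UNIV] g(1) by simp
  then show ?thesis by blast
qed

text \<open>Stated for arbitrary prescribed values so as to justify both definite descriptions,
  \<open>dual_vec\<close> and \<open>vertex\<close>.\<close>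

lemma dual_vec_unique:
  assumes J: "J \<in> D"
  shows "\<exists>!u. u \<in> dual_space \<and> (\<forall>j\<in>V J. u (e j) = c j)"
proof -
  note g = verts_generate[OF D_idx[OF J]]
  obtain u :: "'a \<Rightarrow> real" where u: "linear u" "\<And>x. x \<in> e ` V J \<Longrightarrow> u x = c (the_inv_into (V J) e x)"
    using linear_independent_extend[OF g(1), of "\<lambda>x. c (the_inv_into (V J) e x)"] by blast
  show ?thesis
  proof (rule ex1I[of _ u])
    show "u \<in> dual_space \<and> (\<forall>j\<in>V J. u (e j) = c j)"
      using u the_inv_into_f_f[OF g(2)] by (simp add: dual_space_def)
    fix u' assume u': "u' \<in> dual_space \<and> (\<forall>j\<in>V J. u' (e j) = c j)"
    then have "linear u'" by (simp add: dual_space_def)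
    moreover have "u' x = u x" if "x \<in> e ` V J" for x
      using that u' u(2) the_inv_into_f_f[OF g(2)] by auto
    ultimately have "u' x = u x" for x
      using linear_eq_on_span[of u' u "e ` V J" x] u(1) span_verts[OF J] by auto
    then show "u' = u" by (rule ext)
  qed
qed

lemma dual_vec:
  assumes "J \<in> D"
  shows "linear (U J i)" "j \<in> V J \<Longrightarrow> U J i (e j) = (if j = i then 1 else 0)"
  using theI'[OF dual_vec_unique[OF assms, of "\<lambda>j. if j = i then 1 else 0"]]
  unfolding dual_vec_def[symmetric] by (auto simp: dual_space_def)

lemma dual_vec_expand:
  assumes J: "J \<in> D"
  shows "(\<Sum>i\<in>V J. U J i x *\<^sub>R e i) = x"
proof -
  have lin: "linear (\<lambda>x. \<Sum>i\<in>V J. U J i x *\<^sub>R e i)"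
    using dual_vec(1)[OF J]
    by (intro linear_compose_sum ballI) (auto intro!: linearI simp: linear_add linear_scale scaleR_add_left)
  have "(\<Sum>i\<in>V J. U J i y *\<^sub>R e i) = y" if y: "y \<in> e ` V J" for y
  proof -
    obtain j where j: "j \<in> V J" "y = e j" using y by blast
    have "(\<Sum>i\<in>V J. U J i y *\<^sub>R e i) = (\<Sum>i\<in>V J. if i = j then e i else 0)"
      unfolding j(2) using dual_vec(2)[OF J j(1)] by (intro sum.cong) auto
    then show ?thesis using j finite_verts by simp
  qed
  then show ?thesis
    using linear_eq_on_span[OF lin linear_id[unfolded id_def], of "e ` V J" x] span_verts[OF J] by auto
qed

lemma span_facet:
  assumes J: "J \<in> D" and i: "i \<in> V J"
  shows "x \<in> span (e ` (V J - {i})) \<longleftrightarrow> U J i x = 0"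
proof
  assume x: "x \<in> span (e ` (V J - {i}))"
  have "U J i y = 0" if "y \<in> e ` (V J - {i})" for y
    using that dual_vec(2)[OF J] by (auto split: if_splits)
  then show "U J i x = 0" using linear_eq_0_on_span[OF dual_vec(1)[OF J] _ x] by blast
next
  assume "U J i x = 0"
  then have "x = (\<Sum>j\<in>V J - {i}. U J j x *\<^sub>R e j)"
    using dual_vec_expand[OF J, of x] sum.remove[OF finite_verts i, of "\<lambda>j. U J j x *\<^sub>R e j"] by simp
  also have "\<dots> \<in> span (e ` (V J - {i}))" by (intro span_sum span_scale span_base) auto
  finally show "x \<in> span (e ` (V J - {i}))" .
qed

lemma generic_dual_vec_nonzero:
  assumes v: "generic n \<Delta> v" and J: "J \<in> D" and i: "i \<in> V J"
  shows "U J i v \<noteq> 0"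
proof
  assume "U J i v = 0"
  then have "v \<in> span (e ` (V J - {i}))" using span_facet[OF J i] by simp
  moreover have K: "facet J i \<in> idx \<Delta>" "V (facet J i) = V J - {i}"
    using facet[OF D_idx[OF J], of i] leq_idx by auto
  moreover have "dim (C (facet J i)) < n"
    using dim_C[OF K(1)] K(2) card_verts[OF J] card_Diff1_less[OF finite_verts i] by simp
  ultimately show False using v span_C[OF K(1)] unfolding generic_in_def by auto
qed

text \<open>This carries \<open>quot_span\<close> and \<open>quot_dim\<close> of a projected cone
  back to span and dimension of the original cone.\<close>

lemma Union_cosets_span:
  assumes "(K, J) \<in> leq \<Delta>" and W: "W = span (C K)"
  shows "span (\<Union>x\<in>C J. x +o W) = span (C J)"
proof
  have KJ: "C K \<subseteq> C J" using leq_face[OF assms(1)] by (simp add: face_of_def)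
  have "x + b \<in> span (C J)" if "x \<in> C J" "b \<in> W" for x b
    using that span_mono[OF KJ] unfolding W by (intro span_add[OF span_base]) auto
  then have "(\<Union>x\<in>C J. x +o W) \<subseteq> span (C J)" by (auto simp: elt_set_plus_def)
  then show "span (\<Union>x\<in>C J. x +o W) \<subseteq> span (C J)" by (metis span_mono span_span)
  have "x \<in> x +o W" for x
    using span_zero[of "C K"] unfolding W by (force simp: elt_set_plus_def)
  then have "C J \<subseteq> (\<Union>x\<in>C J. x +o W)" by blast
  then show "span (C J) \<subseteq> span (\<Union>x\<in>C J. x +o W)" by (rule span_mono)
qed

text \<open>The pairs in \<open>balance\<close> correspond to the maximal indices above
  \<open>K\<close>, over which the projected multi-fan sums: \<open>i\<close> is the only vertex of
  \<open>J\<close> that \<open>K\<close> lacks.\<close>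

lemma facet_cofaces:
  assumes J0: "J0 \<in> D" "i0 \<in> V J0" and K: "K = facet J0 i0"
  shows "bij_betw fst {(J, i). (J, i) \<in> Sigma D V \<and> facet J i = K} {J \<in> D. (K, J) \<in> leq \<Delta>}"
proof (rule bij_betw_imageI)
  have VK: "V K = V J0 - {i0}" using facet[OF D_idx[OF J0(1)]] K by simp
  have same: "i = i'" if "i \<in> V J" "i' \<in> V J" "facet J i = facet J i'" "J \<in> D" for J i i'
    using facet(2)[OF D_idx[OF that(4)]] that by (metis Diff_iff insertI1 singletonD)
  show "inj_on fst {(J, i). (J, i) \<in> Sigma D V \<and> facet J i = K}"
    by (rule inj_onI) (use same in auto)
  show "fst ` {(J, i). (J, i) \<in> Sigma D V \<and> facet J i = K} = {J \<in> D. (K, J) \<in> leq \<Delta>}"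
  proof (intro equalityI subsetI)
    fix J assume "J \<in> fst ` {(J, i). (J, i) \<in> Sigma D V \<and> facet J i = K}"
    then show "J \<in> {J \<in> D. (K, J) \<in> leq \<Delta>}" using facet(1) D_idx by auto
  next
    fix J assume "J \<in> {J \<in> D. (K, J) \<in> leq \<Delta>}"
    then have J: "J \<in> D" "(K, J) \<in> leq \<Delta>" by auto
    have sub: "V K \<subseteq> V J" using verts_mono[OF J(2)] .
    have "card (V K) = n - 1" using VK J0 card_verts[OF J0(1)] finite_verts by simp
    moreover have "0 < n" using J0 card_verts[OF J0(1)] finite_verts card_gt_0_iff by blast
    ultimately have "card (V J - V K) = 1"
      using card_Diff_subset[OF finite_verts sub] card_verts[OF J(1)] by simp
    then obtain i where i: "V J - V K = {i}" by (auto simp: card_1_singleton_iff)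
    then have "V K = V J - {i}" "i \<in> V J" using sub by auto
    then have "facet J i = K"
      using verts_inj[OF facet(1)[OF D_idx[OF J(1)]] J(2)] facet(2)[OF D_idx[OF J(1)]] by simp
    then show "J \<in> fst ` {(J, i). (J, i) \<in> Sigma D V \<and> facet J i = K}" using J i \<open>i \<in> V J\<close> by force
  qed
qed

text \<open>The quotient by the span of a facet is a line with coordinate \<open>U J i\<close>, and
  the cone of \<open>J\<close> is mapped onto its nonnegative half.\<close>

lemma coset_in_cone:
  assumes J: "J \<in> D" and i: "i \<in> V J" and W: "W = span (C (facet J i))" and p: "U J i p \<noteq> 0"
  shows "p +o W \<in> (\<lambda>x. x +o W) ` C J \<longleftrightarrow> 0 < U J i p"
proof -
  have idx: "facet J i \<in> idx \<Delta>" and VK: "V (facet J i) = V J - {i}"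
    using leq_idx[OF facet(1)[OF D_idx[OF J]]] facet(2)[OF D_idx[OF J]] by auto
  have inW: "x \<in> W \<longleftrightarrow> U J i x = 0" for x
    unfolding W span_C[OF idx] VK using span_facet[OF J i] .
  have subW: "subspace W" unfolding W by (rule subspace_span)
  have coset: "x +o W = y +o W \<longleftrightarrow> x - y \<in> W" for x y
  proof
    assume "x +o W = y +o W"
    moreover have "x \<in> x +o W" using subspace_0[OF subW] by (force simp: elt_set_plus_def)
    ultimately show "x - y \<in> W" by (auto simp: elt_set_plus_def)
  next
    assume *: "x - y \<in> W"
    have "\<exists>b\<in>W. x + a = y + b" if "a \<in> W" for a
      using subspace_add[OF subW * that] by (intro bexI[of _ "x - y + a"]) (auto simp: algebra_simps)
    moreover have "\<exists>b\<in>W. y + a = x + b" if "a \<in> W" for a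
      using subspace_diff[OF subW that *] by (intro bexI[of _ "a - (x - y)"]) (auto simp: algebra_simps)
    ultimately show "x +o W = y +o W" unfolding elt_set_plus_def by blast
  qed
  note g = verts_generate[OF D_idx[OF J]]
  show ?thesis
  proof
    assume "p +o W \<in> (\<lambda>x. x +o W) ` C J"
    then obtain x where x: "x \<in> C J" "p - x \<in> W" using coset by auto
    then obtain t where t: "\<And>a. a \<in> e ` V J \<Longrightarrow> 0 \<le> t a" "x = (\<Sum>a\<in>e ` V J. t a *\<^sub>R a)"
      unfolding g(3) nonneg_hull_def by blast
    have "x = (\<Sum>j\<in>V J. t (e j) *\<^sub>R e j)" using t(2) by (simp add: sum.reindex[OF g(2)])
    then have "U J i x = (\<Sum>j\<in>V J. t (e j) * U J i (e j))"
      using dual_vec(1)[OF J, of i] by (simp add: linear_sum linear_scale)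
    also have "\<dots> = (\<Sum>j\<in>V J. if j = i then t (e j) else 0)"
      by (intro sum.cong) (auto simp: dual_vec(2)[OF J])
    also have "\<dots> \<ge> 0" using t(1) i finite_verts by simp
    finally have "0 \<le> U J i x" .
    moreover have "U J i p = U J i x" using x(2) inW dual_vec(1)[OF J, of i] by (simp add: linear_diff)
    ultimately show "0 < U J i p" using p by simp
  next
    assume pos: "0 < U J i p"
    have "U J i p *\<^sub>R e i \<in> nonneg_hull {e i}" using pos by (auto simp: nonneg_hull_singleton)
    moreover have "nonneg_hull {e i} \<subseteq> C J"
    proof -
      have "(i, J) \<in> leq \<Delta>" "i \<in> of_dim \<Delta> 1" using i by (auto simp: verts_def)
      then show ?thesis using leq_face ray_prim(1) unfolding face_of_def by metis
    qed
    moreover have "p - U J i p *\<^sub>R e i \<in> W"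
      unfolding inW using dual_vec[OF J, of i] i by (simp add: linear_diff linear_scale)
    ultimately show "p +o W \<in> (\<lambda>x. x +o W) ` C J" using coset by blast
  qed
qed

text \<open>
  Balancing condition: the projected multi-fan of a facet is one-dimensional, and its pre-completeness
  says that the two sides of the facet carry the same total weight.
\<close>

lemma facet_balance:
  assumes p: "\<And>J i. J \<in> D \<Longrightarrow> i \<in> V J \<Longrightarrow> U J i p \<noteq> 0"
  shows "(\<Sum>(J, i) | (J, i) \<in> Sigma D V \<and> facet J i = K. of_int (weight \<Delta> J) * sgn (U J i p)) = (0 :: real)"
proof (cases "{(J, i). (J, i) \<in> Sigma D V \<and> facet J i = K} = {}")
  case True
  then show ?thesis by (metis (no_types, lifting) sum.empty)
next
  case False
  define Q where "Q = {(J, i). (J, i) \<in> Sigma D V \<and> facet J i = K}"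
  obtain J0 i0 where J0: "J0 \<in> D" "i0 \<in> V J0" "facet J0 i0 = K" using False by auto
  have K: "K \<in> idx \<Delta>" "V K = V J0 - {i0}" using facet[OF D_idx[OF J0(1)], of i0] J0(3) leq_idx by auto
  have n0: "0 < n" using J0 card_verts[OF J0(1)] finite_verts card_gt_0_iff by blast
  have dimK: "dim (C K) = n - 1" using dim_C[OF K(1)] K(2) J0 card_verts[OF J0(1)] finite_verts by simp
  define W where "W = span (C K)"
  have dimW: "dim W = n - 1" by (simp add: W_def dimK)
  have qdim: "quot_dim W (cone_of (projected \<Delta> K) J) = dim (C J) - (n - 1)" if "(K, J) \<in> leq \<Delta>" for J
  proof -
    have "dim (\<Union>x\<in>C J. x +o W) = dim (C J)" using Union_cosets_span[OF that W_def] by (metis dim_span)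
    then show ?thesis by (simp add: quot_dim_def projected_def W_def[symmetric] dimW)
  qed
  have dim_le: "dim (C J) \<le> n" for J
    using fd.dim_subset[of "C J" UNIV] dim_eq_card[of B UNIV] indep_B span_B card_B by simp
  \<comment> \<open>The quotient has dimension 1, so the maximal members of the projected multi-fan
    are the maximal indices above \<open>K\<close>.\<close>
  have S1: "{J \<in> idx (projected \<Delta> K). quot_dim W (cone_of (projected \<Delta> K) J) = n - dim (C K)} = {J \<in> D. (K, J) \<in> leq \<Delta>}"
  proof -
    have "quot_dim W (cone_of (projected \<Delta> K) J) = 1 \<longleftrightarrow> dim (C J) = n" if "(K, J) \<in> leq \<Delta>" for J
      unfolding qdim[OF that] using dim_le[of J] n0 by linarith
    moreover have "n - dim (C K) = 1" using n0 dimK by simp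
    ultimately show ?thesis using leq_idx by (auto simp: projected_def of_dim_def)
  qed
  have "pre_complete_in (quot W) (quot_span W) (quot_dim W) (n - dim (C K)) (projected \<Delta> K)"
    using complete K(1) unfolding complete_multi_fan_def Let_def W_def by blast
  then obtain d where d: "\<And>v. v \<in> quot W \<Longrightarrow> generic_in (quot_span W) (quot_dim W) (n - dim (C K)) (projected \<Delta> K) v \<Longrightarrow>
      (\<Sum>I | I \<in> idx (projected \<Delta> K) \<and> quot_dim W (cone_of (projected \<Delta> K) I) = n - dim (C K) \<and>
        v \<in> cone_of (projected \<Delta> K) I. weight (projected \<Delta> K) I) = d"
    unfolding pre_complete_in_def by blast
  have inW: "x \<in> W \<longleftrightarrow> U J0 i0 x = 0" for x
    unfolding W_def span_C[OF K(1)] K(2) using span_facet[OF J0(1,2)] .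
  \<comment> \<open>A projected cone of dimension below 1 comes from a cone whose span is
    \<open>W\<close>, so its linear hull is the zero coset; every other coset is generic.\<close>
  have gen: "generic_in (quot_span W) (quot_dim W) (n - dim (C K)) (projected \<Delta> K) (q +o W)" if q: "q \<notin> W" for q
    unfolding generic_in_def
  proof (intro ballI impI notI)
    fix J assume J: "J \<in> idx (projected \<Delta> K)" "quot_dim W (cone_of (projected \<Delta> K) J) < n - dim (C K)"
      and "q +o W \<in> quot_span W (cone_of (projected \<Delta> K) J)"
    then have KJ: "(K, J) \<in> leq \<Delta>" by (simp add: projected_def)
    have "dim (C J) \<le> dim W" using J(2) unfolding qdim[OF KJ] dimK dimW by linarith
    moreover have "W \<subseteq> span (C J)" unfolding W_def using leq_face[OF KJ] by (intro span_mono) (simp add: face_of_def)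
    ultimately have WJ: "W = span (C J)"
      using fd.subspace_dim_equal[of W "span (C J)"] unfolding W_def by simp
    have "quot_span W (cone_of (projected \<Delta> K) J) = (\<lambda>x. x +o W) ` W"
      unfolding quot_span_def projected_def using Union_cosets_span[OF KJ W_def] WJ by (simp add: W_def)
    then obtain x where x: "x \<in> W" "q +o W = x +o W" using \<open>q +o W \<in> _\<close> by auto
    have "0 \<in> W" unfolding W_def by (rule span_zero)
    then have "q \<in> q +o W" by (force simp: elt_set_plus_def)
    then obtain y where "y \<in> W" "q = x + y" unfolding x(2) by (auto simp: elt_set_plus_def)
    then show False using q x(1) unfolding W_def by (simp add: span_add)
  qed
  \<comment> \<open>\<open>d\<close> does not depend on \<open>q\<close>, so the two sides of the
    facet can be compared by taking \<open>p\<close> and \<open>- p\<close>.\<close>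
  have side: "(\<Sum>(J, i)\<in>Q. weight \<Delta> J * of_bool (0 < U J i q)) = d"
    if q: "\<And>J i. J \<in> D \<Longrightarrow> i \<in> V J \<Longrightarrow> U J i q \<noteq> 0" for q
  proof -
    have "q \<notin> W" using inW q J0 by simp
    have "(\<Sum>(J, i)\<in>Q. weight \<Delta> J * of_bool (0 < U J i q)) =
        (\<Sum>x\<in>Q. weight \<Delta> (fst x) * of_bool (q +o W \<in> (\<lambda>x. x +o W) ` C (fst x)))"
    proof (rule sum.cong[OF refl])
      fix x assume "x \<in> Q"
      then obtain J i where x: "x = (J, i)" "J \<in> D" "i \<in> V J" "facet J i = K" unfolding Q_def by auto
      then show "(case x of (J, i) \<Rightarrow> weight \<Delta> J * of_bool (0 < U J i q)) =
          weight \<Delta> (fst x) * of_bool (q +o W \<in> (\<lambda>x. x +o W) ` C (fst x))"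
        using coset_in_cone[OF x(2,3), of W q] q W_def by simp
    qed
    also have "\<dots> = (\<Sum>J | J \<in> D \<and> (K, J) \<in> leq \<Delta>. weight \<Delta> J * of_bool (q +o W \<in> (\<lambda>x. x +o W) ` C J))"
      unfolding Q_def by (rule sum.reindex_bij_betw[OF facet_cofaces[OF J0(1,2) J0(3)[symmetric]]])
    also have "\<dots> = (\<Sum>I | I \<in> idx (projected \<Delta> K) \<and> quot_dim W (cone_of (projected \<Delta> K) I) = n - dim (C K) \<and>
        q +o W \<in> cone_of (projected \<Delta> K) I. weight (projected \<Delta> K) I)"
    proof -
      have eq: "{I. I \<in> idx (projected \<Delta> K) \<and> quot_dim W (cone_of (projected \<Delta> K) I) = n - dim (C K) \<and>
        q +o W \<in> cone_of (projected \<Delta> K) I} = {J \<in> {J \<in> D. (K, J) \<in> leq \<Delta>}. q +o W \<in> (\<lambda>x. x +o W) ` C J}"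
        unfolding S1[symmetric] by (auto simp: projected_def W_def)
      have fin: "finite {J \<in> D. (K, J) \<in> leq \<Delta>}" using finite_idx by (auto simp: of_dim_def)
      show ?thesis
        unfolding eq sum.inter_filter[OF fin] by (intro sum.cong refl) (simp add: weight_def projected_def)
    qed
    also have "\<dots> = d" by (rule d) (use gen[OF \<open>q \<notin> W\<close>] in \<open>auto simp: quot_def\<close>)
    finally show ?thesis .
  qed
  have neg: "U J i (- p) = - U J i p" if "J \<in> D" for J i
    using dual_vec(1)[OF that] by (rule linear_neg)
  \<comment> \<open>For a nonzero coordinate, the sign is the indicator of the positive side minus
    that of the negative side.\<close>
  have "(\<Sum>(J, i)\<in>Q. of_int (weight \<Delta> J) * sgn (U J i p)) =
     (\<Sum>(J, i)\<in>Q. real_of_int (weight \<Delta> J * of_bool (0 < U J i p)) - of_int (weight \<Delta> J * of_bool (0 < U J i (- p))))"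
    by (rule sum.cong[OF refl]) (use p neg in \<open>auto simp: Q_def sgn_if\<close>)
  also have "\<dots> = of_int (\<Sum>(J, i)\<in>Q. weight \<Delta> J * of_bool (0 < U J i p)) -
      of_int (\<Sum>(J, i)\<in>Q. weight \<Delta> J * of_bool (0 < U J i (- p)))"
    by (simp add: sum_subtractf case_prod_unfold)
  also have "\<dots> = 0" using side[of p] side[of "- p"] p neg by simp
  finally show ?thesis unfolding Q_def .
qed

sublocale balanced_cones D V e U "weight \<Delta>" facet
proof (rule balanced_cones.intro)
  show "finite D" using finite_idx by (auto simp: of_dim_def)
next
  fix J show "finite (V J)" by (rule finite_verts)
next
  fix J i assume "J \<in> D"
  then show "linear (U J i)" by (rule dual_vec(1))
next
  fix J i j assume "J \<in> D" "j \<in> V J"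
  then show "U J i (e j) = (if j = i then 1 else 0)" by (rule dual_vec(2))
next
  fix J x assume "J \<in> D"
  then show "(\<Sum>i\<in>V J. U J i x *\<^sub>R e i) = x" by (rule dual_vec_expand)
next
  fix J i assume "J \<in> D"
  then show "V (facet J i) = V J - {i}" using facet(2) D_idx by blast
qed (rule facet_balance)

lemma generic_regular: "generic n \<Delta> v \<Longrightarrow> regular v"
  using generic_dual_vec_nonzero unfolding regular_def by blast

text \<open>Removing the integer parts of the coordinates moves a lattice vector, within its coset,
  into the parallelepiped spanned by the \<open>e i\<close>, which contains finitely many lattice
  vectors.\<close>

lemma finite_quot_group:
  assumes J: "J \<in> D"
  shows "finite (quot_group N \<Delta> J)"
proof -
  define R where "R = {x \<in> N. \<forall>b\<in>B. \<bar>representation B x b\<bar> \<le> (\<Sum>i\<in>V J. \<bar>representation B (e i) b\<bar>)}"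
  have "quot_group N \<Delta> J \<subseteq> (\<lambda>x. x +o sublat N \<Delta> J) ` R"
  proof
    fix g assume "g \<in> quot_group N \<Delta> J"
    then obtain x where x: "x \<in> N" "g = x +o sublat N \<Delta> J" by (auto simp: quot_group_def)
    define y where "y = (\<Sum>i\<in>V J. of_int \<lfloor>U J i x\<rfloor> *\<^sub>R e i)"
    have xy: "x - y = (\<Sum>i\<in>V J. frac (U J i x) *\<^sub>R e i)"
      unfolding y_def
      by (subst (1) dual_vec_expand[OF J, of x, symmetric]) (simp add: frac_def scaleR_diff_left sum_subtractf)
    interpret L: lattice_basis "e ` V J" "sublat N \<Delta> J"
      by unfold_locales (use finite_verts verts_generate[OF D_idx[OF J]] span_verts[OF J] in \<open>auto simp: sublat_def\<close>)
    have "e i \<in> sublat N \<Delta> J" if "i \<in> V J" for i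
      unfolding sublat_def using that by (auto intro: group_closure.base)
    then have y1: "y \<in> sublat N \<Delta> J"
      unfolding y_def by (intro L.N_sum L.N_of_int_scale)
    have "y \<in> N"
      unfolding y_def using prim_in_N[of J] by (intro N_sum N_of_int_scale) auto
    then have "x - y \<in> N" using x N_diff by blast
    moreover have "\<bar>representation B (x - y) b\<bar> \<le> (\<Sum>i\<in>V J. \<bar>representation B (e i) b\<bar>)" for b
    proof -
      have "representation B (x - y) b = (\<Sum>i\<in>V J. frac (U J i x) * representation B (e i) b)"
        unfolding xy by (simp add: linear_sum[OF lin_coord] linear_scale[OF lin_coord])
      also have "\<bar>\<dots>\<bar> \<le> (\<Sum>i\<in>V J. \<bar>frac (U J i x) * representation B (e i) b\<bar>)" by (rule sum_abs)
      also have "\<dots> \<le> (\<Sum>i\<in>V J. \<bar>representation B (e i) b\<bar>)"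
      proof (rule sum_mono)
        fix i
        have "\<bar>frac (U J i x)\<bar> \<le> 1" using frac_lt_1[of "U J i x"] by simp
        then show "\<bar>frac (U J i x) * representation B (e i) b\<bar> \<le> \<bar>representation B (e i) b\<bar>"
          unfolding abs_mult by (intro mult_left_le_one_le) auto
      qed
      finally show ?thesis .
    qed
    ultimately have "x - y \<in> R" by (simp add: R_def)
    moreover have "x +o sublat N \<Delta> J = (x - y) +o sublat N \<Delta> J"
      using y1 unfolding sublat_def coset_closure_eq_iff by simp
    ultimately show "g \<in> (\<lambda>x. x +o sublat N \<Delta> J) ` R" using x by blast
  qed
  moreover have "finite R" unfolding R_def by (rule finite_N_bounded)
  ultimately show ?thesis by (meson finite_surj)
qed

end

section \<open>Lattice multi-polytopes\<close>

text \<open>If \<open>y\<close> were not a multiple of \<open>x\<close>, the value at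
  \<open>y\<close> could be prescribed independently of the value at \<open>x\<close>, so it would
  take the values 0 and 1 on the hyperplane.\<close>

lemma constant_on_hyperplane_parallel:
  fixes x y :: "'a::real_vector"
  assumes x: "x \<noteq> 0" and const: "(\<lambda>u. u y) constant_on {u \<in> dual_space. u x = c}"
  shows "\<exists>k. y = k *\<^sub>R x"
proof (rule ccontr)
  assume "\<not> ?thesis"
  then have "y \<notin> span {x}" by (auto simp: span_singleton)
  then have indep: "independent {y, x}" and "y \<noteq> x"
    using x span_base[of x "{x}"] by (auto simp: independent_insert)
  have "\<exists>u. linear u \<and> u x = c \<and> u y = r" for r :: real
    using linear_independent_extend[OF indep, of "\<lambda>z. if z = x then c else r"] \<open>y \<noteq> x\<close> by auto
  then obtain u u' where "linear u" "u x = c" "u y = 0" "linear u'" "u' x = c" "u' y = (1 :: real)" by metis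
  then have "u \<in> {u \<in> dual_space. u x = c}" "u' \<in> {u \<in> dual_space. u x = c}" "u y \<noteq> u' y"
    by (auto simp: dual_space_def)
  moreover obtain r where "\<And>u. u \<in> {u \<in> dual_space. u x = c} \<Longrightarrow> u y = r"
    using const unfolding constant_on_def by auto
  ultimately show False by metis
qed

context complete_simplicial_fan
begin

text \<open>The normal vector in \<open>affine_hyperplane\<close> is arbitrary; constancy of the
  pairing with \<open>e i\<close> makes it parallel to \<open>e i\<close>, so the equation can be
  rescaled.\<close>

lemma hyperplane_level:
  assumes F: "multi_polytope n N \<Delta> F" and i: "i \<in> of_dim \<Delta> 1"
  shows "F i = {u \<in> dual_space. u (e i) = level N \<Delta> F i}"
proof -
  have r: "C i = nonneg_hull {e i}" "e i \<noteq> 0"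
    using ray_prim[OF i] by (auto simp: primitive_vector_def)
  have "affine_hyperplane (F i)" using F i by (simp add: multi_polytope_def)
  then obtain x c where x: "x \<noteq> 0" "F i = {u \<in> dual_space. u x = c}"
    unfolding affine_hyperplane_def by (elim exE conjE)
  have "e i \<in> C i" using subset_nonneg_hull[of "{e i}"] r(1) by simp
  moreover have "\<forall>x\<in>C i. (\<lambda>u. u x) constant_on F i" using F i by (simp add: multi_polytope_def)
  ultimately have "(\<lambda>u. u (e i)) constant_on F i" by (rule bspec[rotated])
  then have "(\<lambda>u. u (e i)) constant_on {u \<in> dual_space. u x = c}" unfolding x(2) .
  from constant_on_hyperplane_parallel[OF x(1) this]
  obtain k where k: "e i = k *\<^sub>R x" by (elim exE)
  have "k \<noteq> 0" using k r(2) by auto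
  have Fk: "F i = {u \<in> dual_space. u (e i) = k * c}"
    unfolding x(2) k using \<open>k \<noteq> 0\<close> by (auto simp: dual_space_def linear_scale)
  \<comment> \<open>\<open>level\<close> is a definite description; a point of the hyperplane shows
    that the constant is unique.\<close>
  have "c' = k * c" if c': "F i = {u \<in> dual_space. u (e i) = c'}" for c'
  proof -
    obtain u :: "'a \<Rightarrow> real" where u: "linear u" "u (e i) = k * c"
      using linear_independent_extend[of "{e i}" "\<lambda>_. k * c"] r(2) by auto
    then have "u \<in> F i" unfolding Fk by (simp add: dual_space_def)
    then show ?thesis using u unfolding c' by simp
  qed
  then have "level N \<Delta> F i = k * c" unfolding level_def using Fk by (intro the_equality) auto
  then show ?thesis using Fk by simp
qed

lemma vertex:
  assumes J: "J \<in> D" and F: "\<And>i. i \<in> V J \<Longrightarrow> F i = {u \<in> dual_space. u (e i) = c i}"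
  shows "vertex \<Delta> F J \<in> dual_space" "i \<in> V J \<Longrightarrow> vertex \<Delta> F J (e i) = c i"
proof -
  have "vertex \<Delta> F J = (THE u. u \<in> dual_space \<and> (\<forall>i\<in>V J. u (e i) = c i))"
    unfolding vertex_def using F by (intro arg_cong[where f = The] ext) auto
  then have "vertex \<Delta> F J \<in> dual_space \<and> (\<forall>i\<in>V J. vertex \<Delta> F J (e i) = c i)"
    using theI'[OF dual_vec_unique[OF J, of c]] by simp
  then show "vertex \<Delta> F J \<in> dual_space" "i \<in> V J \<Longrightarrow> vertex \<Delta> F J (e i) = c i" by auto
qed

text \<open>The coordinate of \<open>u\<close> along the \<open>i\<close>-th generator is
  \<open>(u (e i) - c i) * sgn (U J i x)\<close>. Off the hyperplanes it is not 0, so the closed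
  cone is described by strict inequalities, in which the sign may be replaced by
  \<open>U J i x\<close>.\<close>

lemma in_vertex_cone_iff:
  assumes J: "J \<in> D" and F: "\<And>i. i \<in> V J \<Longrightarrow> F i = {u \<in> dual_space. u (e i) = c i}"
    and x: "regular x" and u: "linear u" "\<And>i. i \<in> V J \<Longrightarrow> u (e i) \<noteq> c i"
  shows "u \<in> vertex_cone N \<Delta> F x J \<longleftrightarrow> (\<forall>i\<in>V J. 0 < (u (e i) - c i) * U J i x)"
proof -
  define \<sigma> where "\<sigma> = (\<lambda>i. sgn (U J i x))"
  have Ux: "U J i x \<noteq> 0" if "i \<in> V J" for i using x J that by (simp add: regular_def)
  have pos: "pos_vec N \<Delta> x J i y = \<sigma> i * U J i y" if "i \<in> V J" for i y
    using Ux[OF that] by (auto simp: pos_vec_def \<sigma>_def sgn_if)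
  define p where "p = (\<lambda>t y. vertex \<Delta> F J y + (\<Sum>i\<in>V J. t i * pos_vec N \<Delta> x J i y))"
  have p_eq: "p t y = vertex \<Delta> F J y + (\<Sum>i\<in>V J. (t i * \<sigma> i) * U J i y)" for t y
    unfolding p_def by (simp add: pos mult.assoc)
  have lin: "linear (p t)" for t
    unfolding p_eq[abs_def] using vertex(1)[OF J F] dual_vec(1)[OF J]
    by (intro linear_compose_add linear_combination) (auto simp: dual_space_def)
  have p_e: "p t (e j) = c j + t j * \<sigma> j" if j: "j \<in> V J" for t j
  proof -
    have "(\<Sum>i\<in>V J. (t i * \<sigma> i) * U J i (e j)) = (\<Sum>i\<in>V J. if i = j then t i * \<sigma> i else 0)"
      using dual_vec(2)[OF J j] by (intro sum.cong) auto
    then show ?thesis unfolding p_eq using vertex(2)[OF J F j] j finite_verts by simp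
  qed
  have cone: "u \<in> vertex_cone N \<Delta> F x J \<longleftrightarrow> (\<exists>t. u = p t \<and> (\<forall>i\<in>V J. 0 \<le> t i))"
    unfolding vertex_cone_def p_def by blast
  show ?thesis
  proof
    assume "u \<in> vertex_cone N \<Delta> F x J"
    then obtain t where t: "u = p t" "\<forall>i\<in>V J. 0 \<le> t i" using cone by blast
    show "\<forall>i\<in>V J. 0 < (u (e i) - c i) * U J i x"
    proof
      fix i assume i: "i \<in> V J"
      have "u (e i) - c i = t i * \<sigma> i" using p_e[OF i] t(1) by simp
      moreover have "t i > 0" using u(2)[OF i] t(2) i p_e[OF i, of t] t(1) by (auto simp: order_le_less)
      moreover have "\<sigma> i * U J i x > 0" using Ux[OF i] by (simp add: \<sigma>_def sgn_if)
      ultimately show "0 < (u (e i) - c i) * U J i x" by (simp add: mult.assoc)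
    qed
  next
    assume *: "\<forall>i\<in>V J. 0 < (u (e i) - c i) * U J i x"
    define t where "t = (\<lambda>i. (u (e i) - c i) * \<sigma> i)"
    have "0 \<le> t i" if "i \<in> V J" for i
      using * that by (auto simp: t_def \<sigma>_def sgn_if zero_less_mult_iff)
    moreover have "u y = p t y" if "y \<in> e ` V J" for y
    proof -
      obtain i where i: "i \<in> V J" "y = e i" using \<open>y \<in> e ` V J\<close> by blast
      have "\<sigma> i * \<sigma> i = 1" using Ux[OF i(1)] by (simp add: \<sigma>_def sgn_if)
      then show ?thesis using i p_e[OF i(1), of t] by (simp add: t_def mult.assoc)
    qed
    then have "u y = p t y" for y
      using linear_eq_on_span[OF u(1) lin[of t], of "e ` V J" y] span_verts[OF J] by auto
    ultimately show "u \<in> vertex_cone N \<Delta> F x J" using cone by blast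
  qed
qed

lemma DH_eq_cone_sum:
  assumes F: "\<And>J i. J \<in> D \<Longrightarrow> i \<in> V J \<Longrightarrow> F i = {u \<in> dual_space. u (e i) = c i}"
    and x: "regular x" and u: "linear u" "\<And>J i. J \<in> D \<Longrightarrow> i \<in> V J \<Longrightarrow> u (e i) \<noteq> c i"
  shows "DH n N \<Delta> F x u = cone_sum c x u"
  unfolding DH_def cone_sum_def
proof (rule sum.cong[OF refl])
  fix J assume J: "J \<in> D"
  have "indicator (vertex_cone N \<Delta> F x J) u = (of_bool (\<forall>i\<in>V J. 0 < (u (e i) - c i) * U J i x) :: int)"
    using in_vertex_cone_iff[OF J F[OF J] x u(1) u(2)[OF J]] by (simp add: indicator_def)
  then show "(- 1) ^ card {i \<in> V J. U J i x > 0} * weight \<Delta> J * indicator (vertex_cone N \<Delta> F x J) u =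
      (- 1) ^ card {i \<in> V J. U J i x > 0} * weight \<Delta> J * of_bool (\<forall>i\<in>V J. 0 < (u (e i) - c i) * U J i x)"
    by simp
qed

end

theorem lemma7p3:
  fixes N :: "'a::real_vector set"
    and n :: nat
    and \<Delta> :: "('s, 'a) multi_fan"
    and F :: "'s \<Rightarrow> ('a \<Rightarrow> real) set"
    and v :: 'a
  assumes "lattice_of_rank n N"
    and "simple_multi_polytope n N \<Delta> F"
    and "lattice_multi_polytope n N \<Delta> F"
    and "v \<in> N"
    and "\<forall>I\<in>of_dim \<Delta> n. \<forall>i\<in>verts \<Delta> I. dual_vec N \<Delta> I i v \<in> \<int> \<and> dual_vec N \<Delta> I i v \<noteq> 0"
  shows "\<forall>\<^sub>F \<epsilon> in at_right 0. \<forall>v'. generic n \<Delta> v' \<longrightarrow>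
    (let DHp = DH n N \<Delta> (moved N \<Delta> \<epsilon> F) v' in
       finite {u \<in> dual_lattice N. DHp u \<noteq> 0} \<and>
       (\<forall>z::complex.
          z \<noteq> 0 \<and>
          (\<forall>I\<in>of_dim \<Delta> n. \<forall>g\<in>quot_group N \<Delta> I. \<forall>i\<in>verts \<Delta> I.
             1 - chi (dual_vec N \<Delta> I i) g * zpow z (- dual_vec N \<Delta> I i v) \<noteq> 0) \<longrightarrow>
          (\<Sum>I\<in>of_dim \<Delta> n.
             of_int (weight \<Delta> I) * zpow z (vertex \<Delta> F I v) / of_nat (card (quot_group N \<Delta> I)) *
             (\<Sum>g\<in>quot_group N \<Delta> I.
                1 / (\<Prod>i\<in>verts \<Delta> I.
                       1 - chi (dual_vec N \<Delta> I i) g * zpow z (- dual_vec N \<Delta> I i v)))) =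
          (\<Sum>u | u \<in> dual_lattice N \<and> DHp u \<noteq> 0. of_int (DHp u) * zpow z (u v))))"
proof (rule eventually_at_rightI[of 0 1])
  \<comment> \<open>The bound 1 suffices: the vertices take integer values at the primitive vectors,
    so a shift strictly between 0 and 1 keeps the hyperplanes of the maximal cones off the dual
    lattice.\<close>
  fix \<epsilon> :: real assume "\<epsilon> \<in> {0<..<1}"
  then have \<epsilon>: "0 < \<epsilon>" "\<epsilon> < 1" by auto
  obtain B where B: "finite B" "card B = n" "independent B" "span B = UNIV" "N = group_closure B"
    using assms(1) unfolding lattice_of_rank_def by blast
  have mp: "multi_polytope n N \<Delta> F" and simp_fan: "simplicial_fan \<Delta>"
    using assms(2) by (auto simp: simple_multi_polytope_def)
  interpret complete_simplicial_fan B N n \<Delta>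
    by unfold_locales (use B mp simp_fan in \<open>auto simp: multi_polytope_def\<close>)
  define c where "c = (\<lambda>i. level N \<Delta> F i + \<epsilon>)"
  have dim1: "i \<in> of_dim \<Delta> 1" if "i \<in> V J" for i J using that by (simp add: verts_def)
  have F: "F i = {u \<in> dual_space. u (e i) = level N \<Delta> F i}" if "i \<in> V J" for i J
    using hyperplane_level[OF mp dim1[OF that]] .
  have F\<epsilon>: "moved N \<Delta> \<epsilon> F i = {u \<in> dual_space. u (e i) = c i}" for i
    by (simp add: moved_def c_def)
  have vertex_lattice: "vertex \<Delta> F J \<in> dual_lattice N" if "J \<in> D" for J
    using assms(3) that by (simp add: lattice_multi_polytope_def)
  have c: "c i = vertex \<Delta> F J (e i) + \<epsilon>" if "J \<in> D" "i \<in> V J" for J i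
    using vertex(2)[of J F "level N \<Delta> F", OF that(1) F that(2)] by (simp add: c_def)
  have off: "u (e i) \<noteq> c i" if u: "u \<in> dual_lattice N" and J: "J \<in> D" "i \<in> V J" for u J i
  proof
    assume "u (e i) = c i"
    then have "\<epsilon> = u (e i) - vertex \<Delta> F J (e i)" using c[OF J] by simp
    also have "\<dots> \<in> \<int>" using u vertex_lattice[OF J(1)] prim_in_N[of J] J(2) by (auto simp: dual_lattice_def)
    finally show False using \<epsilon> by (auto elim: Ints_cases)
  qed
  show "\<forall>v'. generic n \<Delta> v' \<longrightarrow>
    (let DHp = DH n N \<Delta> (moved N \<Delta> \<epsilon> F) v' in
       finite {u \<in> dual_lattice N. DHp u \<noteq> 0} \<and>
       (\<forall>z::complex.
          z \<noteq> 0 \<and>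
          (\<forall>I\<in>of_dim \<Delta> n. \<forall>g\<in>quot_group N \<Delta> I. \<forall>i\<in>verts \<Delta> I.
             1 - chi (dual_vec N \<Delta> I i) g * zpow z (- dual_vec N \<Delta> I i v) \<noteq> 0) \<longrightarrow>
          (\<Sum>I\<in>of_dim \<Delta> n.
             of_int (weight \<Delta> I) * zpow z (vertex \<Delta> F I v) / of_nat (card (quot_group N \<Delta> I)) *
             (\<Sum>g\<in>quot_group N \<Delta> I.
                1 / (\<Prod>i\<in>verts \<Delta> I.
                       1 - chi (dual_vec N \<Delta> I i) g * zpow z (- dual_vec N \<Delta> I i v)))) =
          (\<Sum>u | u \<in> dual_lattice N \<and> DHp u \<noteq> 0. of_int (DHp u) * zpow z (u v))))"
  proof (intro allI impI)
    fix v' assume "generic n \<Delta> v'"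
    then have x: "regular v'" by (rule generic_regular)
    have DH: "DH n N \<Delta> (moved N \<Delta> \<epsilon> F) v' u = cone_sum c v' u" if u: "u \<in> dual_lattice N" for u
      by (rule DH_eq_cone_sum[OF F\<epsilon> x _ off[OF u]]) (use u in \<open>auto simp: dual_lattice_def dual_space_def\<close>)
    have supp: "{u \<in> dual_lattice N. DH n N \<Delta> (moved N \<Delta> \<epsilon> F) v' u \<noteq> 0} = {u \<in> dual_lattice N. cone_sum c v' u \<noteq> 0}"
      using DH by auto
    have G: "quot_group N \<Delta> J = (\<lambda>x. x +o group_closure (e ` V J)) ` N" for J
      by (simp add: quot_group_def sublat_def)
    have int: "U J i v \<in> \<int> \<and> U J i v \<noteq> 0" if "J \<in> D" "i \<in> V J" for J i using assms(5) that by blast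
    note identity = lattice_point_identity[where G = "quot_group N \<Delta>" and apex = "vertex \<Delta> F" and v = v,
      OF finite_B span_B N_def card_verts prim_in_N G finite_quot_group vertex_lattice \<epsilon> c assms(4) int x]
    have rhs: "(\<Sum>u | u \<in> dual_lattice N \<and> DH n N \<Delta> (moved N \<Delta> \<epsilon> F) v' u \<noteq> 0.
        of_int (DH n N \<Delta> (moved N \<Delta> \<epsilon> F) v' u) * zpow z (u v)) =
      (\<Sum>u | u \<in> dual_lattice N \<and> cone_sum c v' u \<noteq> 0. of_int (cone_sum c v' u) * zpow z (u v))" for z
      unfolding supp by (rule sum.cong) (use DH in auto)
    show "let DHp = DH n N \<Delta> (moved N \<Delta> \<epsilon> F) v' in
       finite {u \<in> dual_lattice N. DHp u \<noteq> 0} \<and>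
       (\<forall>z::complex.
          z \<noteq> 0 \<and>
          (\<forall>I\<in>of_dim \<Delta> n. \<forall>g\<in>quot_group N \<Delta> I. \<forall>i\<in>verts \<Delta> I.
             1 - chi (dual_vec N \<Delta> I i) g * zpow z (- dual_vec N \<Delta> I i v) \<noteq> 0) \<longrightarrow>
          (\<Sum>I\<in>of_dim \<Delta> n.
             of_int (weight \<Delta> I) * zpow z (vertex \<Delta> F I v) / of_nat (card (quot_group N \<Delta> I)) *
             (\<Sum>g\<in>quot_group N \<Delta> I.
                1 / (\<Prod>i\<in>verts \<Delta> I.
                       1 - chi (dual_vec N \<Delta> I i) g * zpow z (- dual_vec N \<Delta> I i v)))) =
          (\<Sum>u | u \<in> dual_lattice N \<and> DHp u \<noteq> 0. of_int (DHp u) * zpow z (u v)))"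
      unfolding Let_def unfolding rhs unfolding supp
    proof (intro conjI allI impI)
      show "finite {u \<in> dual_lattice N. cone_sum c v' u \<noteq> 0}" by (rule identity(1))
    next
      fix z :: complex
      assume z: "z \<noteq> 0 \<and>
          (\<forall>I\<in>of_dim \<Delta> n. \<forall>g\<in>quot_group N \<Delta> I. \<forall>i\<in>verts \<Delta> I.
             1 - chi (dual_vec N \<Delta> I i) g * zpow z (- dual_vec N \<Delta> I i v) \<noteq> 0)"
      show "(\<Sum>I\<in>of_dim \<Delta> n.
             of_int (weight \<Delta> I) * zpow z (vertex \<Delta> F I v) / of_nat (card (quot_group N \<Delta> I)) *
             (\<Sum>g\<in>quot_group N \<Delta> I.
                1 / (\<Prod>i\<in>verts \<Delta> I.
                       1 - chi (dual_vec N \<Delta> I i) g * zpow z (- dual_vec N \<Delta> I i v)))) =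
          (\<Sum>u | u \<in> dual_lattice N \<and> cone_sum c v' u \<noteq> 0. of_int (cone_sum c v' u) * zpow z (u v))"
        by (rule identity(2)) (use z in blast)+
    qed
  qed
qed simp

end
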